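(* Let $(X,\mu_{uv})$ be a countable, connected, symmetrically weighted graph satisfying $V(D_X,r_0)$ and $P(P_X,r_0)$ for some $r_0\in(0,\infty]$, and let $P$ be the associated Markov operator. Let $k\ge1$ and $l\ge0$ be integers. Suppose that the spectrum of $P$ on $\ell^2(X,m)$ satisfies $\sigma(P)\subset(a,1]$ with $a\in(-1,1)$ and $(1-a)/2<2^{-1+1/k}$. Then there exist constants $C_5,c_5>0$ such that for every integer $n\ge1$ with $r:=n^{1/2k}<r_0$ and all $u,v\in X$, $$\bigl|(I-P)^l(I-(I-P)^k)^n(u,v)\bigr|\le\frac{C_5\,m(v)}{n^{l/k}\sqrt{m(B_r(u))\,m(B_r(v))}}\exp\left(-c_5\left(\frac{d_X(u,v)}{n^{1/2k}}\right)^{2k/(2k-1)}\right).$$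
   Context: Graph: $X$ is a countable set with a symmetric weight $\mu_{uv}=\mu_{vu}\ge0$; $u\sim v$ iff $\mu_{uv}>0$; the graph is connected; $m(u)=\sum_v\mu_{uv}\in(0,\infty)$, $m(E)=\sum_{u\in E}m(u)$; $d_X$ is the shortest-path distance and $B_r(u)=\{v:d_X(u,v)<r\}$. $|\nabla_X h(u)|^2=\frac1{m(u)}\sum_v\mu_{uv}(h(u)-h(v))^2$. $V(D_X,r_0)$: $m(B_{2r}(u))\le D_X\,m(B_r(u))$ for all $u\in X$, $0<r<r_0$. $P(P_X,r_0)$: $\sum_{v\in B_r(u)}|f(v)-f_{u,r}|^2m(v)\le P_Xr^2\sum_{v\in B_{2r}(u)}|\nabla_Xf(v)|^2m(v)$ for all $f:X\to\mathbb R$, $u\in X$, $0<r<r_0$, where $f_{u,r}$ is the $m$-average of $f$ over $B_r(u)$. Markov kernel: $P(u,v)=\mu_{uv}/m(u)$, acting as the self-adjoint operator $Pf(u)=\sum_vP(u,v)f(v)$ on $\ell^2(X,m)$; $P^n(u,v)$ denotes the $n$-step (matrix power) kernel. For a polynomial $K=\sum_ia_iP^i$ in $P$, $K(u,v)=\sum_ia_iP^i(u,v)$ denotes its matrix entry, so $Kf(u)=\sum_vK(u,v)f(v)$. The exponent $1/2k$ means $1/(2k)$. *)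

theory Defs
  imports "HOL-Analysis.Analysis" "HOL-Computational_Algebra.Polynomial"
begin

text \<open>The vertex set is a whole type of class \<open>countable\<close>. Vertices may have infinitely many
  neighbours and loops are allowed, as long as the total weight at each vertex is finite.\<close>

definition vweight :: "('a \<Rightarrow> 'a \<Rightarrow> real) \<Rightarrow> 'a \<Rightarrow> real" where
  "vweight \<mu> u = (\<Sum>\<^sub>\<infinity>v. \<mu> u v)"

definition adj :: "('a \<Rightarrow> 'a \<Rightarrow> real) \<Rightarrow> 'a \<Rightarrow> 'a \<Rightarrow> bool" where
  "adj \<mu> u v \<longleftrightarrow> 0 < \<mu> u v"

definition weighted_graph :: "('a::countable \<Rightarrow> 'a \<Rightarrow> real) \<Rightarrow> bool" where
  "weighted_graph \<mu> \<longleftrightarrow>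
     (\<forall>u v. \<mu> u v = \<mu> v u) \<and>
     (\<forall>u v. 0 \<le> \<mu> u v) \<and>
     (\<forall>u. (\<lambda>v. \<mu> u v) summable_on UNIV \<and> 0 < vweight \<mu> u) \<and>
     (\<forall>u v. (adj \<mu>)\<^sup>*\<^sup>* u v)"

definition gdist :: "('a \<Rightarrow> 'a \<Rightarrow> real) \<Rightarrow> 'a \<Rightarrow> 'a \<Rightarrow> nat" where
  "gdist \<mu> u v = (LEAST n. (adj \<mu> ^^ n) u v)"

definition gball :: "('a \<Rightarrow> 'a \<Rightarrow> real) \<Rightarrow> real \<Rightarrow> 'a \<Rightarrow> 'a set" where
  "gball \<mu> r u = {v. real (gdist \<mu> u v) < r}"

text \<open>The measure and the two sides of the Poincare inequality take values in \<open>ennreal\<close>, where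
  every sum of nonnegative terms exists, so no divergent sum is silently replaced by \<open>0\<close>.\<close>

definition gmeasure :: "('a \<Rightarrow> 'a \<Rightarrow> real) \<Rightarrow> 'a set \<Rightarrow> ennreal" where
  "gmeasure \<mu> E = (\<Sum>\<^sub>\<infinity>u\<in>E. ennreal (vweight \<mu> u))"

definition grad_sq :: "('a \<Rightarrow> 'a \<Rightarrow> real) \<Rightarrow> ('a \<Rightarrow> real) \<Rightarrow> 'a \<Rightarrow> ennreal" where
  "grad_sq \<mu> h u = (\<Sum>\<^sub>\<infinity>v. ennreal (\<mu> u v * (h u - h v)\<^sup>2)) / ennreal (vweight \<mu> u)"

text \<open>The average is meaningful only if \<open>f\<close> is summable over a ball of finite measure. If the
  doubling condition below holds with \<open>r\<^sub>0 > 1/2\<close>, adjacent vertices have comparable weights, so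
  the graph is locally finite and every ball is finite. If \<open>r\<^sub>0 \<le> 1\<close>, every ball of radius
  \<open>r < r\<^sub>0\<close> is a singleton. So the value in degenerate cases is irrelevant under doubling.\<close>

definition gavg :: "('a \<Rightarrow> 'a \<Rightarrow> real) \<Rightarrow> ('a \<Rightarrow> real) \<Rightarrow> 'a \<Rightarrow> real \<Rightarrow> real" where
  "gavg \<mu> f u r =
     (\<Sum>\<^sub>\<infinity>v\<in>gball \<mu> r u. f v * vweight \<mu> v) / enn2real (gmeasure \<mu> (gball \<mu> r u))"

definition doubling :: "('a \<Rightarrow> 'a \<Rightarrow> real) \<Rightarrow> real \<Rightarrow> ereal \<Rightarrow> bool" where
  "doubling \<mu> D r0 \<longleftrightarrow>
     (\<forall>u r. 0 < r \<and> ereal r < r0 \<longrightarrow>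
        gmeasure \<mu> (gball \<mu> (2 * r) u) \<le> ennreal D * gmeasure \<mu> (gball \<mu> r u))"

definition poincare :: "('a \<Rightarrow> 'a \<Rightarrow> real) \<Rightarrow> real \<Rightarrow> ereal \<Rightarrow> bool" where
  "poincare \<mu> C r0 \<longleftrightarrow>
     (\<forall>f u r. 0 < r \<and> ereal r < r0 \<longrightarrow>
        (\<Sum>\<^sub>\<infinity>v\<in>gball \<mu> r u. ennreal (\<bar>f v - gavg \<mu> f u r\<bar>\<^sup>2 * vweight \<mu> v))
        \<le> ennreal (C * r\<^sup>2) *
           (\<Sum>\<^sub>\<infinity>v\<in>gball \<mu> (2 * r) u. grad_sq \<mu> f v * ennreal (vweight \<mu> v)))"

definition markov :: "('a \<Rightarrow> 'a \<Rightarrow> real) \<Rightarrow> 'a \<Rightarrow> 'a \<Rightarrow> real" where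
  "markov \<mu> u v = \<mu> u v / vweight \<mu> u"

fun markov_pow :: "('a \<Rightarrow> 'a \<Rightarrow> real) \<Rightarrow> nat \<Rightarrow> 'a \<Rightarrow> 'a \<Rightarrow> real" where
  "markov_pow \<mu> 0 u v = (if u = v then 1 else 0)"
| "markov_pow \<mu> (Suc n) u v = (\<Sum>\<^sub>\<infinity>w. markov \<mu> u w * markov_pow \<mu> n w v)"

definition poly_kernel :: "('a \<Rightarrow> 'a \<Rightarrow> real) \<Rightarrow> real poly \<Rightarrow> 'a \<Rightarrow> 'a \<Rightarrow> real" where
  "poly_kernel \<mu> p u v = (\<Sum>i\<le>degree p. coeff p i * markov_pow \<mu> i u v)"

text \<open>The Hilbert space is the complex \<open>\<ell>\<^sup>2(X,m)\<close>, represented by its set of functions: all vertex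
  weights are positive, so no quotient is needed.\<close>

definition l2 :: "('a \<Rightarrow> real) \<Rightarrow> ('a \<Rightarrow> complex) set" where
  "l2 m = {f. (\<lambda>u. (cmod (f u))\<^sup>2 * m u) summable_on UNIV}"

definition l2norm :: "('a \<Rightarrow> real) \<Rightarrow> ('a \<Rightarrow> complex) \<Rightarrow> real" where
  "l2norm m f = sqrt (\<Sum>\<^sub>\<infinity>u. (cmod (f u))\<^sup>2 * m u)"

definition l2_bounded_op :: "('a \<Rightarrow> real) \<Rightarrow> (('a \<Rightarrow> complex) \<Rightarrow> 'a \<Rightarrow> complex) \<Rightarrow> bool" where
  "l2_bounded_op m T \<longleftrightarrow>
     (\<forall>f\<in>l2 m. T f \<in> l2 m) \<and>
     (\<forall>f\<in>l2 m. \<forall>g\<in>l2 m. T (\<lambda>u. f u + g u) = (\<lambda>u. T f u + T g u)) \<and>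
     (\<forall>c. \<forall>f\<in>l2 m. T (\<lambda>u. c * f u) = (\<lambda>u. c * T f u)) \<and>
     (\<exists>B. \<forall>f\<in>l2 m. l2norm m (T f) \<le> B * l2norm m f)"

definition l2_spectrum :: "('a \<Rightarrow> real) \<Rightarrow> (('a \<Rightarrow> complex) \<Rightarrow> 'a \<Rightarrow> complex) \<Rightarrow> complex set" where
  "l2_spectrum m T =
     {z. \<not> (\<exists>S. l2_bounded_op m S \<and>
              (\<forall>f\<in>l2 m. S (\<lambda>u. z * f u - T f u) = f \<and>
                         (\<lambda>u. z * S f u - T (S f) u) = f))}"

definition markov_op :: "('a \<Rightarrow> 'a \<Rightarrow> real) \<Rightarrow> ('a \<Rightarrow> complex) \<Rightarrow> 'a \<Rightarrow> complex" where
  "markov_op \<mu> f u = (\<Sum>\<^sub>\<infinity>v. complex_of_real (markov \<mu> u v) * f v)"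

end

(* Put x = 1 - P, whose spectrum lies in [0, 1 - a] with (1 - a)^k < 2. Expanding (1 - x^k)^n in
   Chebyshev polynomials, and bounding the coefficients by shifting the contour to height
   (D / n)^(1 / (2k - 1)), gives polynomials Q of degree less than D such that x^l (1 - x^k)^n - Q(x)
   is at most exp (- c (D^(2k) / n)^(1 / (2k - 1))) n^(-l/k) (1 + n^(1/k) x)^(-J). The kernel of Q
   vanishes at distance D or more, so with D = d(u, v) the theorem reduces to the on-diagonal estimate
   that the form of (1 + N x)^(-J) at the normalised point mass of u is at most C / m(B_sqrt(N)(u)).
   That form is dominated by a sum of return probabilities at the dyadic times N / 4^i. These are bounded
   by Nash's argument, localised at u: the averages of P^N at scale eps sqrt N are controlled through
   volume doubling by a moment of the heat kernel, and the case k = 1 of the polynomial approximation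
   bounds this moment by the square root of the very quantity being estimated.
   Doubling at small scales makes the graph locally finite, so finitely supported functions suffice. If
   r0 is finite, n stays bounded and the estimate is elementary. *)

theory Submission
  imports Defs "HOL-Computational_Algebra.Fundamental_Theorem_Algebra"
begin

section \<open>Polynomial approximation on an interval\<close>

text \<open>The spectral theorem is replaced by positivity certificates. A polynomial that is
  nonnegative on [a, 1] is, up to an arbitrarily small constant, a sum of squares times 1, x - a, 1
  - x or (x - a)(1 - x), so its form is nonnegative. Spectral estimates are therefore stated for
  polynomials, and a multiplier such as (1 + N x)^(-J) enters only through a polynomial majorant.
  The rate of decay comes from a balance: at height eta the function grows like exp (C n eta^(2k)),
  while the coefficients beyond frequency D gain exp (- D eta), and both exponents are of size
  (D^(2k) / n)^(1 / (2k - 1)) at the chosen height. The obstacle on the diagonal is circularity: the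
  tail estimate for the heat kernel already contains the on-diagonal supremum S. It is harmless
  because S returns only as S / 2 + C sqrt S, and S is finite, being a maximum over finitely many
  times. The spectrum may contain negative numbers, so return probabilities enter at even times
  only.\<close>

definition cos_sums :: "nat \<Rightarrow> (complex \<Rightarrow> complex) set" where
  "cos_sums N = {f. \<exists>b::nat \<Rightarrow> real. \<forall>z. f z = (\<Sum>j\<le>N. of_real (b j) * cos (of_nat j * z))}"

lemma cos_sumsI:
  fixes b :: "nat \<Rightarrow> real"
  assumes "\<And>z. f z = (\<Sum>j\<le>N. of_real (b j) * cos (of_nat j * z))"
  shows "f \<in> cos_sums N"
  unfolding cos_sums_def using assms by blast

lemma cos_sums_add:
  assumes "f \<in> cos_sums N" "g \<in> cos_sums N"
  shows "(\<lambda>z. f z + g z) \<in> cos_sums N"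
proof -
  obtain b c :: "nat \<Rightarrow> real" where b: "\<And>z. f z = (\<Sum>j\<le>N. of_real (b j) * cos (of_nat j * z))"
    and c: "\<And>z. g z = (\<Sum>j\<le>N. of_real (c j) * cos (of_nat j * z))"
    using assms unfolding cos_sums_def by blast
  have "f z + g z = (\<Sum>j\<le>N. of_real (b j + c j) * cos (of_nat j * z))" for z
    unfolding b c by (simp add: sum.distrib[symmetric] algebra_simps)
  then show ?thesis by (rule cos_sumsI)
qed

lemma cos_sums_scale:
  assumes "f \<in> cos_sums N"
  shows "(\<lambda>z. of_real a * f z) \<in> cos_sums N"
proof -
  obtain b :: "nat \<Rightarrow> real" where b: "\<And>z. f z = (\<Sum>j\<le>N. of_real (b j) * cos (of_nat j * z))"
    using assms unfolding cos_sums_def by blast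
  have "of_real a * f z = (\<Sum>j\<le>N. of_real (a * b j) * cos (of_nat j * z))" for z
    unfolding b by (simp add: sum_distrib_left algebra_simps)
  then show ?thesis by (rule cos_sumsI)
qed

lemma cos_sums_cos:
  assumes "j \<le> N"
  shows "(\<lambda>z. cos (of_nat j * z)) \<in> cos_sums N"
proof -
  have "cos (of_nat j * z) = (\<Sum>i\<le>N. of_real (if i = j then 1 else 0) * cos (of_nat i * z))" for z :: complex
    using assms by (simp add: if_distrib if_distribR cong: if_cong)
  then show ?thesis by (rule cos_sumsI)
qed

lemma cos_sums_const: "(\<lambda>z. of_real a) \<in> cos_sums N"
  using cos_sums_scale[OF cos_sums_cos[of 0 N], of a] by simp

lemma cos_sums_sum:
  assumes "finite I" "\<And>i. i \<in> I \<Longrightarrow> h i \<in> cos_sums N"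
  shows "(\<lambda>z. \<Sum>i\<in>I. h i z) \<in> cos_sums N"
  using assms
proof (induction I rule: finite_induct)
  case empty
  then show ?case using cos_sums_const[of 0 N] by simp
next
  case (insert i I)
  then show ?case using cos_sums_add[of "h i" N "\<lambda>z. \<Sum>i\<in>I. h i z"] by simp
qed

text \<open>The product-to-sum formula adds the frequency bounds, so the expansion of the
  \<open>n\<close>-th power of a cosine sum of order \<open>k\<close> stops at \<open>k * n\<close>.
  Since the identity holds for every complex argument with the same real coefficients, these can be
  estimated on a shifted line and then used at real angles.\<close>

lemma cos_sums_mult:
  assumes "f \<in> cos_sums N" "g \<in> cos_sums N'"
  shows "(\<lambda>z. f z * g z) \<in> cos_sums (N + N')"
proof -
  obtain b c :: "nat \<Rightarrow> real" where b: "\<And>z. f z = (\<Sum>j\<le>N. of_real (b j) * cos (of_nat j * z))"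
    and c: "\<And>z. g z = (\<Sum>j\<le>N'. of_real (c j) * cos (of_nat j * z))"
    using assms unfolding cos_sums_def by blast
  define h where "h i j z = of_real (b i * c j / 2) *
      (cos (of_nat (if i \<le> j then j - i else i - j) * z) + cos (of_nat (i + j) * z))" for i j and z :: complex
  have h: "h i j z = (of_real (b i) * cos (of_nat i * z)) * (of_real (c j) * cos (of_nat j * z))" for i j z
  proof -
    let ?A = "of_nat i * z" and ?B = "of_nat j * z"
    \<comment> \<open>The frequency difference is a natural number, so both orders occur; evenness
      of the cosine reconciles the first with \<open>?A - ?B\<close>.\<close>
    have 1: "cos (of_nat (if i \<le> j then j - i else i - j) * z) = cos (?A - ?B)"
    proof (cases "i \<le> j")
      case True
      then have "of_nat (j - i) * z = - (?A - ?B)"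
        by (simp add: of_nat_diff left_diff_distrib)
      then show ?thesis using True by (simp only: if_True cos_minus)
    next
      case False
      then have "of_nat (i - j) * z = ?A - ?B"
        by (simp add: of_nat_diff left_diff_distrib)
      then show ?thesis using False by (simp only: if_False)
    qed
    have 2: "cos (of_nat (i + j) * z) = cos (?A + ?B)"
      by (simp add: distrib_right)
    have 3: "cos ?A * cos ?B = (cos (?A - ?B) + cos (?A + ?B)) / 2"
      by (rule cos_times_cos)
    have 4: "of_real (b i) * cos ?A * (of_real (c j) * cos ?B) = of_real (b i * c j) * (cos ?A * cos ?B)"
      by simp
    show ?thesis unfolding h_def 1 2 4 unfolding 3 by simp
  qed
  have "h i j \<in> cos_sums (N + N')" if "i \<le> N" "j \<le> N'" for i j
    unfolding h_def using that
    by (intro cos_sums_scale cos_sums_add cos_sums_cos) auto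
  then have "(\<lambda>z. \<Sum>i\<le>N. \<Sum>j\<le>N'. h i j z) \<in> cos_sums (N + N')"
    by (intro cos_sums_sum) auto
  moreover have "(\<Sum>i\<le>N. \<Sum>j\<le>N'. h i j z) = f z * g z" for z
    unfolding b c h by (simp add: sum_product)
  ultimately show ?thesis by simp
qed

lemma cos_sums_power:
  assumes "f \<in> cos_sums N"
  shows "(\<lambda>z. f z ^ n) \<in> cos_sums (N * n)"
proof (induction n)
  case 0
  then show ?case using cos_sums_const[of 1 0] by simp
next
  case (Suc n)
  then show ?case using cos_sums_mult[OF assms Suc] by simp
qed

text \<open>The Chebyshev polynomials, in the variable \<open>x\<close> with \<open>cos \<theta> = 1 - 2 * x / \<Lambda>\<close>.\<close>

fun cheb :: "real \<Rightarrow> nat \<Rightarrow> real poly" where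
  "cheb \<Lambda> 0 = 1"
| "cheb \<Lambda> (Suc 0) = [:1, - 2 / \<Lambda>:]"
| "cheb \<Lambda> (Suc (Suc j)) = smult 2 ([:1, - 2 / \<Lambda>:] * cheb \<Lambda> (Suc j)) - cheb \<Lambda> j"

lemma degree_cheb: "degree (cheb \<Lambda> j) \<le> j"
proof (induction \<Lambda> j rule: cheb.induct)
  case (3 \<Lambda> j)
  let ?a = "[:1, - 2 / \<Lambda>:] :: real poly"
  have "degree (?a * cheb \<Lambda> (Suc j)) \<le> degree ?a + degree (cheb \<Lambda> (Suc j))"
    by (rule degree_mult_le)
  moreover have "degree ?a \<le> 1" by (rule degree_le) (auto simp: coeff_pCons split: nat.splits)
  ultimately have "degree (?a * cheb \<Lambda> (Suc j)) \<le> Suc (Suc j)"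
    using 3(1) by linarith
  then have "degree (smult 2 (?a * cheb \<Lambda> (Suc j))) \<le> Suc (Suc j)"
    by (meson degree_smult_le le_trans)
  moreover have "degree (cheb \<Lambda> j) \<le> Suc (Suc j)" using 3(2) by linarith
  ultimately show ?case unfolding cheb.simps(3) by (rule degree_diff_le)
next
  case (2 \<Lambda>)
  show ?case unfolding cheb.simps by (rule degree_le) (auto simp: coeff_pCons split: nat.splits)
qed auto

lemma poly_cheb:
  assumes "\<Lambda> \<noteq> 0"
  shows "poly (cheb \<Lambda> j) (\<Lambda> / 2 * (1 - cos \<theta>)) = cos (real j * \<theta>)"
  using assms
proof (induction \<Lambda> j rule: cheb.induct)
  case (3 \<Lambda> j)
  have e: "2 * (cos \<theta> * cos (real (Suc j) * \<theta>)) = cos (real j * \<theta>) + cos (real (Suc (Suc j)) * \<theta>)"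
  proof -
    have "cos \<theta> * cos (real (Suc j) * \<theta>) = (cos (\<theta> - real (Suc j) * \<theta>) + cos (\<theta> + real (Suc j) * \<theta>)) / 2"
      by (rule cos_times_cos)
    moreover have "\<theta> - real (Suc j) * \<theta> = - (real j * \<theta>)" by (simp add: algebra_simps)
    moreover have "\<theta> + real (Suc j) * \<theta> = real (Suc (Suc j)) * \<theta>" by (simp add: algebra_simps)
    ultimately show ?thesis by simp
  qed
  moreover have "poly [:1, - 2 / \<Lambda>:] (\<Lambda> / 2 * (1 - cos \<theta>)) = cos \<theta>" using 3 by (simp add: field_simps)
  moreover have "poly (cheb \<Lambda> (Suc (Suc j))) x = 2 * (poly [:1, - 2 / \<Lambda>:] x * poly (cheb \<Lambda> (Suc j)) x) - poly (cheb \<Lambda> j) x" for x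
    by (simp only: cheb.simps poly_diff poly_smult poly_mult)
  ultimately have "poly (cheb \<Lambda> (Suc (Suc j))) (\<Lambda> / 2 * (1 - cos \<theta>))
      = 2 * (cos \<theta> * cos (real (Suc j) * \<theta>)) - cos (real j * \<theta>)"
    using 3 by presburger
  then show ?case using e by linarith
qed (auto simp: field_simps)

lemma has_integral_cis_int:
  fixes p :: int
  shows "((\<lambda>\<theta>. cis (of_int p * \<theta>)) has_integral (if p = 0 then 2 * of_real pi else 0)) {-pi..pi}"
proof (cases "p = 0")
  case True
  show ?thesis using True has_integral_const_real[of "1 :: complex" "-pi" pi]
    by (simp add: scaleR_conv_of_real)
next
  case False
  define F where "F z = exp (\<i> * of_int p * z) / (\<i> * of_int p)" for z
  have d: "(F has_field_derivative exp (\<i> * of_int p * z)) (at z)" for z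
    unfolding F_def using False by (auto intro!: derivative_eq_intros)
  have "((\<lambda>x. exp (\<i> * of_int p * of_real x)) has_integral F (of_real pi) - F (of_real (-pi))) {-pi..pi}"
    by (intro fundamental_theorem_of_calculus has_vector_derivative_real_field) (auto intro!: d)
  moreover have "F (of_real pi) - F (of_real (-pi)) = 0"
  proof -
    have "exp (\<i> * of_int p * of_real pi) = cis (of_int p * pi)"
      "exp (\<i> * of_int p * of_real (-pi)) = cis (- (of_int p * pi))"
      by (simp_all add: cis_conv_exp algebra_simps)
    moreover have "cis (of_int p * pi) = cis (- (of_int p * pi))"
      by (simp add: complex_eq_iff sin_npi_int sin_times_pi_eq_0)
    ultimately show ?thesis unfolding F_def by simp
  qed
  moreover have "exp (\<i> * of_int p * of_real x) = cis (of_int p * x)" for x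
    by (simp add: cis_conv_exp algebra_simps)
  ultimately show ?thesis using False by simp
qed

text \<open>Orthogonality on the line of height \<eta>. Of the two exponentials in the cosine, the
  one with frequency \<open>- m\<close> carries the factor \<open>exp (m * \<eta>)\<close>, and
  multiplication by \<open>cis (j * \<theta>)\<close> selects it for \<open>m = j\<close>. Reading
  off a coefficient at this height thus divides by \<open>exp (j * \<eta>)\<close>. As
  \<open>j\<close> is positive, the other exponential always integrates to zero.\<close>

lemma has_integral_cos_shift:
  assumes "1 \<le> j"
  shows "((\<lambda>\<theta>. cos (of_nat m * (of_real \<theta> + \<i> * of_real \<eta>)) * cis (real j * \<theta>)) has_integral
           (if m = j then of_real (pi * exp (real j * \<eta>)) else 0)) {-pi..pi}"
proof -
  have e: "cos (of_nat m * (of_real \<theta> + \<i> * of_real \<eta>)) * cis (real j * \<theta>) =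
      of_real (exp (- real m * \<eta>) / 2) * cis (of_int (int m + int j) * \<theta>)
    + of_real (exp (real m * \<eta>) / 2) * cis (of_int (int j - int m) * \<theta>)" for \<theta>
  proof -
    let ?z = "of_nat m * (of_real \<theta> + \<i> * of_real \<eta>) :: complex"
    have 1: "exp (\<i> * ?z) = of_real (exp (- real m * \<eta>)) * cis (real m * \<theta>)"
      by (simp add: cis_conv_exp exp_of_real[symmetric] exp_add[symmetric] algebra_simps)
    have 2: "exp (- (\<i> * ?z)) = of_real (exp (real m * \<eta>)) * cis (- real m * \<theta>)"
      by (simp add: cis_conv_exp exp_of_real[symmetric] exp_add[symmetric] algebra_simps)
    show ?thesis unfolding cos_exp_eq 1 2
      by (simp add: add_divide_distrib distrib_right cis_mult mult.assoc)
        (simp add: algebra_simps)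
  qed
  have "((\<lambda>\<theta>. of_real (exp (- real m * \<eta>) / 2) * cis (of_int (int m + int j) * \<theta>)
    + of_real (exp (real m * \<eta>) / 2) * cis (of_int (int j - int m) * \<theta>)) has_integral
     of_real (exp (- real m * \<eta>) / 2) * (if int m + int j = 0 then 2 * of_real pi else 0)
    + of_real (exp (real m * \<eta>) / 2) * (if int j - int m = 0 then 2 * of_real pi else 0)) {-pi..pi}"
    by (intro has_integral_add has_integral_mult_right has_integral_cis_int)
  moreover have "of_real (exp (- real m * \<eta>) / 2) * (if int m + int j = 0 then 2 * of_real pi else 0)
    + of_real (exp (real m * \<eta>) / 2) * (if int j - int m = 0 then 2 * of_real pi else 0)
    = (if m = j then of_real (pi * exp (real j * \<eta>)) else (0::complex))"
    using assms by auto
  ultimately show ?thesis unfolding e by simp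
qed

text \<open>The integral of the majorant, rather than its supremum, is what keeps the tail of the
  Chebyshev series free of a factor \<open>n powr (1 / (2 * k))\<close>.\<close>

lemma cos_sum_coeff_bound:
  fixes b :: "nat \<Rightarrow> real"
  assumes f: "\<And>z. f z = (\<Sum>j\<le>N. of_real (b j) * cos (of_nat j * z))"
    and j: "1 \<le> j" "j \<le> N"
    and g: "\<And>\<theta>. \<theta> \<in> {-pi..pi} \<Longrightarrow> cmod (f (of_real \<theta> + \<i> * of_real \<eta>)) \<le> g \<theta>"
    and I: "(g has_integral I) {-pi..pi}"
  shows "\<bar>b j\<bar> \<le> exp (- real j * \<eta>) / pi * I"
proof -
  let ?F = "\<lambda>\<theta>. f (of_real \<theta> + \<i> * of_real \<eta>) * cis (real j * \<theta>)"
  have "((\<lambda>\<theta>. \<Sum>m\<le>N. of_real (b m) * (cos (of_nat m * (of_real \<theta> + \<i> * of_real \<eta>)) * cis (real j * \<theta>))) has_integral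
      (\<Sum>m\<le>N. of_real (b m) * (if m = j then of_real (pi * exp (real j * \<eta>)) else 0))) {-pi..pi}"
    using j by (intro has_integral_sum has_integral_mult_right has_integral_cos_shift) auto
  moreover have "(\<Sum>m\<le>N. of_real (b m) * (if m = j then of_real (pi * exp (real j * \<eta>)) else (0::complex)))
     = of_real (b j * (pi * exp (real j * \<eta>)))"
    using j by (simp add: if_distrib cong: if_cong)
  moreover have "(\<Sum>m\<le>N. of_real (b m) * (cos (of_nat m * (of_real \<theta> + \<i> * of_real \<eta>)) * cis (real j * \<theta>))) = ?F \<theta>" for \<theta>
    unfolding f by (simp add: sum_distrib_right mult.assoc)
  ultimately have F: "(?F has_integral of_real (b j * (pi * exp (real j * \<eta>)))) {-pi..pi}"
    by simp
  have "norm (integral {-pi..pi} ?F) \<le> integral {-pi..pi} g"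
    using F I g by (intro integral_norm_bound_integral) (auto simp: norm_mult)
  then have "\<bar>b j * (pi * exp (real j * \<eta>))\<bar> \<le> I"
    using integral_unique[OF F] integral_unique[OF I] by (metis norm_of_real)
  then have "\<bar>b j\<bar> * (pi * exp (real j * \<eta>)) \<le> I"
    by (simp add: abs_mult)
  then have "\<bar>b j\<bar> \<le> I / (pi * exp (real j * \<eta>))"
    by (simp add: pos_le_divide_eq)
  then show ?thesis by (simp add: exp_minus field_simps)
qed

section \<open>Size of the function off the real axis\<close>

lemma norm_power_diff_bound:
  fixes a b :: complex
  assumes "cmod a \<le> R" "cmod b \<le> R"
  shows "cmod (a ^ m - b ^ m) \<le> real m * R ^ (m - 1) * cmod (a - b)"
proof (induction m)
  case 0
  then show ?case by simp
next
  case (Suc m)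
  have R: "0 \<le> R" using assms(1) norm_ge_zero order_trans by blast
  have "a ^ Suc m - b ^ Suc m = a * (a ^ m - b ^ m) + (a - b) * b ^ m" by (simp add: algebra_simps)
  then have "cmod (a ^ Suc m - b ^ Suc m) \<le> cmod a * cmod (a ^ m - b ^ m) + cmod (a - b) * cmod b ^ m"
    by (metis norm_mult norm_power norm_triangle_ineq)
  also have "\<dots> \<le> R * (real m * R ^ (m - 1) * cmod (a - b)) + cmod (a - b) * R ^ m"
    using assms Suc R by (intro add_mono mult_mono power_mono) auto
  also have "\<dots> = real (Suc m) * R ^ (Suc m - 1) * cmod (a - b)"
    by (cases m) (auto simp: algebra_simps)
  finally show ?case .
qed

text \<open>Beyond \<open>t = 1\<close> the worst case is \<open>t = \<beta>\<close>, where the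
  claim amounts to \<open>(\<beta> - 2)^2 >= 0\<close>. A linear gap on the whole interval is what
  turns \<open>n\<close>-th powers into exponential decay, even at the end where
  \<open>1 - t\<close> is near -1.\<close>

lemma abs_one_minus_le:
  fixes t \<beta> :: real
  assumes "0 \<le> t" "t \<le> \<beta>" "\<beta> < 2"
  shows "\<bar>1 - t\<bar> \<le> 1 - (2 - \<beta>) / 2 * t"
proof (cases "t \<le> 1")
  case True
  have "(2 - \<beta>) / 2 * t \<le> 1 * t" using assms by (intro mult_right_mono) auto
  then show ?thesis using True by simp
next
  case False
  have "t * (1 + (2 - \<beta>) / 2) \<le> \<beta> * (1 + (2 - \<beta>) / 2)"
    using assms by (intro mult_right_mono) auto
  also have "\<dots> \<le> 2" using zero_le_power2[of "\<beta> - 2"] by (simp add: power2_eq_square field_simps)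
  finally show ?thesis using False by (simp add: algebra_simps)
qed

text \<open>On the real axis \<open>abs_one_minus_le\<close> gives the gain
  \<open>2 * c * x ^ (2 * k)\<close>. Leaving the axis by \<open>y\<close> changes the power by at
  most \<open>2 * k * (|x| + |y|) ^ (2 * k - 1) * |y|\<close>: if |y| is at most \<tau> |x|, half of
  the gain absorbs this; otherwise it is of order \<open>y ^ (2 * k)\<close>. The exponent is
  \<open>2 * k\<close> because the variable will be a square root of the spectral one.\<close>

lemma cmod_one_minus_power_le:
  fixes \<beta> :: real
  assumes k: "1 \<le> k" and \<beta>: "0 < \<beta>" "\<beta> < 2"
  obtains c C where "0 < c" "0 \<le> C"
    "\<And>x y. x ^ (2 * k) \<le> \<beta> \<Longrightarrow> cmod (1 - Complex x y ^ (2 * k)) \<le> exp (- c * x ^ (2 * k) + C * y ^ (2 * k))"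
proof -
  define c where "c = (2 - \<beta>) / 4"
  define \<tau> where "\<tau> = min 1 (c / (2 * real k * 2 ^ (2 * k - 1)))"
  define C where "C = 2 * real k * (2 / \<tau>) ^ (2 * k - 1)"
  have c: "0 < c" using \<beta> by (simp add: c_def)
  have \<tau>: "0 < \<tau>" "\<tau> \<le> 1" "2 * real k * 2 ^ (2 * k - 1) * \<tau> \<le> c"
    using c k unfolding \<tau>_def by (auto simp: min_def field_simps)
  have C: "0 \<le> C" using \<tau> by (simp add: C_def)
  have "cmod (1 - Complex x y ^ (2 * k)) \<le> exp (- c * x ^ (2 * k) + C * y ^ (2 * k))"
    if x: "x ^ (2 * k) \<le> \<beta>" for x y :: real
  proof -
    have ev: "x ^ (2 * k) = \<bar>x\<bar> ^ (2 * k)" "y ^ (2 * k) = \<bar>y\<bar> ^ (2 * k)"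
      by (simp_all add: power_mult)
    have R: "cmod (Complex x y) \<le> \<bar>x\<bar> + \<bar>y\<bar>" "cmod (of_real x) \<le> \<bar>x\<bar> + \<bar>y\<bar>"
      using cmod_le[of "Complex x y"] by auto
    have "Complex x y - of_real x = \<i> * of_real y" by (simp add: complex_eq_iff)
    then have d: "cmod (Complex x y - of_real x) = \<bar>y\<bar>" by (simp add: norm_mult)
    have p: "z ^ (2 * k) = z * z ^ (2 * k - 1)" for z :: real
    proof -
      have "2 * k = Suc (2 * k - 1)" using k by simp
      then show ?thesis by (metis power_Suc)
    qed
    have "cmod (Complex x y ^ (2 * k) - of_real x ^ (2 * k)) \<le> real (2 * k) * (\<bar>x\<bar> + \<bar>y\<bar>) ^ (2 * k - 1) * \<bar>y\<bar>"
      using norm_power_diff_bound[OF R, of "2 * k"] unfolding d .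
    also have "\<dots> \<le> c * x ^ (2 * k) + C * y ^ (2 * k)"
    proof (cases "\<bar>y\<bar> \<le> \<tau> * \<bar>x\<bar>")
      case True
      have "\<bar>x\<bar> + \<bar>y\<bar> \<le> 2 * \<bar>x\<bar>" using True \<tau> mult_right_mono[of \<tau> 1 "\<bar>x\<bar>"] by simp
      then have "real (2 * k) * (\<bar>x\<bar> + \<bar>y\<bar>) ^ (2 * k - 1) * \<bar>y\<bar> \<le> real (2 * k) * (2 * \<bar>x\<bar>) ^ (2 * k - 1) * (\<tau> * \<bar>x\<bar>)"
        using True \<tau> by (intro mult_mono power_mono) auto
      also have "\<dots> = (2 * real k * 2 ^ (2 * k - 1) * \<tau>) * \<bar>x\<bar> ^ (2 * k)"
        unfolding p[of "\<bar>x\<bar>"] by (simp add: power_mult_distrib)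
      also have "\<dots> \<le> c * \<bar>x\<bar> ^ (2 * k)" using \<tau> by (intro mult_right_mono) auto
      also have "\<dots> \<le> c * x ^ (2 * k) + C * y ^ (2 * k)" unfolding ev using C by simp
      finally show ?thesis .
    next
      case False
      have "\<tau> * (\<bar>x\<bar> + \<bar>y\<bar>) \<le> 2 * \<bar>y\<bar>"
        using False \<tau> mult_right_mono[of \<tau> 1 "\<bar>y\<bar>"] by (simp add: algebra_simps)
      then have "\<bar>x\<bar> + \<bar>y\<bar> \<le> 2 / \<tau> * \<bar>y\<bar>" using \<tau> by (simp add: field_simps)
      then have "real (2 * k) * (\<bar>x\<bar> + \<bar>y\<bar>) ^ (2 * k - 1) * \<bar>y\<bar> \<le> real (2 * k) * (2 / \<tau> * \<bar>y\<bar>) ^ (2 * k - 1) * \<bar>y\<bar>"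
        using \<tau> by (intro mult_mono power_mono) auto
      also have "\<dots> = C * \<bar>y\<bar> ^ (2 * k)"
        unfolding p[of "\<bar>y\<bar>"] C_def power_mult_distrib by simp
      also have "\<dots> \<le> c * x ^ (2 * k) + C * y ^ (2 * k)" unfolding ev using c by simp
      finally show ?thesis .
    qed
    finally have 1: "cmod (Complex x y ^ (2 * k) - of_real x ^ (2 * k)) \<le> c * x ^ (2 * k) + C * y ^ (2 * k)" .
    have "cmod (1 - of_real x ^ (2 * k)) = \<bar>1 - x ^ (2 * k)\<bar>"
      by (metis norm_of_real of_real_1 of_real_diff of_real_power)
    also have "\<dots> \<le> 1 - (2 - \<beta>) / 2 * x ^ (2 * k)"
      using x \<beta> by (intro abs_one_minus_le) auto
    also have "(2 - \<beta>) / 2 = 2 * c" by (simp add: c_def)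
    finally have 2: "cmod (1 - of_real x ^ (2 * k)) \<le> 1 - (2 * c) * x ^ (2 * k)" .
    have "1 - Complex x y ^ (2 * k) = (1 - of_real x ^ (2 * k)) - (Complex x y ^ (2 * k) - of_real x ^ (2 * k))"
      by simp
    then have "cmod (1 - Complex x y ^ (2 * k)) \<le> cmod (1 - of_real x ^ (2 * k)) + cmod (Complex x y ^ (2 * k) - of_real x ^ (2 * k))"
      by (metis norm_triangle_ineq4)
    also have "\<dots> \<le> 1 + (- c * x ^ (2 * k) + C * y ^ (2 * k))" using 1 2 by simp
    also have "\<dots> \<le> exp (- c * x ^ (2 * k) + C * y ^ (2 * k))" by (rule exp_ge_add_one_self)
    finally show ?thesis .
  qed
  then show ?thesis using that c C by blast
qed

text \<open>With \<open>w\<close> half the argument,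
  \<open>\<Lambda> / 2 * (1 - cos (2 * w))\<close> is the square of
  \<open>sqrt \<Lambda> * sin w\<close>, whose real and imaginary parts are products of a sine or
  cosine with the hyperbolic cosine \<open>ch\<close> or sine \<open>sh\<close> of \<eta> / 2. This
  reduces the claim to \<open>cmod_one_minus_power_le\<close>.\<close>

lemma cmod_one_minus_sin_power_le:
  fixes \<Lambda> :: real
  assumes k: "1 \<le> k" and \<Lambda>: "0 < \<Lambda>" "\<Lambda> ^ k < 2"
  obtains c C \<eta>\<^sub>0 where "0 < c" "0 \<le> C" "0 < \<eta>\<^sub>0" "\<eta>\<^sub>0 \<le> 1"
    "\<And>\<theta> \<eta>. \<theta> \<in> {-pi..pi} \<Longrightarrow> 0 \<le> \<eta> \<Longrightarrow> \<eta> \<le> \<eta>\<^sub>0 \<Longrightarrow>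
       cmod (1 - (of_real (\<Lambda> / 2) * (1 - cos (of_real \<theta> + \<i> * of_real \<eta>))) ^ k)
       \<le> exp (- c * (\<theta>\<^sup>2) ^ k + C * \<eta> ^ (2 * k))"
proof -
  \<comment> \<open>Room strictly between \<open>\<Lambda> ^ k\<close> and 2 is needed, since on the
    shifted line the real part exceeds its value on the axis by the factor \<open>ch \<eta>\<close>;
    \<open>\<eta>\<^sub>0\<close> keeps that factor within the room.\<close>
  define \<beta> where "\<beta> = (\<Lambda> ^ k + 2) / 2"
  have \<beta>: "0 < \<beta>" "\<beta> < 2" "\<Lambda> ^ k < \<beta>" using \<Lambda> by (auto simp: \<beta>_def intro: add_pos_pos)
  obtain c C where c: "0 < c" and C: "0 \<le> C" and
    bd: "\<And>x y. x ^ (2 * k) \<le> \<beta> \<Longrightarrow> cmod (1 - Complex x y ^ (2 * k)) \<le> exp (- c * x ^ (2 * k) + C * y ^ (2 * k))"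
    using cmod_one_minus_power_le[OF k \<beta>(1,2)] by metis
  define ch where "ch \<eta> = (exp (\<eta> / 2) + exp (- (\<eta> / 2))) / 2" for \<eta> :: real
  have "((\<lambda>\<eta>. \<Lambda> ^ k * ch \<eta> ^ (2 * k)) \<longlongrightarrow> \<Lambda> ^ k * ch 0 ^ (2 * k)) (at 0)"
    unfolding ch_def by (intro tendsto_intros) auto
  moreover have "ch 0 = 1" by (simp add: ch_def)
  ultimately have "\<forall>\<^sub>F \<eta> in at 0. \<Lambda> ^ k * ch \<eta> ^ (2 * k) < \<beta>"
    using order_tendstoD(2)[of _ "\<Lambda> ^ k" "at 0" \<beta>] \<beta>(3) by simp
  then obtain d where d: "0 < d" "\<And>\<eta>. \<eta> \<noteq> 0 \<Longrightarrow> \<bar>\<eta>\<bar> < d \<Longrightarrow> \<Lambda> ^ k * ch \<eta> ^ (2 * k) < \<beta>"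
    unfolding eventually_at by (auto simp: dist_real_def)
  define \<eta>\<^sub>0 where "\<eta>\<^sub>0 = min 1 (d / 2)"
  have \<eta>0: "0 < \<eta>\<^sub>0" "\<eta>\<^sub>0 \<le> 1" using d by (auto simp: \<eta>\<^sub>0_def)
  have "cmod (1 - (of_real (\<Lambda> / 2) * (1 - cos (of_real \<theta> + \<i> * of_real \<eta>))) ^ k)
       \<le> exp (- (c * (\<Lambda> / pi\<^sup>2) ^ k) * (\<theta>\<^sup>2) ^ k + (C * \<Lambda> ^ k) * \<eta> ^ (2 * k))"
    if \<theta>: "\<theta> \<in> {-pi..pi}" and \<eta>: "0 \<le> \<eta>" "\<eta> \<le> \<eta>\<^sub>0" for \<theta> \<eta>
  proof -
    have chb: "\<Lambda> ^ k * ch \<eta> ^ (2 * k) \<le> \<beta>"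
    proof (cases "\<eta> = 0")
      case True
      then show ?thesis using \<beta>(3) by (simp add: ch_def)
    next
      case False
      then show ?thesis using d(2)[of \<eta>] d(1) \<eta> unfolding \<eta>\<^sub>0_def by auto
    qed
    define w :: complex where "w = of_real (\<theta> / 2) + \<i> * of_real (\<eta> / 2)"
    have Rew: "Re w = \<theta> / 2" "Im w = \<eta> / 2" by (simp_all add: w_def)
    define x where "x = sqrt \<Lambda> * (sin (\<theta> / 2) * ch \<eta>)"
    define sh where "sh = (exp (\<eta> / 2) - exp (- (\<eta> / 2))) / 2"
    define y where "y = sqrt \<Lambda> * (cos (\<theta> / 2) * sh)"
    have "2 \<le> exp (\<eta> / 2) + exp (- (\<eta> / 2))"
      using add_mono[OF exp_ge_add_one_self[of "\<eta> / 2"] exp_ge_add_one_self[of "- (\<eta> / 2)"]]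
      by linarith
    then have ch1: "1 \<le> ch \<eta>" by (simp add: ch_def)
    have sh: "0 \<le> sh" "sh \<le> \<eta>"
    proof -
      show "0 \<le> sh" unfolding sh_def using \<eta> by simp
      define h where "h = \<eta> / 2"
      have h: "0 \<le> h" "h \<le> 1" "\<eta> = 2 * h" using \<eta> \<eta>0 by (auto simp: h_def)
      have "exp h \<le> 1 + h + h\<^sup>2" using h by (intro exp_bound) auto
      moreover have "h\<^sup>2 \<le> h" using h by (simp add: power2_eq_square mult_left_le)
      moreover have "1 - h \<le> exp (- h)" using exp_ge_add_one_self[of "- h"] by simp
      ultimately have "exp h - exp (- h) \<le> 2 * \<eta>" using h by linarith
      then show "sh \<le> \<eta>" unfolding sh_def h(3) by simp
    qed
    have "of_real (sqrt \<Lambda>) * sin w = Complex x y"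
      unfolding complex_eq_iff by (simp add: Re_sin Im_sin Rew x_def y_def ch_def sh_def)
    moreover have "of_real (\<Lambda> / 2) * (1 - cos (of_real \<theta> + \<i> * of_real \<eta>)) = (of_real (sqrt \<Lambda>) * sin w)\<^sup>2"
    proof -
      have "of_real \<theta> + \<i> * of_real \<eta> = 2 * w" by (simp add: w_def)
      then have "cos (of_real \<theta> + \<i> * of_real \<eta>) = 1 - 2 * (sin w)\<^sup>2" by (simp add: cos_double_sin)
      moreover have "(complex_of_real (sqrt \<Lambda>))\<^sup>2 = of_real \<Lambda>" using \<Lambda>
        by (metis of_real_power real_sqrt_pow2 less_imp_le)
      ultimately show ?thesis by (simp add: power_mult_distrib)
    qed
    ultimately have e: "(of_real (\<Lambda> / 2) * (1 - cos (of_real \<theta> + \<i> * of_real \<eta>))) ^ k = Complex x y ^ (2 * k)"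
      by (simp add: power_mult)
    have x2: "x\<^sup>2 = \<Lambda> * ((sin (\<theta> / 2))\<^sup>2 * (ch \<eta>)\<^sup>2)" and y2: "y\<^sup>2 = \<Lambda> * ((cos (\<theta> / 2))\<^sup>2 * sh\<^sup>2)"
      using \<Lambda> by (simp_all add: x_def y_def power_mult_distrib)
    have "x\<^sup>2 \<le> \<Lambda> * (1 * (ch \<eta>)\<^sup>2)" unfolding x2
      using \<Lambda> by (intro mult_left_mono mult_right_mono) (auto simp: sin_squared_eq)
    then have "(x\<^sup>2) ^ k \<le> (\<Lambda> * (1 * (ch \<eta>)\<^sup>2)) ^ k" by (intro power_mono) auto
    then have xb: "x ^ (2 * k) \<le> \<beta>" using chb by (simp add: power_mult_distrib power_mult)
    have "y\<^sup>2 \<le> \<Lambda> * (1 * \<eta>\<^sup>2)" unfolding y2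
      using \<Lambda> sh by (intro mult_left_mono mult_mono power_mono) (auto simp: cos_squared_eq)
    then have "(y\<^sup>2) ^ k \<le> (\<Lambda> * (1 * \<eta>\<^sup>2)) ^ k" by (intro power_mono) auto
    then have yb: "y ^ (2 * k) \<le> \<Lambda> ^ k * \<eta> ^ (2 * k)" by (simp add: power_mult_distrib power_mult)
    \<comment> \<open>Jordan's inequality, from concavity of the sine interpolated between 0 and pi
      / 2.\<close>
    have "\<bar>\<theta>\<bar> / pi \<le> \<bar>sin (\<theta> / 2)\<bar>"
    proof -
      have *: "t / pi \<le> sin (t / 2)" if "0 \<le> t" "t \<le> pi" for t
      proof -
        have "concave_on {0..pi} sin"
          by (rule f''_le0_imp_concave[of _ _ cos "\<lambda>x. - sin x"])
            (auto intro!: derivative_eq_intros sin_ge_zero)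
        from concave_onD[OF this, of "t / pi" 0 "pi / 2"] that
        show ?thesis by simp
      qed
      show ?thesis
      proof (cases "0 \<le> \<theta>")
        case True
        then show ?thesis using *[of \<theta>] \<theta> by auto
      next
        case False
        then show ?thesis using *[of "- \<theta>"] \<theta> by auto
      qed
    qed
    then have "(\<bar>\<theta>\<bar> / pi)\<^sup>2 \<le> \<bar>sin (\<theta> / 2)\<bar>\<^sup>2" by (intro power_mono) auto
    then have "\<theta>\<^sup>2 / pi\<^sup>2 * 1 \<le> (sin (\<theta> / 2))\<^sup>2 * (ch \<eta>)\<^sup>2"
      using ch1 by (intro mult_mono) (auto simp: power_divide)
    then have "\<Lambda> * (\<theta>\<^sup>2 / pi\<^sup>2 * 1) \<le> x\<^sup>2" unfolding x2 using \<Lambda> by (intro mult_left_mono) auto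
    then have "(\<Lambda> * (\<theta>\<^sup>2 / pi\<^sup>2 * 1)) ^ k \<le> (x\<^sup>2) ^ k" using \<Lambda> by (intro power_mono) auto
    then have xl: "(\<Lambda> / pi\<^sup>2) ^ k * (\<theta>\<^sup>2) ^ k \<le> x ^ (2 * k)" 
      by (simp add: power_mult_distrib power_mult power_divide)
    have "- c * x ^ (2 * k) + C * y ^ (2 * k) \<le> - (c * (\<Lambda> / pi\<^sup>2) ^ k) * (\<theta>\<^sup>2) ^ k + (C * \<Lambda> ^ k) * \<eta> ^ (2 * k)"
      using mult_left_mono[OF xl less_imp_le[OF c]] mult_left_mono[OF yb C]
      unfolding mult.assoc mult_minus_left by linarith
    then show ?thesis using bd[OF xb, of y] unfolding e by (meson exp_le_cancel_iff order_trans)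
  qed
  moreover have "0 < c * (\<Lambda> / pi\<^sup>2) ^ k" using c \<Lambda> by simp
  moreover have "0 \<le> C * \<Lambda> ^ k" using C \<Lambda> by simp
  ultimately show ?thesis using that \<eta>0 by blast
qed

lemma exp_neg_power_le:
  fixes c s :: real
  assumes "0 < c" "0 \<le> s" "1 \<le> k"
  shows "exp (- c * s ^ k) \<le> exp c * exp (- c * s)"
proof -
  have "s \<le> 1 + s ^ k"
  proof (cases "s \<le> 1")
    case True
    then show ?thesis using assms by (simp add: add_increasing2)
  next
    case False
    then have "s ^ 1 \<le> s ^ k" using assms by (intro power_increasing) auto
    then show ?thesis by simp
  qed
  then have "c * s \<le> c * (1 + s ^ k)" using assms by simp
  then have "- c * s ^ k \<le> c + - c * s" by (simp add: algebra_simps)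
  then show ?thesis by (simp flip: exp_add)
qed

text \<open>A Lorentzian majorant has an arctangent as primitive, which replaces a Gaussian-type
  integral. The essential output is the factor \<open>1 / sqrt t\<close>, used with
  \<open>t = n powr (1 / k)\<close>.\<close>

lemma exp_neg_power_integral:
  fixes c t :: real
  assumes c: "0 < c" and t: "0 < t" and k: "1 \<le> k"
  obtains g I where "\<And>\<theta>. exp (- c * (t * \<theta>\<^sup>2) ^ k) \<le> g \<theta>"
    "(g has_integral I) {-pi..pi}" "I \<le> exp c * pi / sqrt (c * t)"
proof -
  define \<kappa> where "\<kappa> = sqrt (c * t)"
  have \<kappa>: "0 < \<kappa>" "\<kappa>\<^sup>2 = c * t" using c t by (auto simp: \<kappa>_def)
  define g where "g \<theta> = exp c * inverse (1 + (\<kappa> * \<theta>)\<^sup>2)" for \<theta>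
  define F where "F \<theta> = exp c * (arctan (\<kappa> * \<theta>) / \<kappa>)" for \<theta>
  have d: "(F has_real_derivative g \<theta>) (at \<theta> within S)" for \<theta> S
    unfolding F_def g_def using \<kappa> by (auto intro!: derivative_eq_intros)
  have I: "(g has_integral F pi - F (- pi)) {-pi..pi}"
    by (intro fundamental_theorem_of_calculus) (auto intro!: d simp flip: has_real_derivative_iff_has_vector_derivative)
  have le: "exp (- c * (t * \<theta>\<^sup>2) ^ k) \<le> g \<theta>" for \<theta>
  proof -
    have "exp (- c * (t * \<theta>\<^sup>2) ^ k) \<le> exp c * exp (- c * (t * \<theta>\<^sup>2))"
      using c t k by (intro exp_neg_power_le) auto
    also have "exp (- c * (t * \<theta>\<^sup>2)) = inverse (exp ((\<kappa> * \<theta>)\<^sup>2))"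
      using \<kappa>(2) by (simp add: exp_minus power_mult_distrib algebra_simps)
    also have "\<dots> \<le> inverse (1 + (\<kappa> * \<theta>)\<^sup>2)"
      by (intro le_imp_inverse_le exp_ge_add_one_self) (simp add: add_pos_nonneg)
    finally show ?thesis unfolding g_def by simp
  qed
  have "arctan (\<kappa> * pi) \<le> pi / 2" "- (pi / 2) \<le> arctan (\<kappa> * (- pi))"
    using arctan_bounded[of "\<kappa> * pi"] arctan_bounded[of "\<kappa> * (-pi)"] by auto
  then have "(arctan (\<kappa> * pi) - arctan (\<kappa> * (- pi))) / \<kappa> \<le> pi / \<kappa>"
    using \<kappa> by (intro divide_right_mono) auto
  then have "F pi - F (- pi) \<le> exp c * (pi / \<kappa>)"
    unfolding F_def right_diff_distrib[symmetric] diff_divide_distrib[symmetric]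
    by (intro mult_left_mono) auto
  then show ?thesis using that[OF le I] unfolding \<kappa>_def by simp
qed

text \<open>The exponent of the theorem in the form in which it arises: with
  \<open>y = (D / n) powr (1 / (2 * k - 1))\<close> it equals both \<open>n * y ^ (2 * k)\<close>
  and \<open>D * y\<close>.\<close>

definition decay_rate :: "nat \<Rightarrow> nat \<Rightarrow> real \<Rightarrow> real" where
  "decay_rate k n D = (D ^ (2 * k) / real n) powr (1 / (2 * real k - 1))"

lemma decay_rate_nonneg [simp]: "0 \<le> decay_rate k n D"
  by (simp add: decay_rate_def)

text \<open>The degree is bounded through coefficients: a real bound can then be split as
  \<open>(1 - q) * D + q * D\<close> without rounding, and \<open>r = 0\<close> allows exactly
  \<open>Q = 0\<close>, whose \<open>degree\<close> is not below 0.\<close>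

abbreviation poly_approx :: "real \<Rightarrow> real \<Rightarrow> (real \<Rightarrow> real) \<Rightarrow> (real \<Rightarrow> real) \<Rightarrow> bool" where
  "poly_approx \<Lambda> r g \<epsilon> \<equiv> \<exists>Q. (\<forall>i. r \<le> real i \<longrightarrow> coeff Q i = 0) \<and>
     (\<forall>x\<in>{0..\<Lambda>}. \<bar>g x - poly Q x\<bar> \<le> \<epsilon> x)"

section \<open>Truncating the Chebyshev series\<close>

lemma geometric_tail:
  fixes \<eta> D :: real
  assumes "0 < \<eta>" "\<eta> \<le> 1" "0 \<le> D"
  shows "(\<Sum>j | j \<le> N \<and> D \<le> real j. exp (- real j * \<eta>)) \<le> 2 / \<eta> * exp (- D * \<eta>)"
proof -
  define d where "d = nat \<lceil>D\<rceil>"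
  have d: "D \<le> real j \<longleftrightarrow> d \<le> j" for j using assms(3) by (simp add: d_def nat_le_iff ceiling_le_iff)
  define q where "q = exp (- \<eta>)"
  have q: "0 < q" "q < 1" using assms by (auto simp: q_def)
  have e: "exp (- real j * \<eta>) = q ^ j" for j by (simp add: q_def exp_of_nat_mult[symmetric])
  have "{j. j \<le> N \<and> D \<le> real j} = {d..N}" unfolding d by auto
  then have "(\<Sum>j | j \<le> N \<and> D \<le> real j. exp (- real j * \<eta>)) = (\<Sum>j=d..N. q ^ j)"
    unfolding e by simp
  also have "\<dots> \<le> q ^ d / (1 - q)"
    using q by (simp add: sum_gp divide_right_mono)
  also have "\<dots> \<le> exp (- D * \<eta>) / (\<eta> / 2)"
  proof (intro frac_le)
    show "q ^ d \<le> exp (- D * \<eta>)" unfolding e[symmetric] using d[of d] assms by simp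
    have "1 + \<eta> \<le> exp \<eta>" by (rule exp_ge_add_one_self)
    then have "q \<le> inverse (1 + \<eta>)" unfolding q_def exp_minus
      using assms by (intro le_imp_inverse_le) auto
    also have "\<dots> \<le> 1 - \<eta> / 2"
    proof -
      have "\<eta> * \<eta> \<le> \<eta> * 1" using assms by (intro mult_left_mono) auto
      then show ?thesis using assms by (simp add: field_simps)
    qed
    finally show "\<eta> / 2 \<le> 1 - q" by simp
  qed (use assms in auto)
  also have "\<dots> = 2 / \<eta> * exp (- D * \<eta>)" by simp
  finally show ?thesis .
qed

text \<open>The contour height is \<open>a * y\<close>, with \<open>y\<close> as explained at
  \<open>decay_rate\<close>. The growth \<open>n * C * \<eta> ^ (2 * k)\<close> and the gain
  \<open>D * \<eta>\<close> are both multiples of the decay rate, and a small \<open>a\<close> makes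
  the gain at least twice the growth. The condition \<open>D <= k * n\<close> keeps the height
  admissible. A rate above 1 means \<open>sqrt t * y > 1\<close> for \<open>t ^ k = n\<close>, so
  the \<open>1 / \<eta>\<close> lost in the geometric tail is repaid by the
  \<open>1 / sqrt t\<close> of the integral and no power of \<open>n\<close> survives.\<close>

lemma power_approx_aux:
  fixes \<Lambda> :: real
  assumes k: "1 \<le> k" and \<Lambda>: "0 < \<Lambda>" "\<Lambda> ^ k < 2"
  obtains A c where "0 < A" "0 < c"
    "\<And>n D. 1 \<le> n \<Longrightarrow> 0 \<le> D \<Longrightarrow> D \<le> real (k * n) \<Longrightarrow> 1 < decay_rate k n D \<Longrightarrow>
       poly_approx \<Lambda> D (\<lambda>x. (1 - x ^ k) ^ n) (\<lambda>x. A * exp (- c * decay_rate k n D))"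
proof -
  obtain c C \<eta>\<^sub>0 where c: "0 < c" and C: "0 \<le> C" and \<eta>\<^sub>0: "0 < \<eta>\<^sub>0" "\<eta>\<^sub>0 \<le> 1" and
    bd: "\<And>\<theta> \<eta>. \<theta> \<in> {-pi..pi} \<Longrightarrow> 0 \<le> \<eta> \<Longrightarrow> \<eta> \<le> \<eta>\<^sub>0 \<Longrightarrow>
       cmod (1 - (of_real (\<Lambda> / 2) * (1 - cos (of_real \<theta> + \<i> * of_real \<eta>))) ^ k)
       \<le> exp (- c * (\<theta>\<^sup>2) ^ k + C * \<eta> ^ (2 * k))"
    using cmod_one_minus_sin_power_le[OF k \<Lambda>] by metis
  \<comment> \<open>The entry \<open>1 / (2 * (C + 1))\<close> keeps the growth below half of the
    gain; \<open>\<eta>\<^sub>0 / k\<close> makes the height admissible, because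
    \<open>y <= k\<close> is shown below.\<close>
  define a where "a = min (min 1 (1 / (2 * (C + 1)))) (\<eta>\<^sub>0 / real k)"
  have a: "0 < a" "a \<le> 1" "C * a \<le> 1 / 2" "a * real k \<le> \<eta>\<^sub>0"
  proof -
    show "0 < a" using C \<eta>\<^sub>0 k by (auto simp: a_def)
    show "a \<le> 1" unfolding a_def by linarith
    have "a \<le> 1 / (2 * (C + 1))" by (simp add: a_def)
    then have "(C + 1) * a \<le> 1 / 2" using C by (simp add: field_simps)
    then show "C * a \<le> 1 / 2" using \<open>0 < a\<close> by (simp add: algebra_simps)
    have "a \<le> \<eta>\<^sub>0 / real k" by (simp add: a_def)
    then show "a * real k \<le> \<eta>\<^sub>0" using k by (simp add: field_simps)
  qed
  define A where "A = 2 * exp c / (sqrt c * a)"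
  have A: "0 < A" using a c by (simp add: A_def)
  have "poly_approx \<Lambda> D (\<lambda>x. (1 - x ^ k) ^ n) (\<lambda>x. A * exp (- (a / 2) * decay_rate k n D))"
    if n: "1 \<le> n" and D: "0 \<le> D" "D \<le> real (k * n)" and \<omega>: "1 < decay_rate k n D" for n D
  proof -
    let ?\<omega> = "decay_rate k n D"
    have D1: "1 < D"
    proof (rule ccontr)
      assume "\<not> 1 < D"
      then have "D ^ (2 * k) \<le> 1" using D by (intro power_le_one) auto
      then have "D ^ (2 * k) / real n \<le> 1" using n D by (simp add: divide_simps)
      then have "?\<omega> \<le> 1" unfolding decay_rate_def using D k by (intro powr_le1) auto
      then show False using \<omega> by simp
    qed
    define y where "y = (D / real n) powr (1 / (2 * real k - 1))"
    define \<eta> where "\<eta> = a * y"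
    have y0: "0 < y" using D1 n by (simp add: y_def)
    have "y ^ (2 * k - 1) = D / real n"
    proof -
      have "y ^ (2 * k - 1) = y powr real (2 * k - 1)" using y0 by (simp add: powr_realpow)
      also have "real (2 * k - 1) = 2 * real k - 1" using k by (simp add: of_nat_diff)
      finally show ?thesis unfolding y_def using k D1 n by (simp add: powr_powr)
    qed
    then have Dy: "D = real n * y ^ (2 * k - 1)" using n by simp
    have k2: "2 * k = Suc (2 * k - 1)" using k by simp
    have p: "z ^ (2 * k) = z * z ^ (2 * k - 1)" for z :: real
      by (subst k2) (rule power_Suc)
    have om: "?\<omega> = real n * y ^ (2 * k)"
    proof -
      have "D ^ (2 * k) / real n = (real n * y ^ (2 * k)) ^ (2 * k - 1)"
      proof -
        have "D ^ (2 * k) / real n = real n ^ (2 * k - 1) * (y ^ (2 * k - 1)) ^ (2 * k)"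
          unfolding Dy power_mult_distrib p[of "real n"] using n by simp
        also have "\<dots> = (real n * y ^ (2 * k)) ^ (2 * k - 1)"
          by (simp add: power_mult_distrib power_mult[symmetric] mult.commute)
        finally show ?thesis .
      qed
      also have "\<dots> = (real n * y ^ (2 * k)) powr real (2 * k - 1)"
        using n y0 by (subst powr_realpow) auto
      also have "real (2 * k - 1) = 2 * real k - 1" using k by (simp add: of_nat_diff)
      finally show ?thesis unfolding decay_rate_def using k n y0 by (simp add: powr_powr)
    qed
    have Dom: "D * \<eta> = a * ?\<omega>" unfolding om p \<eta>_def by (subst Dy) simp
    have yk: "y \<le> real k"
    proof (rule ccontr)
      assume "\<not> y \<le> real k"
      then have "real k ^ (2 * k - 1) < y ^ (2 * k - 1)" using k by (intro power_strict_mono) auto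
      moreover have "real k ^ 1 \<le> real k ^ (2 * k - 1)" using k by (intro power_increasing) auto
      then have "real k \<le> real k ^ (2 * k - 1)" unfolding power_one_right .
      moreover have "y ^ (2 * k - 1) \<le> real k" unfolding \<open>y ^ (2 * k - 1) = D / real n\<close>
        using D n by (simp add: divide_simps)
      ultimately show False by linarith
    qed
    have \<eta>: "0 < \<eta>" "\<eta> \<le> \<eta>\<^sub>0" 
      using a y0 order_trans[OF mult_left_mono[OF yk, of a] a(4)] unfolding \<eta>_def by auto
    have Cn: "real n * (C * \<eta> ^ (2 * k)) \<le> a / 2 * ?\<omega>"
    proof -
      have "real n * (C * \<eta> ^ (2 * k)) = (C * a) * a ^ (2 * k - 1) * ?\<omega>"
        unfolding om \<eta>_def power_mult_distrib p[of a] by simp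
      also have "\<dots> \<le> (1 / 2) * a * ?\<omega>"
      proof (intro mult_right_mono mult_mono)
        have "a ^ (2 * k - 1) \<le> a ^ 1" using a k by (intro power_decreasing) auto
        then show "a ^ (2 * k - 1) \<le> a" by simp
      qed (use a C in auto)
      finally show ?thesis by simp
    qed
    define t where "t = real n powr (1 / real k)"
    have t: "0 < t" "t ^ k = real n" using n k by (auto simp: t_def powr_realpow[symmetric] powr_powr)
    have st: "a \<le> sqrt t * \<eta>"
    proof -
      have "1 \<le> (sqrt t * y) ^ (2 * k)"
        using \<omega> t unfolding om power_mult_distrib power_mult by simp
      then have "1 ^ (2 * k) \<le> (sqrt t * y) ^ (2 * k)" by simp
      then have "1 \<le> sqrt t * y" using k t y0 power_mono_iff[of 1 "sqrt t * y" "2 * k"] by auto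
      then show ?thesis using a mult_left_mono[of 1 "sqrt t * y" a] unfolding \<eta>_def by (simp add: mult.left_commute)
    qed
    define N where "N = k * n"
    define f where "f z = (1 - (of_real (\<Lambda> / 2) * (1 - cos z)) ^ k) ^ n" for z :: complex
    have "f \<in> cos_sums (k * n)"
    proof -
      have "(\<lambda>z. of_real (-1) * cos (of_nat 1 * z)) \<in> cos_sums 1"
        by (intro cos_sums_scale cos_sums_cos) simp
      from cos_sums_add[OF cos_sums_const[of 1 1] this]
      have "(\<lambda>z. 1 - cos z) \<in> cos_sums 1" by simp
      from cos_sums_power[OF cos_sums_scale[OF this, of "\<Lambda> / 2"], of k]
      have "(\<lambda>z. of_real (-1) * (of_real (\<Lambda> / 2) * (1 - cos z)) ^ k) \<in> cos_sums k"
        by (intro cos_sums_scale) simp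
      from cos_sums_add[OF cos_sums_const[of 1 k] this]
      have "(\<lambda>z. 1 - (of_real (\<Lambda> / 2) * (1 - cos z)) ^ k) \<in> cos_sums k" by simp
      from cos_sums_power[OF this, of n] show ?thesis unfolding f_def .
    qed
    then obtain b :: "nat \<Rightarrow> real" where b: "\<And>z. f z = (\<Sum>j\<le>N. of_real (b j) * cos (of_nat j * z))"
      unfolding cos_sums_def N_def by blast
    obtain g I where g: "\<And>\<theta>. exp (- c * (t * \<theta>\<^sup>2) ^ k) \<le> g \<theta>"
      and I: "(g has_integral I) {-pi..pi}" "I \<le> exp c * pi / sqrt (c * t)"
      using exp_neg_power_integral[OF c t(1) k] by metis
    let ?E = "exp (a / 2 * ?\<omega>)"
    have bj: "\<bar>b j\<bar> \<le> ?E * (exp c / sqrt (c * t)) * exp (- real j * \<eta>)" if j: "1 \<le> j" "j \<le> N" for j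
    proof -
      have "cmod (f (of_real \<theta> + \<i> * of_real \<eta>)) \<le> ?E * g \<theta>" if \<theta>: "\<theta> \<in> {-pi..pi}" for \<theta>
      proof -
        have "cmod (f (of_real \<theta> + \<i> * of_real \<eta>)) \<le> exp (- c * (\<theta>\<^sup>2) ^ k + C * \<eta> ^ (2 * k)) ^ n"
          unfolding f_def norm_power using bd[OF \<theta>, of \<eta>] \<eta> by (intro power_mono) auto
        also have "\<dots> = exp (real n * (C * \<eta> ^ (2 * k))) * exp (- c * (t * \<theta>\<^sup>2) ^ k)"
          unfolding power_mult_distrib t(2)
          by (simp add: exp_of_nat_mult[symmetric] exp_add[symmetric] algebra_simps)
        also have "\<dots> \<le> ?E * g \<theta>" using Cn g by (intro mult_mono) auto
        finally show ?thesis .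
      qed
      from cos_sum_coeff_bound[OF b j this has_integral_mult_right[OF I(1)]]
      have "\<bar>b j\<bar> \<le> exp (- real j * \<eta>) / pi * (?E * I)" by blast
      also have "\<dots> \<le> exp (- real j * \<eta>) / pi * (?E * (exp c * pi / sqrt (c * t)))"
        using I(2) by (intro mult_left_mono) auto
      also have "\<dots> = ?E * (exp c / sqrt (c * t)) * exp (- real j * \<eta>)" by simp
      finally show ?thesis .
    qed
    define Q where "Q = (\<Sum>j | j \<le> N \<and> real j < D. smult (b j) (cheb \<Lambda> j))"
    have Qc: "coeff Q i = 0" if "D \<le> real i" for i
    proof -
      have "coeff (cheb \<Lambda> j) i = 0" if "real j < D" for j
        using that \<open>D \<le> real i\<close> degree_cheb[of \<Lambda> j] by (intro coeff_eq_0) linarith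
      then show ?thesis unfolding Q_def coeff_sum by (intro sum.neutral) auto
    qed
    have "\<bar>(1 - x ^ k) ^ n - poly Q x\<bar> \<le> A * exp (- (a / 2) * ?\<omega>)" if x: "x \<in> {0..\<Lambda>}" for x
    proof -
      define \<theta> where "\<theta> = arccos (1 - 2 * x / \<Lambda>)"
      have "cos \<theta> = 1 - 2 * x / \<Lambda>" unfolding \<theta>_def using x \<Lambda> by (intro cos_arccos) (auto simp: field_simps)
      then have x\<theta>: "\<Lambda> / 2 * (1 - cos \<theta>) = x" using \<Lambda> by (simp add: field_simps)
      have "complex_of_real ((1 - x ^ k) ^ n) = f (of_real \<theta>)"
        unfolding f_def x\<theta>[symmetric] by (simp add: cos_of_real)
      also have "\<dots> = of_real (\<Sum>j\<le>N. b j * cos (real j * \<theta>))"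
      proof -
        have "cos (of_nat j * complex_of_real \<theta>) = of_real (cos (real j * \<theta>))" for j
          by (metis cos_of_real of_real_mult of_real_of_nat_eq)
        then show ?thesis unfolding b by simp
      qed
      finally have "(1 - x ^ k) ^ n = (\<Sum>j\<le>N. b j * cos (real j * \<theta>))"
        using of_real_eq_iff by blast
      also have "\<dots> = (\<Sum>j | j \<le> N \<and> real j < D. b j * cos (real j * \<theta>)) + (\<Sum>j | j \<le> N \<and> D \<le> real j. b j * cos (real j * \<theta>))"
        by (subst sum.union_disjoint[symmetric]) (auto intro!: sum.cong)
      also have "(\<Sum>j | j \<le> N \<and> real j < D. b j * cos (real j * \<theta>)) = poly Q x"
        unfolding Q_def poly_sum poly_smult x\<theta>[symmetric] using \<Lambda> by (subst poly_cheb) auto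
      finally have "\<bar>(1 - x ^ k) ^ n - poly Q x\<bar> = \<bar>\<Sum>j | j \<le> N \<and> D \<le> real j. b j * cos (real j * \<theta>)\<bar>" by simp
      also have "\<dots> \<le> (\<Sum>j | j \<le> N \<and> D \<le> real j. \<bar>b j\<bar> * 1)"
        by (intro order_trans[OF sum_abs] sum_mono) (auto simp: abs_mult intro!: mult_left_le)
      also have "\<dots> \<le> (\<Sum>j | j \<le> N \<and> D \<le> real j. ?E * (exp c / sqrt (c * t)) * exp (- real j * \<eta>))"
        using bj D1 by (intro sum_mono) auto
      also have "\<dots> = ?E * (exp c / sqrt (c * t)) * (\<Sum>j | j \<le> N \<and> D \<le> real j. exp (- real j * \<eta>))"
        by (simp only: sum_distrib_left)
      also have "\<dots> \<le> ?E * (exp c / sqrt (c * t)) * (2 / \<eta> * exp (- D * \<eta>))"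
        using \<eta> \<eta>\<^sub>0 D c t by (intro mult_left_mono geometric_tail) auto
      also have "\<dots> = (2 * exp c / (sqrt c * (sqrt t * \<eta>))) * exp (- (a / 2) * ?\<omega>)"
      proof -
        have "exp (- D * \<eta>) = exp (- (a / 2) * ?\<omega>) * exp (- (a / 2) * ?\<omega>)"
          using Dom by (simp add: exp_add[symmetric])
        moreover have "?E * exp (- (a / 2) * ?\<omega>) = 1" by (simp add: exp_add[symmetric])
        ultimately have "?E * exp (- D * \<eta>) = exp (- (a / 2) * ?\<omega>)" by (metis mult.assoc mult_1)
        moreover have "?E * (exp c / sqrt (c * t)) * (2 / \<eta> * exp (- D * \<eta>)) = (2 * exp c / (sqrt c * (sqrt t * \<eta>))) * (?E * exp (- D * \<eta>))"
          by (simp add: real_sqrt_mult mult_ac)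
        ultimately show ?thesis by simp
      qed
      also have "\<dots> \<le> A * exp (- (a / 2) * ?\<omega>)"
        unfolding A_def using st a c by (intro mult_right_mono frac_le mult_left_mono) auto
      finally show ?thesis .
    qed
    then show ?thesis using Qc by blast
  qed
  moreover have "0 < a / 2" using a by simp
  ultimately show ?thesis using that A by blast
qed

text \<open>Only trivial cases remain: if \<open>D\<close> exceeds \<open>k * n\<close> the power
  itself is an admissible polynomial, and at a rate of at most 1 the zero polynomial will do, since
  the power is at most 1 in modulus on the interval.\<close>

lemma power_approx:
  fixes \<Lambda> :: real
  assumes k: "1 \<le> k" and \<Lambda>: "0 < \<Lambda>" "\<Lambda> ^ k < 2"
  obtains A c where "0 < A" "0 < c"
    "\<And>n D. 1 \<le> n \<Longrightarrow> 0 \<le> D \<Longrightarrow>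
       poly_approx \<Lambda> D (\<lambda>x. (1 - x ^ k) ^ n) (\<lambda>x. A * exp (- c * decay_rate k n D))"
proof -
  obtain A c where A: "0 < A" and c: "0 < c" and
    ap: "\<And>n D. 1 \<le> n \<Longrightarrow> 0 \<le> D \<Longrightarrow> D \<le> real (k * n) \<Longrightarrow> 1 < decay_rate k n D \<Longrightarrow>
       poly_approx \<Lambda> D (\<lambda>x. (1 - x ^ k) ^ n) (\<lambda>x. A * exp (- c * decay_rate k n D))"
    using power_approx_aux[OF k \<Lambda>] by metis
  define A' where "A' = max A (exp c)"
  have "poly_approx \<Lambda> D (\<lambda>x. (1 - x ^ k) ^ n) (\<lambda>x. A' * exp (- c * decay_rate k n D))"
    if n: "1 \<le> n" and D: "0 \<le> D" for n D
  proof (cases "real (k * n) < D")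
    case True
    define Q :: "real poly" where "Q = (1 - monom 1 k) ^ n"
    have "degree (1 - monom 1 k :: real poly) \<le> k"
      by (intro degree_diff_le) (auto simp: degree_monom_le)
    then have "degree Q \<le> k * n" unfolding Q_def
      by (metis degree_power_le le_trans mult_le_mono1)
    then have "coeff Q i = 0" if "D \<le> real i" for i
      using that True by (intro coeff_eq_0) linarith
    moreover have "(1 - x ^ k) ^ n - poly Q x = 0" for x
      by (simp add: Q_def poly_monom)
    moreover have "0 \<le> A'" using A by (simp add: A'_def)
    ultimately show ?thesis by (intro exI[of _ Q]) auto
  next
    case F: False
    show ?thesis
    proof (cases "1 < decay_rate k n D")
      case True
      obtain Q where Q: "\<forall>i. D \<le> real i \<longrightarrow> coeff Q i = 0"
        "\<forall>x\<in>{0..\<Lambda>}. \<bar>(1 - x ^ k) ^ n - poly Q x\<bar> \<le> A * exp (- c * decay_rate k n D)"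
        using ap[OF n D _ True] F by auto
      have "A * exp (- c * decay_rate k n D) \<le> A' * exp (- c * decay_rate k n D)"
        by (intro mult_right_mono) (auto simp: A'_def)
      then show ?thesis using Q by (meson order_trans)
    next
      case False
      have "\<bar>(1 - x ^ k) ^ n - poly 0 x\<bar> \<le> A' * exp (- c * decay_rate k n D)" if x: "x \<in> {0..\<Lambda>}" for x
      proof -
        have "x ^ k \<le> \<Lambda> ^ k" using x by (intro power_mono) auto
        moreover have "0 \<le> x ^ k" using x by simp
        ultimately have "\<bar>1 - x ^ k\<bar> \<le> 1" using \<Lambda> by linarith
        then have "\<bar>(1 - x ^ k) ^ n\<bar> \<le> 1" by (simp add: power_abs power_le_one)
        also have "1 \<le> exp c * exp (- c * decay_rate k n D)"
          using False c mult_left_mono[of "decay_rate k n D" 1 c] by (simp flip: exp_add)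
        also have "\<dots> \<le> A' * exp (- c * decay_rate k n D)"
          by (intro mult_right_mono) (auto simp: A'_def)
        finally show ?thesis by simp
      qed
      then show ?thesis by (intro exI[of _ 0]) auto
    qed
  qed
  moreover have "0 < A'" using A by (simp add: A'_def)
  ultimately show ?thesis using that c by blast
qed

section \<open>Damping at the spectral scale\<close>

lemma poly_times_exp_bounded:
  fixes c :: real
  assumes "0 < c"
  obtains C where "0 < C" "\<And>s. 0 \<le> s \<Longrightarrow> (1 + s) ^ m * exp (- c * s) \<le> C"
proof -
  define b where "b = min 1 (c / real (Suc m))"
  have b: "0 < b" "b \<le> 1" using assms by (auto simp: b_def)
  have "b \<le> c / real (Suc m)" unfolding b_def by (rule min.cobounded2)
  then have bc: "b * real (Suc m) \<le> c" by (simp add: pos_le_divide_eq del: of_nat_Suc)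
  have "(1 + s) ^ m * exp (- c * s) \<le> (1 / b) ^ m" if s: "0 \<le> s" for s
  proof -
    have "b * (1 + s) \<le> 1 + b * s" using b by (simp add: algebra_simps)
    also have "\<dots> \<le> exp (b * s)" by (rule exp_ge_add_one_self)
    finally have "(b * (1 + s)) ^ m \<le> exp (b * s) ^ m" using b s by (intro power_mono) auto
    also have "\<dots> = exp (b * real m * s)" by (simp add: exp_of_nat_mult[symmetric] algebra_simps)
    also have "\<dots> \<le> exp (c * s)"
    proof -
      have "b * real m \<le> b * real (Suc m)" using b by simp
      then have "b * real m \<le> c" using bc by linarith
      then show ?thesis using s by (simp add: mult_right_mono)
    qed
    finally have "b ^ m * (1 + s) ^ m * exp (- c * s) \<le> exp (c * s) * exp (- c * s)"
      by (simp add: power_mult_distrib)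
    also have "\<dots> = 1" by (simp flip: exp_add)
    finally show ?thesis using b by (simp add: field_simps)
  qed
  moreover have "0 < (1 / b) ^ m" using b by simp
  ultimately show ?thesis using that by blast
qed

text \<open>Put \<open>t = n powr (1 / k)\<close>; the spectral variable of order
  \<open>1 / t\<close> is where \<open>n * x ^ k\<close> is of order 1. The factor
  \<open>t ^ l\<close> becomes \<open>n powr (l / k)\<close> in the theorem, and the
  \<open>J\<close>-th power pays later for a sum over dyadic times.\<close>

definition damping :: "nat \<Rightarrow> nat \<Rightarrow> nat \<Rightarrow> nat \<Rightarrow> real \<Rightarrow> real" where
  "damping k l J n x = 1 / ((real n powr (1 / real k)) ^ l * (1 + real n powr (1 / real k) * x) ^ J)"

lemma damping_nonneg: "0 \<le> x \<Longrightarrow> 0 \<le> damping k l J n x"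
  by (auto simp: damping_def intro!: mult_nonneg_nonneg add_nonneg_nonneg)

text \<open>The \<open>n\<close>-th power is at most a constant times
  \<open>exp (- c * (t * x))\<close>, which beats every power of \<open>1 + t * x\<close>.\<close>

lemma monomial_power_le_damping:
  fixes \<Lambda> :: real
  assumes k: "1 \<le> k" and \<Lambda>: "0 < \<Lambda>" "\<Lambda> ^ k < 2"
  obtains C where "0 < C"
    "\<And>n x. 1 \<le> n \<Longrightarrow> x \<in> {0..\<Lambda>} \<Longrightarrow> \<bar>x ^ l * (1 - x ^ k) ^ n\<bar> \<le> C * damping k l J n x"
proof -
  define c where "c = (2 - \<Lambda> ^ k) / 2"
  have c: "0 < c" using \<Lambda> by (simp add: c_def)
  obtain C where C: "0 < C" "\<And>s. 0 \<le> s \<Longrightarrow> (1 + s) ^ (l + J) * exp (- c * s) \<le> C"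
    using poly_times_exp_bounded[OF c, of "l + J"] by metis
  have "\<bar>x ^ l * (1 - x ^ k) ^ n\<bar> \<le> exp c * C * damping k l J n x" if n: "1 \<le> n" and x: "x \<in> {0..\<Lambda>}" for n x
  proof -
    define t where "t = real n powr (1 / real k)"
    have t: "0 < t" "t ^ k = real n" using n k by (auto simp: t_def powr_realpow[symmetric] powr_powr)
    have x0: "0 \<le> x" "0 \<le> t * x" using x t by auto
    have "x ^ k \<le> \<Lambda> ^ k" using x by (intro power_mono) auto
    then have "\<bar>1 - x ^ k\<bar> \<le> 1 - c * x ^ k" unfolding c_def using x \<Lambda> by (intro abs_one_minus_le) auto
    also have "\<dots> \<le> exp (- c * x ^ k)" using exp_ge_add_one_self[of "- c * x ^ k"] by simp
    finally have "\<bar>1 - x ^ k\<bar> ^ n \<le> exp (- c * x ^ k) ^ n" by (intro power_mono) auto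
    also have "\<dots> = exp (- c * (t * x) ^ k)"
      unfolding power_mult_distrib t by (simp add: exp_of_nat_mult[symmetric] algebra_simps)
    also have "\<dots> \<le> exp c * exp (- c * (t * x))" using c x0 k by (intro exp_neg_power_le) auto
    finally have "(t * x) ^ l * (1 + t * x) ^ J * \<bar>1 - x ^ k\<bar> ^ n \<le> (1 + t * x) ^ l * (1 + t * x) ^ J * (exp c * exp (- c * (t * x)))"
      using x0 by (intro mult_mono power_mono) auto
    also have "\<dots> = exp c * ((1 + t * x) ^ (l + J) * exp (- c * (t * x)))" by (simp add: power_add)
    also have "\<dots> \<le> exp c * C" using C(2)[OF x0(2)] by simp
    finally have *: "(t * x) ^ l * (1 + t * x) ^ J * \<bar>1 - x ^ k\<bar> ^ n \<le> exp c * C" .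
    have "0 < 1 + t * x" using x0 by linarith
    then have "0 < t ^ l * (1 + t * x) ^ J" using t by (intro mult_pos_pos zero_less_power)
    moreover have "\<bar>x ^ l * (1 - x ^ k) ^ n\<bar> * (t ^ l * (1 + t * x) ^ J) \<le> exp c * C"
      using * x0 by (simp add: abs_mult power_abs power_mult_distrib algebra_simps)
    ultimately show ?thesis unfolding damping_def t_def[symmetric] by (simp add: pos_le_divide_eq)
  qed
  moreover have "0 < exp c * C" using C by simp
  ultimately show ?thesis using that by blast
qed

text \<open>For \<open>n >= 2\<close>, replacing \<open>n\<close> by \<open>n div 2\<close> costs at
  most a factor 3, attained at \<open>n = 3\<close>. This loss occurs at every halving and has to be
  beaten there.\<close>

lemma damping_third:
  assumes k: "1 \<le> k" and n: "1 \<le> n" "n \<le> 3 * n'" and x: "0 \<le> x"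
  shows "damping k l J n' x \<le> 3 ^ (l + J) * damping k l J n x"
proof -
  define t where "t = real n powr (1 / real k)"
  define t' where "t' = real n' powr (1 / real k)"
  have t: "0 < t" "0 < t'" using n by (auto simp: t_def t'_def)
  have "t \<le> (3 * real n') powr (1 / real k)" unfolding t_def using n by (intro powr_mono2) auto
  also have "\<dots> = 3 powr (1 / real k) * t'" by (simp add: t'_def powr_mult)
  also have "\<dots> \<le> 3 powr 1 * t'" using k t by (intro mult_right_mono powr_mono) auto
  finally have tt: "t / 3 \<le> t'" by simp
  have "(1 + t * x) / 3 \<le> 1 + t' * x" using mult_right_mono[OF tt x] by simp
  then have "(t / 3) ^ l * ((1 + t * x) / 3) ^ J \<le> t' ^ l * (1 + t' * x) ^ J"
    using tt t x by (intro mult_mono power_mono) auto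
  moreover have p: "0 < 1 + t * x" using t x by (intro add_pos_nonneg mult_nonneg_nonneg) auto
  then have "0 < (t / 3) ^ l * ((1 + t * x) / 3) ^ J" using t by simp
  ultimately have "1 / (t' ^ l * (1 + t' * x) ^ J) \<le> 1 / ((t / 3) ^ l * ((1 + t * x) / 3) ^ J)"
    by (intro frac_le) auto
  also have "\<dots> = 3 ^ (l + J) * (1 / (t ^ l * (1 + t * x) ^ J))"
    by (simp add: power_divide power_add)
  finally show ?thesis unfolding damping_def t_def t'_def .
qed

lemma decay_rate_scale:
  assumes "1 \<le> k" "0 < n" "0 < n'" "0 \<le> D" "0 \<le> a" "0 \<le> s" "s * real n' \<le> a ^ (2 * k) * real n"
  shows "s powr (1 / (2 * real k - 1)) * decay_rate k n D \<le> decay_rate k n' (a * D)"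
proof -
  have "s * (D ^ (2 * k) / real n) \<le> (a * D) ^ (2 * k) / real n'"
  proof -
    have "(s * real n') * D ^ (2 * k) \<le> (a ^ (2 * k) * real n) * D ^ (2 * k)"
      using assms by (intro mult_right_mono) auto
    then show ?thesis using assms by (simp add: power_mult_distrib field_simps)
  qed
  then have "(s * (D ^ (2 * k) / real n)) powr (1 / (2 * real k - 1)) \<le> decay_rate k n' (a * D)"
    unfolding decay_rate_def using assms by (intro powr_mono2) auto
  then show ?thesis unfolding decay_rate_def using assms by (subst powr_mult[symmetric]) auto
qed

text \<open>The truncated Chebyshev series is only uniformly close. The damping is gained by induction on
  \<open>n\<close>: write \<open>n = h + n div 2\<close>, approximate the \<open>h\<close>-th power with a fraction \<open>1 - q\<close> of the
  degree, and the damped remaining power with the fraction \<open>q\<close>. As \<open>q ^ (2 * k) > 1 / 2\<close>, the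
  decay rate grows at each halving.\<close>

lemma damped_power_approx:
  fixes \<Lambda> :: real
  assumes k: "1 \<le> k" and \<Lambda>: "0 < \<Lambda>" "\<Lambda> ^ k < 2"
  obtains B c where "0 < B" "0 < c"
    "\<And>n D. 1 \<le> n \<Longrightarrow> 0 \<le> D \<Longrightarrow>
       poly_approx \<Lambda> D (\<lambda>x. x ^ l * (1 - x ^ k) ^ n) (\<lambda>x. B * exp (- c * decay_rate k n D) * damping k l J n x)"
proof -
  obtain A c0 where A: "0 < A" and c0: "0 < c0" and
    ap: "\<And>n D. 1 \<le> n \<Longrightarrow> 0 \<le> D \<Longrightarrow>
       poly_approx \<Lambda> D (\<lambda>x. (1 - x ^ k) ^ n) (\<lambda>x. A * exp (- c0 * decay_rate k n D))"
    using power_approx[OF k \<Lambda>] by metis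
  obtain C where C: "0 < C"
    "\<And>n x. 1 \<le> n \<Longrightarrow> x \<in> {0..\<Lambda>} \<Longrightarrow> \<bar>x ^ l * (1 - x ^ k) ^ n\<bar> \<le> C * damping k l J n x"
    using monomial_power_le_damping[OF k \<Lambda>] by metis
  define e where "e = 1 / (2 * real k - 1)"
  have e: "0 < e" using k by (simp add: e_def)
  \<comment> \<open>Bernoulli's inequality gives \<open>q ^ (2 * k) >= 3 / 4\<close>. As the
    exponent is at least halved, the quotient inside the decay rate grows by a factor of at least 3
    / 2, whence \<gamma>.\<close>
  define q where "q = 1 - 1 / (8 * real k)"
  have q: "0 < q" "q < 1" using k by (auto simp: q_def field_simps)
  have q2: "3 / 4 \<le> q ^ (2 * k)"
    using Bernoulli_inequality[of "- (1 / (8 * real k))" "2 * k"] k by (simp add: q_def)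
  define \<gamma> where "\<gamma> = (3 / 2) powr e"
  have \<gamma>: "1 < \<gamma>" unfolding \<gamma>_def using e by simp
  define s where "s = ((1 - q) ^ (2 * k)) powr e"
  have s: "0 < s" using q by (simp add: s_def)
  define c where "c = c0 * s"
  have c: "0 < c" using c0 s by (simp add: c_def)
  define G where "G = (1 + A) * 3 ^ (l + J)"
  have G: "0 < G" using A by (simp add: G_def add_pos_pos)
  \<comment> \<open>Two thresholds: above the first, \<open>exp (- (c * (\<gamma> - 1)) * w)\<close>
    brings the loss \<open>G\<close> of one halving down to 1 / 2; above the second, at
    \<open>n = 1\<close>, \<open>D\<close> exceeds \<open>l + k\<close>, so the polynomial itself is
    admissible.\<close>
  define T where "T = max (max 0 (ln (2 * G) / (c * (\<gamma> - 1)))) (decay_rate k 1 (real (l + k)))"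
  have T1: "decay_rate k 1 (real (l + k)) \<le> T" by (simp add: T_def)
  have T2: "G * exp (- (c * (\<gamma> - 1)) * w) \<le> 1 / 2" if "T < w" for w
  proof -
    have "ln (2 * G) / (c * (\<gamma> - 1)) \<le> T" by (simp add: T_def)
    then have "ln (2 * G) / (c * (\<gamma> - 1)) \<le> w" using that by simp
    then have "ln (2 * G) \<le> c * (\<gamma> - 1) * w" using c \<gamma> by (simp add: field_simps)
    then have "exp (ln (2 * G)) \<le> exp (c * (\<gamma> - 1) * w)" by simp
    then have "2 * G \<le> exp (c * (\<gamma> - 1) * w)" using G by simp
    moreover have "exp (- (c * (\<gamma> - 1)) * w) = inverse (exp (c * (\<gamma> - 1) * w))"
      by (simp only: mult_minus_left exp_minus)
    moreover have "G * inverse X \<le> 1 / 2" if "2 * G \<le> X" "0 < X" for X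
      using that by (simp add: field_simps)
    ultimately show ?thesis by simp
  qed
  \<comment> \<open>Half of \<open>B\<close> takes the error of the undamped factor, the other half
    the inductive error; the second entry makes the zero polynomial work up to the threshold
    \<open>T\<close>.\<close>
  define B where "B = max (2 * A * C * 3 ^ (l + J)) (C * exp (c * T))"
  have B: "0 < B" "2 * (A * C * 3 ^ (l + J)) \<le> B" "C * exp (c * T) \<le> B" using C A by (auto simp: B_def less_max_iff_disj)
  have "poly_approx \<Lambda> D (\<lambda>x. x ^ l * (1 - x ^ k) ^ n) (\<lambda>x. B * exp (- c * decay_rate k n D) * damping k l J n x)"
    if "1 \<le> n" "0 \<le> D" for n D
    using that
  proof (induction n arbitrary: D rule: less_induct)
    case (less n)
    note n = less.prems(1) and D = less.prems(2)
    let ?\<omega> = "decay_rate k n D"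
    show ?case
    proof (cases "?\<omega> \<le> T")
      case True
      have "\<bar>x ^ l * (1 - x ^ k) ^ n - poly 0 x\<bar> \<le> B * exp (- c * ?\<omega>) * damping k l J n x" if x: "x \<in> {0..\<Lambda>}" for x
      proof -
        have "C \<le> C * (exp (c * T) * exp (- c * ?\<omega>))"
          using True c C by (simp flip: exp_add)
        also have "\<dots> \<le> B * exp (- c * ?\<omega>)" using mult_right_mono[OF B(3), of "exp (- c * ?\<omega>)"] by simp
        finally have "C * damping k l J n x \<le> B * exp (- c * ?\<omega>) * damping k l J n x"
          using damping_nonneg[of x k l J n] x by (intro mult_right_mono) auto
        then show ?thesis using C(2)[OF n x] by simp
      qed
      then show ?thesis by (intro exI[of _ 0]) auto
    next
      case F: False
      show ?thesis
      proof (cases "n = 1")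
        case True
        define Q :: "real poly" where "Q = monom 1 l * (1 - monom 1 k)"
        have "real (l + k) < D"
        proof (rule ccontr)
          assume "\<not> real (l + k) < D"
          then have "D ^ (2 * k) \<le> real (l + k) ^ (2 * k)" using D by (intro power_mono) auto
          then have "?\<omega> \<le> decay_rate k 1 (real (l + k))"
            unfolding decay_rate_def True using D k by (intro powr_mono2) auto
          then show False using T1 F by simp
        qed
        moreover have "degree Q \<le> l + k"
        proof -
          have "degree (1 - monom 1 k :: real poly) \<le> k"
            by (intro degree_diff_le) (auto simp: degree_monom_le)
          moreover have "degree (monom 1 l :: real poly) \<le> l" by (rule degree_monom_le)
          ultimately show ?thesis unfolding Q_def by (meson add_mono degree_mult_le le_trans)
        qed
        ultimately have "coeff Q i = 0" if "D \<le> real i" for i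
          using that by (intro coeff_eq_0) linarith
        moreover have "x ^ l * (1 - x ^ k) ^ n - poly Q x = 0" for x
          by (simp add: Q_def poly_monom True)
        ultimately show ?thesis using B damping_nonneg
          by (intro exI[of _ Q]) (auto intro!: mult_nonneg_nonneg)
      next
        case False
        define n' where "n' = n div 2"
        define h where "h = n - n'"
        have nh: "1 \<le> n'" "1 \<le> h" "n' < n" "n \<le> 3 * n'" "2 * n' \<le> n" "n = h + n'" "h \<le> n"
          using n False by (auto simp: n'_def h_def)
        obtain Q1 where Q1: "\<forall>i. (1 - q) * D \<le> real i \<longrightarrow> coeff Q1 i = 0"
          "\<forall>x\<in>{0..\<Lambda>}. \<bar>(1 - x ^ k) ^ h - poly Q1 x\<bar> \<le> A * exp (- c0 * decay_rate k h ((1 - q) * D))"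
          using ap[OF nh(2), of "(1 - q) * D"] q D by auto
        obtain Q2 where Q2: "\<forall>i. q * D \<le> real i \<longrightarrow> coeff Q2 i = 0"
          "\<forall>x\<in>{0..\<Lambda>}. \<bar>x ^ l * (1 - x ^ k) ^ n' - poly Q2 x\<bar>
              \<le> B * exp (- c * decay_rate k n' (q * D)) * damping k l J n' x"
          using less.IH[OF nh(3) nh(1), of "q * D"] q D by auto
        have r1: "s * ?\<omega> \<le> decay_rate k h ((1 - q) * D)"
          unfolding s_def e_def using k n nh D q by (intro decay_rate_scale) (auto intro!: mult_left_mono)
        have r2: "\<gamma> * ?\<omega> \<le> decay_rate k n' (q * D)"
          unfolding \<gamma>_def e_def
        proof (intro decay_rate_scale)
          have "3 / 2 * real n' \<le> 3 / 4 * real n" using nh(5) by linarith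
          also have "\<dots> \<le> q ^ (2 * k) * real n" using q2 by (intro mult_right_mono) auto
          finally show "3 / 2 * real n' \<le> q ^ (2 * k) * real n" .
        qed (use k n nh D q in auto)
        have cof: "coeff (Q1 * Q2) i = 0" if i: "D \<le> real i" for i
          unfolding coeff_mult
        proof (intro sum.neutral ballI)
          fix j assume j: "j \<in> {..i}"
          then have "(1 - q) * D + q * D \<le> real j + real (i - j)" using i by (simp add: of_nat_diff algebra_simps)
          then have "(1 - q) * D \<le> real j \<or> q * D \<le> real (i - j)" by linarith
          then show "coeff Q1 j * coeff Q2 (i - j) = 0" using Q1(1) Q2(1) by auto
        qed
        have "\<bar>x ^ l * (1 - x ^ k) ^ n - poly (Q1 * Q2) x\<bar> \<le> B * exp (- c * ?\<omega>) * damping k l J n x"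
          if x: "x \<in> {0..\<Lambda>}" for x
        proof -
          let ?W = "damping k l J n x" and ?W' = "damping k l J n' x"
          have W: "0 \<le> ?W" "0 \<le> ?W'" "?W' \<le> 3 ^ (l + J) * ?W"
            using x k n nh by (auto intro!: damping_nonneg damping_third)
          have "x ^ k \<le> \<Lambda> ^ k" using x by (intro power_mono) auto
          moreover have "0 \<le> x ^ k" using x by simp
          ultimately have "\<bar>1 - x ^ k\<bar> \<le> 1" using \<Lambda> by linarith
          then have kap: "\<bar>(1 - x ^ k) ^ h\<bar> \<le> 1" by (simp add: power_abs power_le_one)
          have "A * exp (- c0 * decay_rate k h ((1 - q) * D)) \<le> A * exp (- c * ?\<omega>)"
            using A mult_left_mono[OF r1, of c0] c0 by (simp add: c_def mult.assoc)
          then have b1: "\<bar>(1 - x ^ k) ^ h - poly Q1 x\<bar> \<le> A * exp (- c * ?\<omega>)"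
            using Q1(2) x by (meson order_trans)
          have "A * exp (- c * ?\<omega>) \<le> A * 1" using A c by (intro mult_left_mono) auto
          then have b2: "\<bar>poly Q1 x\<bar> \<le> 1 + A" using b1 kap by linarith
          have "exp (- c * decay_rate k n' (q * D)) \<le> exp (- c * (\<gamma> * ?\<omega>))"
            using mult_left_mono[OF r2, of c] c by simp
          then have "B * exp (- c * decay_rate k n' (q * D)) * ?W' \<le> B * exp (- c * (\<gamma> * ?\<omega>)) * ?W'"
            using B W by (intro mult_right_mono mult_left_mono) auto
          then have b3: "\<bar>x ^ l * (1 - x ^ k) ^ n' - poly Q2 x\<bar> \<le> B * exp (- c * (\<gamma> * ?\<omega>)) * ?W'"
            using Q2(2) x by (meson order_trans)
          have "x ^ l * (1 - x ^ k) ^ n - poly (Q1 * Q2) x =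
              ((1 - x ^ k) ^ h - poly Q1 x) * (x ^ l * (1 - x ^ k) ^ n')
              + poly Q1 x * (x ^ l * (1 - x ^ k) ^ n' - poly Q2 x)"
            unfolding nh(6) power_add by (simp add: algebra_simps)
          also have "\<bar>\<dots>\<bar> \<le> \<bar>(1 - x ^ k) ^ h - poly Q1 x\<bar> * \<bar>x ^ l * (1 - x ^ k) ^ n'\<bar>
              + \<bar>poly Q1 x\<bar> * \<bar>x ^ l * (1 - x ^ k) ^ n' - poly Q2 x\<bar>"
            by (metis abs_mult abs_triangle_ineq)
          also have "\<dots> \<le> (A * exp (- c * ?\<omega>)) * (C * ?W') + (1 + A) * (B * exp (- c * (\<gamma> * ?\<omega>)) * ?W')"
            using b1 b2 b3 C(2)[OF nh(1) x] A by (intro add_mono mult_mono) auto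
          also have "\<dots> = (A * C * exp (- c * ?\<omega>) + (1 + A) * B * exp (- c * (\<gamma> * ?\<omega>))) * ?W'"
            by (simp add: algebra_simps)
          also have "\<dots> \<le> (A * C * exp (- c * ?\<omega>) + (1 + A) * B * exp (- c * (\<gamma> * ?\<omega>))) * (3 ^ (l + J) * ?W)"
            using W A B C by (intro mult_left_mono add_nonneg_nonneg mult_nonneg_nonneg) auto
          also have "\<dots> = (A * C * 3 ^ (l + J) * exp (- c * ?\<omega>) + B * (G * exp (- c * (\<gamma> * ?\<omega>)))) * ?W"
            by (simp add: G_def algebra_simps)
          also have "exp (- c * (\<gamma> * ?\<omega>)) = exp (- (c * (\<gamma> - 1)) * ?\<omega>) * exp (- c * ?\<omega>)"
            by (simp add: exp_add[symmetric] algebra_simps)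
          also have "(A * C * 3 ^ (l + J) * exp (- c * ?\<omega>) + B * (G * (exp (- (c * (\<gamma> - 1)) * ?\<omega>) * exp (- c * ?\<omega>)))) * ?W
             \<le> (B / 2 * exp (- c * ?\<omega>) + B * (1 / 2 * exp (- c * ?\<omega>))) * ?W"
          proof (rule mult_right_mono[OF add_mono])
            show "A * C * 3 ^ (l + J) * exp (- c * ?\<omega>) \<le> B / 2 * exp (- c * ?\<omega>)"
              using B(2) by (intro mult_right_mono) auto
            have "G * exp (- (c * (\<gamma> - 1)) * ?\<omega>) * exp (- c * ?\<omega>) \<le> 1 / 2 * exp (- c * ?\<omega>)"
              using T2[of ?\<omega>] F by (intro mult_right_mono) auto
            then show "B * (G * (exp (- (c * (\<gamma> - 1)) * ?\<omega>) * exp (- c * ?\<omega>))) \<le> B * (1 / 2 * exp (- c * ?\<omega>))"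
              using B(1) by (intro mult_left_mono) (auto simp: mult.assoc)
          qed (use W in auto)
          also have "\<dots> = B * exp (- c * ?\<omega>) * ?W" by simp
          finally show ?thesis .
        qed
        then show ?thesis using cof by blast
      qed
    qed
  qed
  then show ?thesis using that B(1) c by blast
qed

section \<open>Polynomials positive on an interval\<close>

text \<open>A cone of certificates of nonnegativity where \<open>A\<close> and \<open>B\<close> are
  nonnegative. The product \<open>A * B\<close> is among the generators so that multiplication by
  \<open>A\<close> or by \<open>B\<close> stays inside; generation by sums lets positivity of a
  quadratic form be checked on generators.\<close>

inductive_set pos_cone :: "real poly \<Rightarrow> real poly \<Rightarrow> real poly set" for A B where
  base: "g \<in> {1, A, B, A * B} \<Longrightarrow> q * q * g \<in> pos_cone A B"
| add: "p \<in> pos_cone A B \<Longrightarrow> q \<in> pos_cone A B \<Longrightarrow> p + q \<in> pos_cone A B"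

lemma pos_cone_mult_square: "p \<in> pos_cone A B \<Longrightarrow> q * q * p \<in> pos_cone A B"
proof (induction rule: pos_cone.induct)
  case (base g r)
  have "q * q * (r * r * g) = (q * r) * (q * r) * g" by (simp only: ac_simps)
  then show ?case using pos_cone.base[OF base, of "q * r"] by (simp only:)
next
  case (add p r)
  then show ?case by (simp only: distrib_left pos_cone.add)
qed

lemma pos_cone_mult_left: "p \<in> pos_cone A B \<Longrightarrow> A * p \<in> pos_cone A B"
proof (induction rule: pos_cone.induct)
  case (base g r)
  then consider "g = 1" | "g = A" | "g = B" | "g = A * B" by blast
  then show ?case
  proof cases
    case 1
    then have "A * (r * r * g) = r * r * A" by (simp only: ac_simps mult_1)
    then show ?thesis using pos_cone.base[of A A B r] by (simp only: insert_iff simp_thms)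
  next
    case 2
    then have "A * (r * r * g) = (A * r) * (A * r) * 1" by (simp only: ac_simps mult_1)
    then show ?thesis using pos_cone.base[of 1 A B "A * r"] by (simp only: insert_iff simp_thms)
  next
    case 3
    then have "A * (r * r * g) = r * r * (A * B)" by (simp only: ac_simps)
    then show ?thesis using pos_cone.base[of "A * B" A B r] by (simp only: insert_iff simp_thms)
  next
    case 4
    then have "A * (r * r * g) = (A * r) * (A * r) * B" by (simp only: ac_simps)
    then show ?thesis using pos_cone.base[of B A B "A * r"] by (simp only: insert_iff simp_thms)
  qed
next
  case (add p r)
  then show ?case by (simp only: distrib_left pos_cone.add)
qed

lemma pos_cone_commute: "p \<in> pos_cone A B \<Longrightarrow> p \<in> pos_cone B A"
proof (induction rule: pos_cone.induct)
  case (base g r)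
  then show ?case by (intro pos_cone.base) (auto simp: mult.commute)
qed (rule pos_cone.add)

lemma pos_cone_mult_right: "p \<in> pos_cone A B \<Longrightarrow> B * p \<in> pos_cone A B"
  using pos_cone_commute pos_cone_mult_left by blast

lemma pos_cone_mult_const:
  assumes "p \<in> pos_cone A B" "0 \<le> c"
  shows "[:c:] * p \<in> pos_cone A B"
proof -
  have "[:c:] = [:sqrt c:] * [:sqrt c:]" using assms by simp
  then show ?thesis using pos_cone_mult_square[OF assms(1), of "[:sqrt c:]"] by metis
qed

lemma poly_map_of_real_add:
  "poly (map_poly complex_of_real (p + q)) w = poly (map_poly of_real p) w + poly (map_poly of_real q) w"
proof (induction p arbitrary: q)
  case (pCons a p)
  then show ?case by (cases q) (simp add: map_poly_pCons algebra_simps)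
qed simp

lemma poly_map_of_real_mult:
  "poly (map_poly complex_of_real (p * q)) w = poly (map_poly of_real p) w * poly (map_poly of_real q) w"
proof -
  have smult: "poly (map_poly complex_of_real (smult c p)) w = of_real c * poly (map_poly of_real p) w" for c p
    by (induction p) (simp_all add: map_poly_pCons algebra_simps)
  show ?thesis
    by (induction p) (simp_all add: map_poly_pCons poly_map_of_real_add smult algebra_simps)
qed

text \<open>Division by the real quadratic with nonreal root \<open>w\<close> leaves a real
  remainder of degree at most 1 that vanishes at \<open>w\<close>, hence is zero. The quadratic is
  displayed as a sum of two squares, the shape that \<open>pos_cone\<close> absorbs.\<close>

lemma real_poly_factor:
  fixes p :: "real poly"
  assumes "degree p \<noteq> 0"
  obtains z q where "p = [:- z, 1:] * q"
    | \<alpha> \<beta> q where "\<beta> \<noteq> 0" "p = ([:- \<alpha>, 1:] * [:- \<alpha>, 1:] + [:\<beta>:] * [:\<beta>:]) * q"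
proof -
  let ?ev = "\<lambda>p w. poly (map_poly complex_of_real p) w"
  have "degree (map_poly complex_of_real p) = degree p" by (rule degree_map_poly) auto
  then have "\<not> constant (poly (map_poly complex_of_real p))" using assms by (simp add: constant_degree)
  then obtain w where w: "?ev p w = 0" using fundamental_theorem_of_algebra by blast
  show ?thesis
  proof (cases "Im w = 0")
    case True
    then have "w = of_real (Re w)" by (simp add: complex_eq_iff)
    moreover have "of_real (poly p x) = ?ev p (of_real x)" for x
      by (induction p) (simp_all add: map_poly_pCons)
    ultimately have "of_real (poly p (Re w)) = (0::complex)" using w by metis
    then have "poly p (Re w) = 0" by simp
    then show ?thesis using that(1) by (auto simp: poly_eq_0_iff_dvd dvd_def)
  next
    case False
    define d where "d = [:- Re w, 1:] * [:- Re w, 1:] + [:Im w:] * [:Im w:]"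
    have d: "d = [:(Re w)\<^sup>2 + (Im w)\<^sup>2, - 2 * Re w, 1:]" by (simp add: d_def power2_eq_square)
    have dw: "?ev d w = 0"
      unfolding d by (simp add: map_poly_pCons complex_eq_iff power2_eq_square algebra_simps)
    define r where "r = p mod d"
    have r: "r = 0 \<or> degree r < 2"
      unfolding r_def using degree_mod_less[of d p] d by auto
    have "p = d * (p div d) + r" unfolding r_def by simp
    then have "?ev p w = ?ev d w * ?ev (p div d) w + ?ev r w"
      by (metis poly_map_of_real_add poly_map_of_real_mult)
    then have rw: "?ev r w = 0" using w dw by simp
    have "r = 0"
    proof -
      have e: "r = [:coeff r 0, coeff r 1:]"
        using r by (auto intro!: poly_eqI simp: coeff_pCons coeff_eq_0 split: nat.splits)
      have "?ev [:coeff r 0, coeff r 1:] w = 0" using rw e by simp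
      then have "of_real (coeff r 0) + w * of_real (coeff r 1) = 0"
        by (simp add: map_poly_pCons)
      then have "coeff r 1 = 0" "coeff r 0 = 0" using False by (auto simp: complex_eq_iff)
      then show ?thesis using e by simp
    qed
    then have "p = d * (p div d)" using \<open>p = d * (p div d) + r\<close> by simp
    then show ?thesis using that(2)[OF False] unfolding d_def by blast
  qed
qed

text \<open>Strict positivity keeps real roots off the interval. A root \<open>z < a\<close> gives
  \<open>x - z = (x - a) + (a - z)\<close>, a root \<open>z > b\<close> gives
  \<open>z - x = (b - x) + (z - b)\<close>, and a nonreal pair gives a sum of two squares. Each such
  factor is positive on the interval, so the cofactor is again positive there and has smaller
  degree.\<close>

lemma positive_poly_in_pos_cone:
  fixes p :: "real poly"
  assumes "a \<le> b" "\<And>x. x \<in> {a..b} \<Longrightarrow> 0 < poly p x"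
  shows "p \<in> pos_cone [:- a, 1:] [:b, - 1:]"
  using assms
proof (induction "degree p" arbitrary: p rule: less_induct)
  case less
  let ?C = "pos_cone [:- a, 1:] [:b, - 1:]"
  show ?case
  proof (cases "degree p = 0")
    case True
    then obtain c where p: "p = [:c:]" by (metis degree_eq_zeroE)
    then have "0 < c" using less.prems(2)[of a] less.prems(1) by simp
    moreover have "1 * 1 * 1 \<in> ?C" by (rule pos_cone.base) simp
    ultimately have "[:c:] * (1 * 1 * 1) \<in> ?C" by (intro pos_cone_mult_const) auto
    then show ?thesis using p by simp
  next
    case False
    have red: "q \<in> ?C" if "p = d * q" "\<And>x. x \<in> {a..b} \<Longrightarrow> 0 < poly d x" "degree d \<noteq> 0" for d q
    proof (rule less.hyps)
      have "p \<noteq> 0" using False by auto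
      then have "d \<noteq> 0" "q \<noteq> 0" using that by auto
      then show "degree q < degree p" using that by (simp add: degree_mult_eq)
      show "a \<le> b" by fact
      show "0 < poly q x" if "x \<in> {a..b}" for x
        using less.prems(2)[OF that] \<open>p = d * q\<close> \<open>x \<in> {a..b} \<Longrightarrow> 0 < poly d x\<close>[OF that]
        by (simp add: zero_less_mult_iff)
    qed
    from False show ?thesis
    proof (cases rule: real_poly_factor)
      case (1 z q)
      have nz: "\<not> (a \<le> z \<and> z \<le> b)" using less.prems(2)[of z] 1 by auto
      show ?thesis
      proof (cases "z < a")
        case True
        have q: "q \<in> ?C" using True by (intro red[OF 1]) auto
        have "p = [:- a, 1:] * q + [:a - z:] * q"
          unfolding 1 distrib_right[symmetric] by simp
        moreover have "[:- a, 1:] * q + [:a - z:] * q \<in> ?C"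
          using True by (intro pos_cone.add pos_cone_mult_left pos_cone_mult_const q) auto
        ultimately show ?thesis by simp
      next
        case False
        then have z: "b < z" using nz by auto
        \<comment> \<open>The factor is reversed to be positive on the interval, and the cofactor
          takes the sign.\<close>
        have p: "p = [:z, - 1:] * (- q)" unfolding 1 by simp
        have q: "- q \<in> ?C" using z by (intro red[OF p]) auto
        have "p = [:b, - 1:] * (- q) + [:z - b:] * (- q)"
          unfolding p distrib_right[symmetric] by simp
        moreover have "[:b, - 1:] * (- q) + [:z - b:] * (- q) \<in> ?C"
          using z by (intro pos_cone.add pos_cone_mult_right pos_cone_mult_const q) auto
        ultimately show ?thesis by simp
      qed
    next
      case (2 \<alpha> \<beta> q)
      have "0 < poly ([:- \<alpha>, 1:] * [:- \<alpha>, 1:] + [:\<beta>:] * [:\<beta>:]) x" for x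
      proof -
        have "poly ([:- \<alpha>, 1:] * [:- \<alpha>, 1:] + [:\<beta>:] * [:\<beta>:]) x = (x - \<alpha>)\<^sup>2 + \<beta>\<^sup>2"
          by (simp add: power2_eq_square algebra_simps)
        moreover have "0 < \<beta>\<^sup>2" using 2 by simp
        ultimately show ?thesis by (simp add: add_nonneg_pos)
      qed
      then have q: "q \<in> ?C" by (intro red[OF 2(2)]) auto
      then show ?thesis unfolding 2(2) distrib_right
        by (intro pos_cone.add pos_cone_mult_square)
    qed
  qed
qed

lemma discriminant_le:
  fixes b \<alpha> \<beta> :: real
  assumes "\<And>s t. 2 * s * t * b \<le> s\<^sup>2 * \<alpha> + t\<^sup>2 * \<beta>"
  shows "b\<^sup>2 \<le> \<alpha> * \<beta>"
proof (cases "\<alpha> = 0")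
  case True
  have "b = 0"
  proof (rule ccontr)
    assume "b \<noteq> 0"
    have "2 * ((\<bar>\<beta>\<bar> + 1) / b) * 1 * b \<le> \<beta>" using assms[of "(\<bar>\<beta>\<bar> + 1) / b" 1] True by simp
    then show False using \<open>b \<noteq> 0\<close> by simp
  qed
  then show ?thesis using True by simp
next
  case False
  have "0 \<le> \<alpha>" using assms[of 1 0] by simp
  then have "0 < \<alpha>" using False by simp
  have "2 * b * \<alpha> * b \<le> b\<^sup>2 * \<alpha> + \<alpha>\<^sup>2 * \<beta>" by (rule assms)
  then have "\<alpha> * b\<^sup>2 \<le> \<alpha> * (\<alpha> * \<beta>)" by (simp add: power2_eq_square algebra_simps)
  then show ?thesis using \<open>0 < \<alpha>\<close> by simp
qed

section \<open>The Markov operator on finitely supported functions\<close>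

locale locally_finite_graph =
  fixes \<mu> :: "'a::countable \<Rightarrow> 'a \<Rightarrow> real"
  assumes weighted_graph: "weighted_graph \<mu>"
    and locally_finite: "finite {v. \<mu> u v \<noteq> 0}"
begin

abbreviation m :: "'a \<Rightarrow> real" where "m \<equiv> vweight \<mu>"

definition nbrs :: "'a \<Rightarrow> 'a set" where "nbrs u = {v. \<mu> u v \<noteq> 0}"

lemma finite_nbrs [simp]: "finite (nbrs u)"
  using locally_finite by (simp add: nbrs_def)

lemma sym: "\<mu> u v = \<mu> v u"
  using weighted_graph by (auto simp: weighted_graph_def)

lemma nonneg: "0 \<le> \<mu> u v"
  using weighted_graph by (auto simp: weighted_graph_def)

lemma m_pos: "0 < m u"
  using weighted_graph by (auto simp: weighted_graph_def)

lemma connected: "(adj \<mu>)\<^sup>*\<^sup>* u v"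
  using weighted_graph by (auto simp: weighted_graph_def)

lemma nbrs_sym: "v \<in> nbrs u \<longleftrightarrow> u \<in> nbrs v"
  by (simp add: nbrs_def sym)

lemma infsum_nbrs:
  fixes h :: "'a \<Rightarrow> 'b::{topological_comm_monoid_add, t2_space}"
  assumes "\<And>v. v \<notin> nbrs u \<Longrightarrow> h v = 0"
  shows "infsum h UNIV = (\<Sum>v\<in>nbrs u. h v)"
  using infsum_cong_neutral[of "nbrs u" UNIV h h] assms by (simp add: infsum_finite)

lemma m_eq: "m u = (\<Sum>v\<in>nbrs u. \<mu> u v)"
  unfolding vweight_def by (rule infsum_nbrs) (simp add: nbrs_def)

definition P :: "('a \<Rightarrow> real) \<Rightarrow> 'a \<Rightarrow> real" where
  "P f u = (\<Sum>v\<in>nbrs u. \<mu> u v * f v) / m u"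

lemma P_m: "P f u * m u = (\<Sum>v\<in>nbrs u. \<mu> u v * f v)"
  using m_pos[of u] by (simp add: P_def)

lemma P_add: "P (\<lambda>v. f v + g v) = (\<lambda>u. P f u + P g u)"
  by (simp add: fun_eq_iff P_def distrib_left sum.distrib add_divide_distrib)

lemma P_scale: "P (\<lambda>v. c * f v) = (\<lambda>u. c * P f u)"
  by (simp add: fun_eq_iff P_def sum_distrib_left mult.left_commute)

lemma P_zero [simp]: "P (\<lambda>v. 0) = (\<lambda>u. 0)"
  by (simp add: fun_eq_iff P_def)

definition fs :: "('a \<Rightarrow> real) \<Rightarrow> bool" where "fs f \<longleftrightarrow> finite {u. f u \<noteq> 0}"

lemma fs_add [intro]: "fs f \<Longrightarrow> fs g \<Longrightarrow> fs (\<lambda>u. f u + g u)"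
  unfolding fs_def by (rule finite_subset[of _ "{u. f u \<noteq> 0} \<union> {u. g u \<noteq> 0}"]) auto

lemma fs_scale [intro]: "fs f \<Longrightarrow> fs (\<lambda>u. c * f u)"
  unfolding fs_def by (rule finite_subset[of _ "{u. f u \<noteq> 0}"]) auto

lemma fs_zero [simp]: "fs (\<lambda>u. 0)"
  by (simp add: fs_def)

lemma supp_P: "P f u \<noteq> 0 \<Longrightarrow> \<exists>v\<in>nbrs u. f v \<noteq> 0"
  unfolding P_def by (metis (no_types, lifting) divide_eq_0_iff mult_eq_0_iff sum.neutral)

lemma fs_P [intro]:
  assumes "fs f"
  shows "fs (P f)"
  unfolding fs_def
proof (rule finite_subset)
  show "{u. P f u \<noteq> 0} \<subseteq> (\<Union>v\<in>{u. f u \<noteq> 0}. nbrs v)" using supp_P nbrs_sym by blast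
  show "finite (\<Union>v\<in>{u. f u \<noteq> 0}. nbrs v)" using assms by (auto simp: fs_def)
qed

text \<open>The sum runs over the support of the first argument, so for \<open>fs f\<close> it is
  finite whatever \<open>g\<close> is; linearity in the second argument is then free, and linearity
  in the first needs finite supports.\<close>

definition ip :: "('a \<Rightarrow> real) \<Rightarrow> ('a \<Rightarrow> real) \<Rightarrow> real" where
  "ip f g = (\<Sum>u | f u \<noteq> 0. f u * g u * m u)"

lemma ip_eq:
  assumes "fs f" "finite A" "\<And>u. f u \<noteq> 0 \<Longrightarrow> g u \<noteq> 0 \<Longrightarrow> u \<in> A"
  shows "ip f g = (\<Sum>u\<in>A. f u * g u * m u)"
proof -
  have "ip f g = (\<Sum>u\<in>{u. f u \<noteq> 0} \<inter> A. f u * g u * m u)"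
    unfolding ip_def using assms by (intro sum.mono_neutral_right) (auto simp: fs_def)
  also have "\<dots> = (\<Sum>u\<in>A. f u * g u * m u)"
    using assms by (intro sum.mono_neutral_left) auto
  finally show ?thesis .
qed

lemma ip_commute: "fs f \<Longrightarrow> fs g \<Longrightarrow> ip f g = ip g f"
  by (subst ip_eq[of f "{u. f u \<noteq> 0} \<union> {u. g u \<noteq> 0}" g], auto simp: fs_def)
     (subst ip_eq[of g "{u. f u \<noteq> 0} \<union> {u. g u \<noteq> 0}" f], auto simp: fs_def ac_simps)

lemma ip_add_left:
  assumes "fs f" "fs g"
  shows "ip (\<lambda>u. f u + g u) h = ip f h + ip g h"
proof -
  let ?A = "{u. f u \<noteq> 0} \<union> {u. g u \<noteq> 0}"
  have A: "finite ?A" using assms by (simp add: fs_def)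
  have 1: "ip (\<lambda>u. f u + g u) h = (\<Sum>u\<in>?A. (f u + g u) * h u * m u)"
    by (rule ip_eq) (use A assms in auto)
  have 2: "ip f h = (\<Sum>u\<in>?A. f u * h u * m u)" by (rule ip_eq) (use A assms in auto)
  have 3: "ip g h = (\<Sum>u\<in>?A. g u * h u * m u)" by (rule ip_eq) (use A assms in auto)
  show ?thesis unfolding 1 2 3 by (simp add: sum.distrib[symmetric] algebra_simps)
qed

lemma ip_scale_left:
  assumes "fs f"
  shows "ip (\<lambda>u. c * f u) h = c * ip f h"
proof -
  have 1: "ip (\<lambda>u. c * f u) h = (\<Sum>u | f u \<noteq> 0. (c * f u) * h u * m u)"
    by (rule ip_eq) (use assms in \<open>auto simp: fs_def\<close>)
  show ?thesis unfolding 1 unfolding ip_def by (simp add: sum_distrib_left algebra_simps)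
qed

lemma ip_lin_left:
  assumes "fs f" "fs g"
  shows "ip (\<lambda>u. s * f u + t * g u) h = s * ip f h + t * ip g h"
  using assms by (simp add: ip_add_left ip_scale_left fs_scale)

lemma ip_add_right: "ip h (\<lambda>u. f u + g u) = ip h f + ip h g"
  unfolding ip_def by (simp add: sum.distrib[symmetric] algebra_simps)

lemma ip_scale_right: "ip h (\<lambda>u. c * f u) = c * ip h f"
  unfolding ip_def by (simp add: sum_distrib_left algebra_simps)

lemma ip_nonneg: "0 \<le> ip f f"
  unfolding ip_def using m_pos by (intro sum_nonneg) (auto simp: less_imp_le)

lemma ip_P:
  assumes "fs f" "fs g" "finite A" "finite B" "\<And>u. f u \<noteq> 0 \<Longrightarrow> u \<in> A" "\<And>u. g u \<noteq> 0 \<Longrightarrow> u \<in> B"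
  shows "ip (P f) g = (\<Sum>u\<in>B. \<Sum>v\<in>A. \<mu> u v * f v * g u)"
proof -
  have "ip (P f) g = (\<Sum>u\<in>B. P f u * g u * m u)"
    by (rule ip_eq) (use assms in auto)
  also have "\<dots> = (\<Sum>u\<in>B. \<Sum>v\<in>A. \<mu> u v * f v * g u)"
  proof (rule sum.cong[OF refl])
    fix u
    have "(\<Sum>v\<in>nbrs u. \<mu> u v * f v) = (\<Sum>v\<in>nbrs u \<inter> A. \<mu> u v * f v)"
      using assms by (intro sum.mono_neutral_right) auto
    also have "\<dots> = (\<Sum>v\<in>A. \<mu> u v * f v)"
      using assms by (intro sum.mono_neutral_left) (auto simp: nbrs_def)
    finally have "P f u * m u = (\<Sum>v\<in>A. \<mu> u v * f v)" unfolding P_m .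
    then have "(P f u * m u) * g u = (\<Sum>v\<in>A. \<mu> u v * f v * g u)" by (simp only: sum_distrib_right)
    then show "P f u * g u * m u = (\<Sum>v\<in>A. \<mu> u v * f v * g u)" by (simp only: ac_simps)
  qed
  finally show ?thesis .
qed

lemma ip_P_commute:
  assumes "fs f" "fs g"
  shows "ip (P f) g = ip f (P g)"
proof -
  let ?A = "{u. f u \<noteq> 0}" and ?B = "{u. g u \<noteq> 0}"
  have "ip (P f) g = (\<Sum>u\<in>?B. \<Sum>v\<in>?A. \<mu> u v * f v * g u)"
    by (rule ip_P) (use assms in \<open>auto simp: fs_def\<close>)
  also have "\<dots> = (\<Sum>v\<in>?A. \<Sum>u\<in>?B. \<mu> v u * g u * f v)"
    by (subst sum.swap) (simp add: sym ac_simps)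
  also have "\<dots> = ip (P g) f"
    by (rule ip_P[symmetric]) (use assms in \<open>auto simp: fs_def\<close>)
  also have "\<dots> = ip f (P g)" using assms by (intro ip_commute) auto
  finally show ?thesis .
qed

text \<open>For \<open>s = -1\<close> this is the energy identity, for \<open>s = 1\<close> its
  counterpart that yields P >= -1. \<open>A\<close> has to contain the support together with its
  neighbours, so that each edge meeting the support is counted from both ends.\<close>

lemma signed_energy:
  assumes f: "fs f" and A: "finite A" "\<And>u. f u \<noteq> 0 \<Longrightarrow> u \<in> A" "\<And>u v. f u \<noteq> 0 \<Longrightarrow> v \<in> nbrs u \<Longrightarrow> v \<in> A"
    and s: "s\<^sup>2 = 1"
  shows "(\<Sum>u\<in>A. \<Sum>v\<in>nbrs u. \<mu> u v * (f u + s * f v)\<^sup>2) = 2 * ip f f + 2 * s * ip (P f) f"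
proof -
  have ff: "ip f f = (\<Sum>u\<in>A. (f u)\<^sup>2 * m u)"
    using ip_eq[OF f A(1), of f] A by (simp add: power2_eq_square)
  have e: "\<mu> u v * (f u + s * f v)\<^sup>2 = \<mu> u v * (f u)\<^sup>2 + 2 * s * (\<mu> u v * f v * f u) + \<mu> u v * (f v)\<^sup>2" for u v
  proof -
    have "(f u + s * f v)\<^sup>2 = (f u)\<^sup>2 + 2 * s * (f v * f u) + s\<^sup>2 * (f v)\<^sup>2"
      by (simp add: power2_eq_square algebra_simps)
    then show ?thesis unfolding s by (simp add: algebra_simps)
  qed
  have 1: "(\<Sum>u\<in>A. \<Sum>v\<in>nbrs u. \<mu> u v * (f u)\<^sup>2) = ip f f"
    unfolding ff m_eq by (simp add: sum_distrib_right sum_distrib_left mult.commute)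
  have 2: "(\<Sum>u\<in>A. \<Sum>v\<in>nbrs u. \<mu> u v * f v * f u) = ip (P f) f"
  proof -
    have "ip (P f) f = (\<Sum>u\<in>A. P f u * f u * m u)" by (rule ip_eq) (use f A in auto)
    also have "\<dots> = (\<Sum>u\<in>A. \<Sum>v\<in>nbrs u. \<mu> u v * f v * f u)"
    proof (rule sum.cong[OF refl])
      fix u
      have "(P f u * m u) * f u = (\<Sum>v\<in>nbrs u. \<mu> u v * f v * f u)"
        unfolding P_m by (simp only: sum_distrib_right)
      then show "P f u * f u * m u = (\<Sum>v\<in>nbrs u. \<mu> u v * f v * f u)" by (simp only: ac_simps)
    qed
    finally show ?thesis by simp
  qed
  have 3: "(\<Sum>u\<in>A. \<Sum>v\<in>nbrs u. \<mu> u v * (f v)\<^sup>2) = ip f f"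
  proof -
    have "(\<Sum>u\<in>A. \<Sum>v\<in>nbrs u. \<mu> u v * (f v)\<^sup>2) = (\<Sum>u\<in>A. \<Sum>v | f v \<noteq> 0. \<mu> u v * (f v)\<^sup>2)"
    proof (rule sum.cong[OF refl])
      fix u
      have "(\<Sum>v\<in>nbrs u. \<mu> u v * (f v)\<^sup>2) = (\<Sum>v\<in>nbrs u \<inter> {v. f v \<noteq> 0}. \<mu> u v * (f v)\<^sup>2)"
        by (intro sum.mono_neutral_right) auto
      also have "\<dots> = (\<Sum>v | f v \<noteq> 0. \<mu> u v * (f v)\<^sup>2)"
        using f by (intro sum.mono_neutral_left) (auto simp: nbrs_def fs_def)
      finally show "(\<Sum>v\<in>nbrs u. \<mu> u v * (f v)\<^sup>2) = (\<Sum>v | f v \<noteq> 0. \<mu> u v * (f v)\<^sup>2)" .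
    qed
    also have "\<dots> = (\<Sum>v | f v \<noteq> 0. \<Sum>u\<in>A. \<mu> u v * (f v)\<^sup>2)" by (rule sum.swap)
    also have "\<dots> = (\<Sum>v | f v \<noteq> 0. (f v)\<^sup>2 * m v)"
    proof (rule sum.cong[OF refl])
      fix v assume "v \<in> {v. f v \<noteq> 0}"
      then have "nbrs v \<subseteq> A" using A(3) by auto
      then have "(\<Sum>u\<in>A. \<mu> v u) = m v"
        unfolding m_eq using A(1) by (intro sum.mono_neutral_right) (auto simp: nbrs_def)
      then show "(\<Sum>u\<in>A. \<mu> u v * (f v)\<^sup>2) = (f v)\<^sup>2 * m v"
        by (simp add: sum_distrib_right[symmetric] sym[of _ v] mult.commute)
    qed
    also have "\<dots> = ip f f" unfolding ip_def by (simp add: power2_eq_square)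
    finally show ?thesis .
  qed
  have "(\<Sum>u\<in>A. \<Sum>v\<in>nbrs u. \<mu> u v * (f u + s * f v)\<^sup>2) = (\<Sum>u\<in>A. \<Sum>v\<in>nbrs u. \<mu> u v * (f u)\<^sup>2)
      + 2 * s * (\<Sum>u\<in>A. \<Sum>v\<in>nbrs u. \<mu> u v * f v * f u) + (\<Sum>u\<in>A. \<Sum>v\<in>nbrs u. \<mu> u v * (f v)\<^sup>2)"
    unfolding e by (simp only: sum.distrib sum_distrib_left)
  then show ?thesis unfolding 1 2 3 by simp
qed

lemma abs_ip_P_le:
  assumes f: "fs f"
  shows "ip (P f) f \<le> ip f f" "- ip f f \<le> ip (P f) f"
proof -
  let ?A = "{u. f u \<noteq> 0} \<union> (\<Union>u\<in>{u. f u \<noteq> 0}. nbrs u)"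
  have A: "finite ?A" using f by (simp add: fs_def)
  have *: "0 \<le> 2 * ip f f + 2 * s * ip (P f) f" if "s\<^sup>2 = 1" for s
    unfolding signed_energy[OF f A _ _ that, symmetric, simplified]
    by (subst signed_energy[OF f A _ _ that, symmetric]) (auto intro!: sum_nonneg mult_nonneg_nonneg nonneg)
  show "ip (P f) f \<le> ip f f" using *[of "-1"] by simp
  show "- ip f f \<le> ip (P f) f" using *[of 1] by simp
qed

text \<open>Horner's scheme for p(P) f, so that induction on \<open>pCons\<close> proves the rules
  of the operator calculus.\<close>

definition pop :: "real poly \<Rightarrow> ('a \<Rightarrow> real) \<Rightarrow> 'a \<Rightarrow> real" where
  "pop p f = fold_coeffs (\<lambda>a g u. a * f u + P g u) p (\<lambda>_. 0)"

lemma pop_0 [simp]: "pop 0 f = (\<lambda>_. 0)"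
  by (simp add: pop_def)

lemma pop_pCons [simp]: "pop (pCons a p) f = (\<lambda>u. a * f u + P (pop p f) u)"
proof (cases "p = 0 \<and> a = 0")
  case True
  then show ?thesis by (simp add: pop_def)
next
  case False
  then show ?thesis by (cases "p = 0") (auto simp: pop_def)
qed

lemma pop_1 [simp]: "pop 1 f = f"
  by (simp add: one_pCons)

lemma fs_pop [intro]: "fs f \<Longrightarrow> fs (pop p f)"
  by (induction p) auto

lemma pop_add: "pop (p + q) f = (\<lambda>u. pop p f u + pop q f u)"
proof (induction p arbitrary: q)
  case 0
  then show ?case by simp
next
  case (pCons a p)
  then show ?case by (cases q) (simp add: P_add algebra_simps)
qed

lemma pop_smult: "pop (smult c p) f = (\<lambda>u. c * pop p f u)"
  by (induction p) (auto simp: P_scale algebra_simps)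

lemma pop_mult: "pop (p * q) f = pop p (pop q f)"
  by (induction p) (auto simp: pop_add pop_smult)

lemma pop_lin: "pop p (\<lambda>u. s * f u + t * g u) = (\<lambda>u. s * pop p f u + t * pop p g u)"
  by (induction p) (auto simp: P_add P_scale algebra_simps)

lemma pop_P: "pop p (P f) = P (pop p f)"
  by (induction p) (auto simp: P_add P_scale)

lemma ip_pop_commute:
  assumes "fs f" "fs g"
  shows "ip (pop p f) g = ip f (pop p g)"
  using assms
proof (induction p arbitrary: g)
  case 0
  then show ?case by (simp add: ip_def)
next
  case (pCons a p)
  have "ip (P (pop p f)) g = ip (pop p f) (P g)" using pCons.prems by (intro ip_P_commute) auto
  also have "\<dots> = ip f (P (pop p g))" using pCons by (simp add: fs_P pop_P)
  finally show ?case using pCons.prems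
    by (simp add: ip_add_left ip_add_right ip_scale_left ip_scale_right fs_P fs_pop fs_scale)
qed

lemma ip_pop_bilinear:
  assumes "fs f" "fs h"
  shows "ip (pop p (\<lambda>u. s * f u + t * h u)) (\<lambda>u. s * f u + t * h u)
    = s\<^sup>2 * ip (pop p f) f + 2 * s * t * ip (pop p f) h + t\<^sup>2 * ip (pop p h) h"
proof -
  have "ip (pop p h) f = ip (pop p f) h"
    using assms by (subst ip_pop_commute) (auto intro!: ip_commute)
  then show ?thesis unfolding pop_lin using assms
    by (simp add: ip_add_left ip_add_right ip_scale_left ip_scale_right fs_pop fs_scale power2_eq_square algebra_simps)
qed

text \<open>Polarisation: the two hypotheses, taken at \<open>s * f + t * h\<close> and at
  \<open>s * f - t * h\<close>, are added so that only the mixed term of \<open>g\<close> and the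
  pure terms of \<open>w\<close> survive. The form of \<open>g\<close> may be indefinite; only its
  domination by that of \<open>w\<close> enters.\<close>

lemma form_cauchy_schwarz:
  assumes f: "fs f" "fs h"
    and 1: "\<And>f. fs f \<Longrightarrow> ip (pop g f) f \<le> ip (pop w f) f"
    and 2: "\<And>f. fs f \<Longrightarrow> - ip (pop g f) f \<le> ip (pop w f) f"
  shows "(ip (pop g f) h)\<^sup>2 \<le> ip (pop w f) f * ip (pop w h) h"
proof (rule discriminant_le)
  fix s t :: real
  let ?a = "\<lambda>u. s * f u + t * h u" and ?b = "\<lambda>u. s * f u + (- t) * h u"
  have "fs ?a" "fs ?b" by (intro fs_add fs_scale f)+
  then have "ip (pop g ?a) ?a - ip (pop g ?b) ?b \<le> ip (pop w ?a) ?a + ip (pop w ?b) ?b"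
    using 1[of ?a] 2[of ?b] by linarith
  then show "2 * s * t * ip (pop g f) h \<le> s\<^sup>2 * ip (pop w f) f + t\<^sup>2 * ip (pop w h) h"
    unfolding ip_pop_bilinear[OF f] by (simp add: algebra_simps)
qed


section \<open>Point masses, matrix entries and distance\<close>

definition \<delta> :: "'a \<Rightarrow> 'a \<Rightarrow> real" where "\<delta> v u = (if u = v then 1 else 0)"

text \<open>Normalised to have mass 1 for \<open>m\<close>, so that pairing with it evaluates a
  function at \<open>v\<close> (\<open>ip_dens\<close>) and matrix entries become values of a
  symmetric form.\<close>

definition dens :: "'a \<Rightarrow> 'a \<Rightarrow> real" where "dens v u = \<delta> v u / m v"

lemma fs_\<delta> [simp]: "fs (\<delta> v)"
  unfolding fs_def by (rule finite_subset[of _ "{v}"]) (auto simp: \<delta>_def)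

lemma dens_eq: "dens v = (\<lambda>u. (1 / m v) * \<delta> v u)"
  by (simp add: fun_eq_iff dens_def)

lemma fs_dens [simp]: "fs (dens v)"
  unfolding dens_eq by (intro fs_scale) simp

lemma ip_dens: "fs f \<Longrightarrow> ip f (dens v) = f v"
  using ip_eq[of f "{v}" "dens v"] m_pos[of v]
  by (force simp: dens_def \<delta>_def split: if_splits)

lemma markov_pow_Suc: "markov_pow \<mu> (Suc i) u v = P (\<lambda>w. markov_pow \<mu> i w v) u"
proof -
  have "markov_pow \<mu> (Suc i) u v = (\<Sum>w\<in>nbrs u. markov \<mu> u w * markov_pow \<mu> i w v)"
    by (simp, rule infsum_nbrs) (simp add: markov_def nbrs_def)
  then show ?thesis by (simp add: P_def markov_def sum_divide_distrib)
qed

lemma markov_pow_eq: "(\<lambda>u. markov_pow \<mu> i u v) = (P ^^ i) (\<delta> v)"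
proof (induction i)
  case 0
  then show ?case by (simp add: fun_eq_iff \<delta>_def)
next
  case (Suc i)
  then show ?case by (simp add: fun_eq_iff markov_pow_Suc del: markov_pow.simps)
qed

lemma pop_sum: "pop p f u = (\<Sum>i\<le>degree p. coeff p i * (P ^^ i) f u)"
proof (induction p arbitrary: u)
  case 0
  then show ?case by simp
next
  case (pCons a p)
  have Psum: "P (\<lambda>u. \<Sum>i\<in>I. h i u) u = (\<Sum>i\<in>I. P (h i) u)" if "finite I" for I :: "nat set" and h u
    using that by (induction I rule: finite_induct) (auto simp: P_add)
  have "pop p f = (\<lambda>u. \<Sum>i\<le>degree p. coeff p i * (P ^^ i) f u)" using pCons by (simp add: fun_eq_iff)
  then have "P (pop p f) u = (\<Sum>i\<le>degree p. coeff p i * (P ^^ Suc i) f u)"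
    by (simp add: Psum P_scale)
  then have "pop (pCons a p) f u = a * f u + (\<Sum>i\<le>degree p. coeff p i * (P ^^ Suc i) f u)" by simp
  also have "\<dots> = (\<Sum>i\<le>Suc (degree p). coeff (pCons a p) i * (P ^^ i) f u)"
    by (subst sum.atMost_Suc_shift) simp
  also have "\<dots> = (\<Sum>i\<le>degree (pCons a p). coeff (pCons a p) i * (P ^^ i) f u)"
    by (cases "p = 0") simp_all
  finally show ?case .
qed

lemma poly_kernel_eq: "poly_kernel \<mu> p u v = pop p (\<delta> v) u"
  unfolding poly_kernel_def pop_sum using markov_pow_eq[of _ v] by (simp add: fun_eq_iff)

lemma poly_kernel_dens: "poly_kernel \<mu> p u v = m v * ip (pop p (dens v)) (dens u)"
proof -
  have "pop p (dens v) = (\<lambda>u. 1 / m v * pop p (\<delta> v) u)"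
    unfolding dens_eq using pop_lin[of p "1 / m v" "\<delta> v" 0 "\<delta> v"] by simp
  moreover have "ip (pop p (dens v)) (dens u) = pop p (dens v) u" by (intro ip_dens fs_pop fs_dens)
  ultimately show ?thesis using m_pos[of v] by (simp add: poly_kernel_eq)
qed

lemma adj_iff: "adj \<mu> u v \<longleftrightarrow> v \<in> nbrs u"
  using nonneg[of u v] by (auto simp: adj_def nbrs_def)

lemma adj_relpowp_sym: "(adj \<mu> ^^ n) u v \<Longrightarrow> (adj \<mu> ^^ n) v u"
proof (induction n arbitrary: v)
  case (Suc n)
  then obtain w where "(adj \<mu> ^^ n) u w" "adj \<mu> w v" by auto
  have "(adj \<mu> ^^ n) w u" by (rule Suc.IH) fact
  moreover have "adj \<mu> v w" using \<open>adj \<mu> w v\<close> by (simp add: adj_def sym[of v w])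
  ultimately show ?case by (rule relpowp_Suc_I2[rotated])
qed auto

lemma gdist_le: "(adj \<mu> ^^ n) u v \<Longrightarrow> gdist \<mu> u v \<le> n"
  unfolding gdist_def by (rule Least_le)

lemma gdist_path: "(adj \<mu> ^^ gdist \<mu> u v) u v"
proof -
  obtain n where "(adj \<mu> ^^ n) u v" using connected[of u v] rtranclp_imp_relpowp by metis
  then show ?thesis unfolding gdist_def by (rule LeastI)
qed

lemma gdist_sym: "gdist \<mu> u v = gdist \<mu> v u"
  by (metis adj_relpowp_sym antisym gdist_le gdist_path)

lemma gdist_triangle: "gdist \<mu> u w \<le> gdist \<mu> u v + gdist \<mu> v w"
  by (intro gdist_le relpowp_trans[OF gdist_path gdist_path])

lemma gdist_self [simp]: "gdist \<mu> u u = 0"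
  using gdist_le[of 0 u u] by simp

lemma gdist_eq_0 [simp]: "gdist \<mu> u v = 0 \<longleftrightarrow> u = v"
  using gdist_path[of u v] by auto

lemma gdist_nbrs: "v \<in> nbrs u \<Longrightarrow> gdist \<mu> u v \<le> 1"
  using gdist_le[of 1 u v] by (simp add: adj_iff relpowp_1 del: relpowp.simps)

lemma finite_gdist_le: "finite {v. gdist \<mu> u v \<le> n}"
proof (induction n)
  case 0
  then show ?case by simp
next
  case (Suc n)
  have "{v. gdist \<mu> u v \<le> Suc n} \<subseteq> {v. gdist \<mu> u v \<le> n} \<union> (\<Union>w\<in>{v. gdist \<mu> u v \<le> n}. nbrs w)"
  proof
    fix v assume v: "v \<in> {v. gdist \<mu> u v \<le> Suc n}"
    show "v \<in> {v. gdist \<mu> u v \<le> n} \<union> (\<Union>w\<in>{v. gdist \<mu> u v \<le> n}. nbrs w)"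
    proof (cases "gdist \<mu> u v = Suc n")
      case True
      then have "(adj \<mu> ^^ Suc n) u v" using gdist_path[of u v] by simp
      then obtain w where "(adj \<mu> ^^ n) u w" "adj \<mu> w v" by auto
      then show ?thesis using gdist_le by (auto simp: adj_iff)
    next
      case False
      then show ?thesis using v by auto
    qed
  qed
  then show ?case by (rule finite_subset) (use Suc in auto)
qed

lemma finite_gball [simp]: "finite (gball \<mu> r u)"
proof (rule finite_subset)
  show "gball \<mu> r u \<subseteq> {v. gdist \<mu> u v \<le> nat \<lceil>r\<rceil>}"
    unfolding gball_def by (auto, linarith)
qed (rule finite_gdist_le)

lemma P_pow_\<delta>_nonzero: "(P ^^ i) (\<delta> v) u \<noteq> 0 \<Longrightarrow> gdist \<mu> u v \<le> i"
proof (induction i arbitrary: u)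
  case 0
  then show ?case by (auto simp: \<delta>_def split: if_splits)
next
  case (Suc i)
  then obtain w where "w \<in> nbrs u" "(P ^^ i) (\<delta> v) w \<noteq> 0" using supp_P by fastforce
  then have "gdist \<mu> u w \<le> 1" "gdist \<mu> w v \<le> i" using Suc gdist_nbrs by auto
  then show ?case using gdist_triangle[of u v w] by linarith
qed

text \<open>Finite propagation speed: only powers \<open>P ^^ i\<close> with \<open>i\<close> at
  least the distance can connect two vertices.\<close>

lemma pop_\<delta>_eq_0:
  assumes "\<And>i. D \<le> real i \<Longrightarrow> coeff p i = 0" "D \<le> real (gdist \<mu> u v)"
  shows "pop p (\<delta> v) u = 0"
  unfolding pop_sum
proof (intro sum.neutral ballI)
  fix i
  show "coeff p i * (P ^^ i) (\<delta> v) u = 0"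
  proof (cases "gdist \<mu> u v \<le> i")
    case True
    then show ?thesis using assms by auto
  next
    case False
    then show ?thesis using P_pow_\<delta>_nonzero by auto
  qed
qed

lemma pop_dens_eq_0:
  assumes "\<And>i. D \<le> real i \<Longrightarrow> coeff p i = 0" "D \<le> real (gdist \<mu> u v)"
  shows "pop p (dens v) u = 0"
proof -
  have "pop p (dens v) = (\<lambda>u. 1 / m v * pop p (\<delta> v) u)"
    unfolding dens_eq using pop_lin[of p "1 / m v" "\<delta> v" 0 "\<delta> v"] by simp
  then show ?thesis using pop_\<delta>_eq_0[OF assms] by simp
qed

lemma P_nonneg: "(\<And>v. 0 \<le> f v) \<Longrightarrow> 0 \<le> P f u"
  unfolding P_def using m_pos[of u] by (intro divide_nonneg_pos sum_nonneg mult_nonneg_nonneg nonneg) auto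

section \<open>From the spectrum to a lower bound for the form\<close>

lemma l2_of_real:
  assumes "fs f"
  shows "(\<lambda>u. complex_of_real (f u)) \<in> l2 m" "l2norm m (\<lambda>u. complex_of_real (f u)) = sqrt (ip f f)"
proof -
  let ?h = "\<lambda>u. (cmod (complex_of_real (f u)))\<^sup>2 * m u"
  let ?A = "{u. f u \<noteq> 0}"
  have A: "finite ?A" using assms by (simp add: fs_def)
  have "?h summable_on ?A" using A by (rule summable_on_finite)
  then show "(\<lambda>u. complex_of_real (f u)) \<in> l2 m"
  proof -
    have "?h summable_on UNIV \<longleftrightarrow> ?h summable_on ?A" by (rule summable_on_cong_neutral) auto
    then show ?thesis using \<open>?h summable_on ?A\<close> by (simp add: l2_def)
  qed
  have "infsum ?h UNIV = infsum ?h ?A" by (rule infsum_cong_neutral) auto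
  also have "\<dots> = sum ?h ?A" using A by (rule infsum_finite)
  also have "\<dots> = ip f f" unfolding ip_def by (simp add: power2_eq_square)
  finally show "l2norm m (\<lambda>u. complex_of_real (f u)) = sqrt (ip f f)" by (simp add: l2norm_def)
qed

lemma markov_op_of_real: "markov_op \<mu> (\<lambda>u. complex_of_real (f u)) u = of_real (P f u)"
proof -
  have "markov_op \<mu> (\<lambda>u. complex_of_real (f u)) u = (\<Sum>v\<in>nbrs u. complex_of_real (markov \<mu> u v) * of_real (f v))"
    unfolding markov_op_def by (rule infsum_nbrs) (simp add: markov_def nbrs_def)
  then show ?thesis by (simp add: P_def markov_def sum_divide_distrib)
qed

text \<open>With \<open>T = P - \<alpha>\<close> nonnegative, the Cauchy-Schwarz inequality for the form of \<open>T\<close> bounds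
  \<open>T f\<close> by the form at \<open>f\<close>, and the resolvent recovers \<open>f\<close> from \<open>T f\<close>.\<close>

lemma resolvent_form_bound:
  assumes ns: "complex_of_real \<alpha> \<notin> l2_spectrum m (markov_op \<mu>)"
    and lower: "\<And>f. fs f \<Longrightarrow> \<alpha> * ip f f \<le> ip (P f) f"
  obtains K where "0 < K" "\<And>f. fs f \<Longrightarrow> ip f f \<le> K * (ip (P f) f - \<alpha> * ip f f)"
proof -
  obtain S B where S: "\<And>f. f \<in> l2 m \<Longrightarrow> S (\<lambda>u. of_real \<alpha> * f u - markov_op \<mu> f u) = f"
    and B: "\<And>f. f \<in> l2 m \<Longrightarrow> l2norm m (S f) \<le> B * l2norm m f"
    using ns unfolding l2_spectrum_def l2_bounded_op_def by blast
  define K where "K = B\<^sup>2 * (1 + \<bar>\<alpha>\<bar>) + 1"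
  have K: "0 < K" unfolding K_def by (intro add_nonneg_pos mult_nonneg_nonneg) auto
  have "ip f f \<le> K * (ip (P f) f - \<alpha> * ip f f)" if f: "fs f" for f
  proof -
    let ?T = "[:- \<alpha>, 1:]"
    define h where "h = pop ?T f"
    have h: "fs h" "h = (\<lambda>u. (- \<alpha>) * f u + 1 * P f u)"
    proof -
      show "fs h" unfolding h_def using f by (rule fs_pop)
      show "h = (\<lambda>u. (- \<alpha>) * f u + 1 * P f u)" by (simp add: h_def)
    qed
    have Tf: "ip (pop ?T g) g = ip (P g) g - \<alpha> * ip g g" if "fs g" for g
    proof -
      have "pop ?T g = (\<lambda>u. (- \<alpha>) * g u + 1 * P g u)" by simp
      then have "ip (pop ?T g) g = (- \<alpha>) * ip g g + 1 * ip (P g) g"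
        using ip_lin_left[OF that fs_P[OF that]] by metis
      then show ?thesis by simp
    qed
    have T0: "0 \<le> ip (pop ?T g) g" if "fs g" for g using lower[OF that] Tf[OF that] by simp
    let ?F = "\<lambda>u. complex_of_real (f u)"
    \<comment> \<open>Here \<open>h\<close> is (P - \<alpha>) f while the resolvent inverts \<alpha>
      - P; hence the factor -1, which the norm ignores.\<close>
    have "(\<lambda>u. of_real \<alpha> * ?F u - markov_op \<mu> ?F u) = (\<lambda>u. complex_of_real ((- 1) * h u))"
      unfolding markov_op_of_real h(2) by (simp add: fun_eq_iff)
    then have "S (\<lambda>u. complex_of_real ((- 1) * h u)) = ?F" using S[OF l2_of_real(1)[OF f]] by simp
    then have "sqrt (ip f f) \<le> B * sqrt (ip (\<lambda>u. (- 1) * h u) (\<lambda>u. (- 1) * h u))"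
      using B[OF l2_of_real(1)[OF fs_scale[OF h(1), of "-1"]]] l2_of_real(2)[OF f] l2_of_real(2)[OF fs_scale[OF h(1), of "-1"]]
      by simp
    also have "ip (\<lambda>u. (- 1) * h u) (\<lambda>u. (- 1) * h u) = ip h h"
      by (simp only: ip_scale_left[OF h(1)] ip_scale_right)
    finally have "(sqrt (ip f f))\<^sup>2 \<le> (B * sqrt (ip h h))\<^sup>2" by (intro power_mono) (auto simp: ip_nonneg)
    then have 1: "ip f f \<le> B\<^sup>2 * ip h h" by (simp add: power_mult_distrib ip_nonneg)
    have "(ip (pop ?T f) h)\<^sup>2 \<le> ip (pop ?T f) f * ip (pop ?T h) h"
    proof (rule form_cauchy_schwarz[OF f h(1)])
      show "- ip (pop ?T g) g \<le> ip (pop ?T g) g" if "fs g" for g using T0[OF that] by linarith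
    qed simp
    then have "(ip h h)\<^sup>2 \<le> ip (pop ?T f) f * ip (pop ?T h) h" unfolding h_def[symmetric] .
    also have "\<dots> \<le> ip (pop ?T f) f * ((1 + \<bar>\<alpha>\<bar>) * ip h h)"
    proof (rule mult_left_mono[OF _ T0[OF f]])
      have "- \<alpha> * ip h h \<le> \<bar>\<alpha>\<bar> * ip h h" by (intro mult_right_mono ip_nonneg) auto
      then show "ip (pop ?T h) h \<le> (1 + \<bar>\<alpha>\<bar>) * ip h h"
        unfolding Tf[OF h(1)] using abs_ip_P_le(1)[OF h(1)] by (simp add: algebra_simps)
    qed
    finally have "ip h h * ip h h \<le> ((1 + \<bar>\<alpha>\<bar>) * ip (pop ?T f) f) * ip h h"
      by (simp add: power2_eq_square algebra_simps)
    then have 2: "ip h h \<le> (1 + \<bar>\<alpha>\<bar>) * ip (pop ?T f) f"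
    proof (cases "ip h h = 0")
      case True
      then show ?thesis using T0[OF f] by simp
    next
      case False
      then have "0 < ip h h" using ip_nonneg[of h] by simp
      then show ?thesis using \<open>ip h h * ip h h \<le> _\<close> by simp
    qed
    have "ip f f \<le> B\<^sup>2 * ((1 + \<bar>\<alpha>\<bar>) * ip (pop ?T f) f)"
      using 1 mult_left_mono[OF 2, of "B\<^sup>2"] by simp
    also have "\<dots> \<le> K * ip (pop ?T f) f" unfolding K_def using T0[OF f] by (simp add: algebra_simps)
    finally show ?thesis unfolding Tf[OF f] .
  qed
  then show ?thesis using that K by blast
qed

text \<open>The best constant \<alpha> in a lower bound for the form of P lies in the spectrum:
  otherwise \<open>resolvent_form_bound\<close> would improve it by \<open>1 / K\<close>. Hence it
  cannot be smaller than \<open>a\<close>. The bound P >= -1 shows that the set of admissible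
  constants is not empty.\<close>

lemma spectrum_lower_bound:
  assumes spec: "l2_spectrum m (markov_op \<mu>) \<subseteq> complex_of_real ` {a<..1}"
    and f: "fs f"
  shows "a * ip f f \<le> ip (P f) f"
proof -
  define R where "R = {\<alpha>. \<forall>f. fs f \<longrightarrow> \<alpha> * ip f f \<le> ip (P f) f}"
  define \<alpha> where "\<alpha> = Sup R"
  have ne: "- 1 \<in> R" unfolding R_def using abs_ip_P_le(2) by auto
  have bound: "\<beta> \<le> ip (P f) f / ip f f" if "\<beta> \<in> R" "fs f" "0 < ip f f" for \<beta> f
    using that unfolding R_def by (auto simp: field_simps)
  obtain x :: 'a where True by simp
  have "0 < ip (dens x) (dens x)" using ip_dens[of "dens x" x] m_pos[of x] by (simp add: dens_def \<delta>_def)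
  then have bdd: "bdd_above R" using bound[of _ "dens x"] by (intro bdd_aboveI) auto
  have "\<alpha> \<in> R"
    unfolding R_def
  proof (intro CollectI allI impI)
    fix f assume f: "fs f"
    show "\<alpha> * ip f f \<le> ip (P f) f"
    proof (cases "ip f f = 0")
      case True
      then show ?thesis using abs_ip_P_le(2)[OF f] by simp
    next
      case False
      then have p: "0 < ip f f" using ip_nonneg[of f] by simp
      have "\<alpha> \<le> ip (P f) f / ip f f" unfolding \<alpha>_def using ne bound[OF _ f p] by (intro cSup_least) auto
      then show ?thesis using p by (simp add: field_simps)
    qed
  qed
  have "a \<le> \<alpha>"
  proof (rule ccontr)
    assume "\<not> a \<le> \<alpha>"
    then have "complex_of_real \<alpha> \<notin> l2_spectrum m (markov_op \<mu>)" using spec by auto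
    then obtain K where K: "0 < K" "\<And>f. fs f \<Longrightarrow> ip f f \<le> K * (ip (P f) f - \<alpha> * ip f f)"
      using resolvent_form_bound \<open>\<alpha> \<in> R\<close> unfolding R_def by blast
    have "\<alpha> + 1 / K \<in> R" unfolding R_def using K by (auto simp: field_simps)
    then have "\<alpha> + 1 / K \<le> \<alpha>" unfolding \<alpha>_def using bdd by (intro cSup_upper) auto
    then show False using K by simp
  qed
  then have "a * ip f f \<le> \<alpha> * ip f f" by (intro mult_right_mono ip_nonneg)
  also have "\<dots> \<le> ip (P f) f" using \<open>\<alpha> \<in> R\<close> f unfolding R_def by auto
  finally show ?thesis .
qed

end

section \<open>Positivity of polynomial forms\<close>

locale spectral_graph = locally_finite_graph +
  fixes a :: real
  assumes a: "-1 < a" "a < 1"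
    and P_lower: "fs f \<Longrightarrow> a * ip f f \<le> ip (P f) f"
begin

text \<open>The delicate generator is the product of \<open>A = x - a\<close> and
  \<open>B = 1 - x\<close>. As \<open>A + B\<close> is the constant \<open>1 - a > 0\<close>, one
  has (1 - a) A B = B A B + A B A, and the two terms are the nonnegative forms of \<open>A\<close>
  and \<open>B\<close> evaluated at the images under \<open>B\<close> and \<open>A\<close>. This
  avoids a square root of an operator.\<close>

lemma pos_cone_form_nonneg:
  assumes "p \<in> pos_cone [:- a, 1:] [:1, - 1:]" "fs f"
  shows "0 \<le> ip (pop p f) f"
  using assms
proof (induction arbitrary: f rule: pos_cone.induct)
  case (base g q)
  define h where "h = pop q f"
  have h: "fs h" using base by (auto simp: h_def)
  have A: "0 \<le> ip (pop [:- a, 1:] h) h" if "fs h" for h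
  proof -
    have "pop [:- a, 1:] h = (\<lambda>u. (- a) * h u + 1 * P h u)" by simp
    then have "ip (pop [:- a, 1:] h) h = (- a) * ip h h + 1 * ip (P h) h"
      using ip_lin_left[OF that fs_P[OF that]] by metis
    then show ?thesis using P_lower[OF that] by simp
  qed
  have B: "0 \<le> ip (pop [:1, - 1:] h) h" if "fs h" for h
  proof -
    have "pop [:1, - 1:] h = (\<lambda>u. 1 * h u + (- 1) * P h u)" using P_scale[of "- 1" h] by simp
    then have "ip (pop [:1, - 1:] h) h = 1 * ip h h + (- 1) * ip (P h) h"
      using ip_lin_left[OF that fs_P[OF that]] by metis
    then show ?thesis using abs_ip_P_le(1)[OF that] by simp
  qed
  have "0 \<le> ip (pop g h) h"
  proof -
    from base consider "g = 1" | "g = [:- a, 1:]" | "g = [:1, - 1:]" | "g = [:- a, 1:] * [:1, - 1:]" by blast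
    then show ?thesis
    proof cases
      case 1
      then show ?thesis using ip_nonneg[of h] by simp
    next
      case 2
      then show ?thesis using A[OF h] by simp
    next
      case 3
      then show ?thesis using B[OF h] by simp
    next
      case 4
      let ?A = "[:- a, 1:]" and ?B = "[:1, - 1:] :: real poly"
      have "smult (1 - a) g = ?B * (?A * ?B) + ?A * (?B * ?A)"
      proof -
        have gen: "(X + Y) * (X * Y) = Y * (X * Y) + X * (Y * X)" for X Y :: "real poly"
          by (simp add: algebra_simps)
        have "smult (1 - a) g = (?A + ?B) * g" by simp
        also have "\<dots> = ?B * (?A * ?B) + ?A * (?B * ?A)" unfolding 4 by (rule gen)
        finally show ?thesis .
      qed
      have "(1 - a) * ip (pop g h) h = ip (pop (smult (1 - a) g) h) h"
        unfolding pop_smult using h by (intro ip_scale_left[symmetric] fs_pop)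
      also have "smult (1 - a) g = ?B * (?A * ?B) + ?A * (?B * ?A)" by fact
      also have "ip (pop (?B * (?A * ?B) + ?A * (?B * ?A)) h) h = ip (pop ?B (pop (?A * ?B) h)) h + ip (pop ?A (pop (?B * ?A) h)) h"
        unfolding pop_add pop_mult[of ?B] pop_mult[of ?A] using h by (intro ip_add_left fs_pop)
      also have "ip (pop ?B (pop (?A * ?B) h)) h = ip (pop ?A (pop ?B h)) (pop ?B h)"
        unfolding pop_mult[of ?A] using h by (intro ip_pop_commute fs_pop)
      also have "ip (pop ?A (pop (?B * ?A) h)) h = ip (pop ?B (pop ?A h)) (pop ?A h)"
        unfolding pop_mult[of ?B] using h by (intro ip_pop_commute fs_pop)
      finally have "0 \<le> (1 - a) * ip (pop g h) h"
        using A[OF fs_pop[OF h, of ?B]] B[OF fs_pop[OF h, of ?A]] by linarith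
      then show ?thesis using a by (metis diff_gt_0_iff_gt zero_le_mult_iff not_less)
    qed
  qed
  moreover have "ip (pop (q * q * g) f) f = ip (pop g h) h"
  proof -
    have "ip (pop (q * (g * q)) f) f = ip (pop q (pop g h)) f" by (simp only: pop_mult h_def)
    also have "\<dots> = ip (pop g h) h" unfolding h_def using base by (intro ip_pop_commute fs_pop)
    finally show ?thesis by (simp only: ac_simps)
  qed
  ultimately show ?case by simp
next
  case (add p q)
  then show ?case by (simp add: pop_add ip_add_left fs_pop)
qed

text \<open>The substitute for functional calculus. The certificate requires strict positivity,
  hence the added constant \<epsilon>, whose contribution is made arbitrarily small.\<close>

lemma poly_form_nonneg:
  assumes p: "\<And>x. x \<in> {a..1} \<Longrightarrow> 0 \<le> poly p x" and f: "fs f"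
  shows "0 \<le> ip (pop p f) f"
proof (rule field_le_epsilon)
  fix e :: real assume e: "0 < e"
  define \<epsilon> where "\<epsilon> = e / (ip f f + 1)"
  have i: "0 < ip f f + 1" using ip_nonneg[of f] by linarith
  have \<epsilon>: "0 < \<epsilon>" "\<epsilon> * ip f f \<le> e" using e i by (auto simp: \<epsilon>_def field_simps)
  have "p + [:\<epsilon>:] \<in> pos_cone [:- a, 1:] [:1, - 1:]"
    using a p \<epsilon> by (intro positive_poly_in_pos_cone) (auto simp: add_nonneg_pos)
  then have "0 \<le> ip (pop (p + [:\<epsilon>:]) f) f" using f by (rule pos_cone_form_nonneg)
  also have "\<dots> = ip (pop p f) f + \<epsilon> * ip f f"
    unfolding pop_add using f by (simp add: ip_add_left ip_scale_left fs_pop fs_scale)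
  finally show "0 \<le> ip (pop p f) f + e" using \<epsilon> by linarith
qed

lemma poly_form_mono:
  assumes "\<And>x. x \<in> {a..1} \<Longrightarrow> poly p x \<le> poly q x" "fs f"
  shows "ip (pop p f) f \<le> ip (pop q f) f"
proof -
  have "0 \<le> ip (pop (q + smult (- 1) p) f) f" using assms by (intro poly_form_nonneg) auto
  then show ?thesis unfolding pop_add pop_smult using assms(2)
    by (subst (asm) ip_add_left) (auto simp: ip_scale_left[of _ "- 1", simplified] fs_pop fs_scale[of _ "- 1", simplified])
qed

text \<open>With point masses for \<open>f\<close> and \<open>h\<close> this bounds an off-diagonal
  matrix entry by two diagonal ones.\<close>

lemma form_bound:
  assumes "\<And>x. x \<in> {a..1} \<Longrightarrow> \<bar>poly g x\<bar> \<le> poly w x" "fs f" "fs h"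
  shows "(ip (pop g f) h)\<^sup>2 \<le> ip (pop w f) f * ip (pop w h) h"
proof (rule form_cauchy_schwarz)
  show "ip (pop g f) f \<le> ip (pop w f) f" if "fs f" for f
    using assms(1) that by (intro poly_form_mono) (auto simp: abs_le_iff)
  show "- ip (pop g f) f \<le> ip (pop w f) f" if "fs f" for f
  proof -
    have "ip (pop (smult (- 1) g) f) f \<le> ip (pop w f) f"
      using assms(1) that by (intro poly_form_mono) (auto simp: abs_le_iff)
    then show ?thesis unfolding pop_smult using that
      by (simp add: ip_scale_left[of _ "- 1", simplified] fs_pop)
  qed
qed (use assms in auto)

end

section \<open>Volumes, averages and the heat kernel\<close>

context locally_finite_graph
begin

definition vol :: "'a \<Rightarrow> real \<Rightarrow> real" where "vol u r = (\<Sum>v\<in>gball \<mu> r u. m v)"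

definition avg :: "('a \<Rightarrow> real) \<Rightarrow> real \<Rightarrow> 'a \<Rightarrow> real" where
  "avg f r u = (\<Sum>v\<in>gball \<mu> r u. f v * m v) / vol u r"

text \<open>The squared gradient times \<open>m v\<close>, in which the normalising weight cancels
  (\<open>grad_sq_eq\<close>); a sum over all vertices sees every edge from both ends.\<close>

definition energy :: "('a \<Rightarrow> real) \<Rightarrow> 'a \<Rightarrow> real" where
  "energy f v = (\<Sum>w\<in>nbrs v. \<mu> v w * (f v - f w)\<^sup>2)"

abbreviation kernel_bound :: "nat \<Rightarrow> nat \<Rightarrow> real \<Rightarrow> real \<Rightarrow> nat \<Rightarrow> 'a \<Rightarrow> 'a \<Rightarrow> bool" where
  "kernel_bound k l C c n u v \<equiv>
     \<bar>poly_kernel \<mu> ([:1, - 1:] ^ l * (1 - [:1, - 1:] ^ k) ^ n) u v\<bar>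
     \<le> C * m v / ((real n powr (1 / real k)) ^ l *
         sqrt (vol u (real n powr (1 / (2 * real k))) * vol v (real n powr (1 / (2 * real k)))))
       * exp (- c * decay_rate k n (real (gdist \<mu> u v)))"

lemma mem_gball: "v \<in> gball \<mu> r u \<longleftrightarrow> real (gdist \<mu> u v) < r"
  by (simp add: gball_def)

lemma mem_gball_sym: "v \<in> gball \<mu> r u \<longleftrightarrow> u \<in> gball \<mu> r v"
  by (simp add: gball_def gdist_sym)

lemma vol_pos: "0 < r \<Longrightarrow> 0 < vol u r"
  unfolding vol_def using m_pos mem_gball[of u r u] by (intro sum_pos) auto

lemma vol_mono: "r \<le> s \<Longrightarrow> vol u r \<le> vol u s"
  unfolding vol_def using m_pos by (intro sum_mono2) (auto simp: mem_gball less_imp_le)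

lemma vol_shift: "real (gdist \<mu> u v) + r \<le> s \<Longrightarrow> vol u r \<le> vol v s"
  unfolding vol_def
proof (intro sum_mono2 subsetI)
  fix w assume "real (gdist \<mu> u v) + r \<le> s" "w \<in> gball \<mu> r u"
  then show "w \<in> gball \<mu> s v"
    using gdist_triangle[of v w u] gdist_sym[of u v] unfolding mem_gball by linarith
qed (use m_pos in \<open>auto simp: less_imp_le\<close>)

lemma gball_le_1:
  assumes "0 < r" "r \<le> 1"
  shows "gball \<mu> r u = {u}"
proof -
  have "real (gdist \<mu> u v) < r \<longleftrightarrow> gdist \<mu> u v = 0" for v
    using assms by (cases "gdist \<mu> u v") auto
  then show ?thesis by (auto simp: gball_def)
qed

lemma energy_nonneg: "0 \<le> energy f v"
  unfolding energy_def by (intro sum_nonneg mult_nonneg_nonneg nonneg) auto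

lemma sum_energy:
  assumes "fs f" "finite A" "\<And>u. f u \<noteq> 0 \<Longrightarrow> u \<in> A" "\<And>u v. f u \<noteq> 0 \<Longrightarrow> v \<in> nbrs u \<Longrightarrow> v \<in> A"
  shows "(\<Sum>v\<in>A. energy f v) = 2 * (ip f f - ip (P f) f)"
  using signed_energy[OF assms, where s = "-1"] unfolding energy_def by simp

lemma mass_P_le:
  assumes "fs f" "\<And>u. 0 \<le> f u"
  shows "(\<Sum>u | P f u \<noteq> 0. P f u * m u) \<le> (\<Sum>u | f u \<noteq> 0. f u * m u)"
proof -
  let ?T = "{u. f u \<noteq> 0}" and ?B = "{u. P f u \<noteq> 0}"
  have fin: "finite ?T" "finite ?B" using assms fs_P[of f] by (auto simp: fs_def)
  have "(\<Sum>u\<in>?B. P f u * m u) = (\<Sum>u\<in>?B. \<Sum>v\<in>?T. \<mu> u v * f v)"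
  proof (rule sum.cong[OF refl])
    fix u
    have "(\<Sum>v\<in>nbrs u. \<mu> u v * f v) = (\<Sum>v\<in>nbrs u \<inter> ?T. \<mu> u v * f v)"
      by (intro sum.mono_neutral_right) auto
    also have "\<dots> = (\<Sum>v\<in>?T. \<mu> u v * f v)"
      using fin by (intro sum.mono_neutral_left) (auto simp: nbrs_def)
    finally show "P f u * m u = (\<Sum>v\<in>?T. \<mu> u v * f v)" unfolding P_m .
  qed
  also have "\<dots> = (\<Sum>v\<in>?T. f v * (\<Sum>u\<in>?B. \<mu> v u))"
    by (subst sum.swap) (simp add: sum_distrib_left sym mult.commute)
  also have "\<dots> \<le> (\<Sum>v\<in>?T. f v * m v)"
  proof (intro sum_mono mult_left_mono assms)
    fix v
    have "(\<Sum>u\<in>?B. \<mu> v u) = (\<Sum>u\<in>?B \<inter> nbrs v. \<mu> v u)"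
      using fin by (intro sum.mono_neutral_right) (auto simp: nbrs_def)
    also have "\<dots> \<le> m v" unfolding m_eq by (intro sum_mono2) (auto simp: nonneg)
    finally show "(\<Sum>u\<in>?B. \<mu> v u) \<le> m v" .
  qed
  finally show ?thesis .
qed

abbreviation heat :: "nat \<Rightarrow> 'a \<Rightarrow> 'a \<Rightarrow> real" where
  "heat n x \<equiv> pop (monom 1 n) (dens x)"

lemma heat_Suc: "heat (Suc n) x = P (heat n x)"
  by (simp add: monom_Suc)

lemma heat_0: "heat 0 x = dens x"
  by (simp add: monom_0)

lemma heat_nonneg: "0 \<le> heat n x u"
proof (induction n arbitrary: u)
  case 0
  then show ?case using m_pos[of x] by (simp add: heat_0 dens_def \<delta>_def)
next
  case (Suc n)
  then show ?case unfolding heat_Suc by (intro P_nonneg)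
qed

lemma heat_mass_le_1: "(\<Sum>u | heat n x u \<noteq> 0. heat n x u * m u) \<le> 1"
proof (induction n)
  case 0
  have "{u. dens x u \<noteq> 0} = {x}" using m_pos[of x] by (auto simp: dens_def \<delta>_def)
  then show ?case using m_pos[of x] by (simp add: heat_0 dens_def \<delta>_def)
next
  case (Suc n)
  then show ?case unfolding heat_Suc using mass_P_le[of "heat n x"] heat_nonneg fs_pop[OF fs_dens] by force
qed

end

section \<open>Volume doubling and the Poincare inequality\<close>

locale doubling_graph = locally_finite_graph +
  fixes D K :: real
  assumes doubling: "0 < r \<Longrightarrow> vol u (2 * r) \<le> D * vol u r"
    and K: "0 \<le> K"
    and poincare: "0 < r \<Longrightarrow> (\<Sum>v\<in>gball \<mu> r u. (f v - avg f r u)\<^sup>2 * m v)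
       \<le> K * r\<^sup>2 * (\<Sum>v\<in>gball \<mu> (2 * r) u. energy f v)"
begin

lemma D_ge_1: "1 \<le> D"
proof -
  obtain u :: 'a where True by simp
  have "vol u 1 \<le> vol u (2 * 1)" by (rule vol_mono) simp
  also have "\<dots> \<le> D * vol u 1" by (rule doubling) simp
  finally show ?thesis using vol_pos[of 1 u] by simp
qed

lemma vol_power: "0 < r \<Longrightarrow> vol u (2 ^ i * r) \<le> D ^ i * vol u r"
proof (induction i)
  case 0
  then show ?case by simp
next
  case (Suc i)
  have "vol u (2 ^ Suc i * r) \<le> D * vol u (2 ^ i * r)" using doubling[of "2 ^ i * r" u] Suc by (simp add: mult.assoc)
  also have "\<dots> \<le> D * (D ^ i * vol u r)" using Suc D_ge_1 by (intro mult_left_mono) auto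
  finally show ?case by (simp add: mult.assoc)
qed

text \<open>An integer bound for the doubling dimension, the logarithm of \<open>D\<close> to base
  2. It serves both as exponent of volume growth and as order of the moment of the heat
  kernel.\<close>

definition \<nu> :: nat where "\<nu> = (SOME n. D \<le> 2 ^ n)"

lemma D_le_\<nu>: "D \<le> 2 ^ \<nu>"
proof -
  obtain n where "D < 2 ^ n" using real_arch_pow[of 2 D] by auto
  then show ?thesis unfolding \<nu>_def by (intro someI[of "\<lambda>n. D \<le> 2 ^ n" n]) auto
qed

lemma vol_growth:
  assumes A: "1 \<le> A" and r: "0 < r"
  shows "vol u (A * r) \<le> (2 * A) ^ \<nu> * vol u r"
proof -
  define i where "i = (LEAST i. A \<le> 2 ^ i)"
  obtain n where "A < 2 ^ n" using real_arch_pow[of 2 A] by auto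
  then have i: "A \<le> 2 ^ i" unfolding i_def by (intro LeastI[of "\<lambda>i. A \<le> 2 ^ i" n]) auto
  have i2: "2 ^ i \<le> 2 * A"
  proof (cases i)
    case 0
    then show ?thesis using A by simp
  next
    case (Suc j)
    then have "\<not> A \<le> 2 ^ j" using not_less_Least[of j "\<lambda>i. A \<le> 2 ^ i"] unfolding i_def[symmetric] by simp
    then show ?thesis using Suc by simp
  qed
  have "vol u (A * r) \<le> vol u (2 ^ i * r)" using i r by (intro vol_mono mult_right_mono) auto
  also have "\<dots> \<le> D ^ i * vol u r" by (rule vol_power[OF r])
  also have "\<dots> \<le> (2 * A) ^ \<nu> * vol u r"
  proof (intro mult_right_mono)
    have "D ^ i \<le> (2 ^ \<nu>) ^ i" using D_le_\<nu> D_ge_1 by (intro power_mono) auto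
    also have "\<dots> = (2 ^ i) ^ \<nu>" by (simp add: power_mult[symmetric] mult.commute)
    also have "\<dots> \<le> (2 * A) ^ \<nu>" using i2 by (intro power_mono) auto
    finally show "D ^ i \<le> (2 * A) ^ \<nu>" .
  qed (use vol_pos[OF r, of u] in simp)
  finally show ?thesis .
qed

text \<open>Balls of radius \<open>s\<close> whose centres are less than \<open>s\<close> apart have
  volumes within a factor \<open>D\<close>. So the weights \<open>m z / vol z s\<close> act as a
  partition of unity up to \<open>D\<close>, from below here and from above in
  \<open>weight_sum_upper\<close>.\<close>

lemma weight_sum_lower:
  assumes s: "0 < s"
  shows "1 \<le> D * (\<Sum>z\<in>gball \<mu> s y. m z / vol z s)"
proof -
  have v: "0 < vol y s" using vol_pos[OF s] .
  have "1 = D * (\<Sum>z\<in>gball \<mu> s y. m z / (D * vol y s))"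
    using v D_ge_1 unfolding sum_divide_distrib[symmetric] vol_def[symmetric] by simp
  also have "\<dots> \<le> D * (\<Sum>z\<in>gball \<mu> s y. m z / vol z s)"
  proof (intro mult_left_mono sum_mono divide_left_mono)
    fix z assume z: "z \<in> gball \<mu> s y"
    have "vol z s \<le> vol y (2 * s)" using z gdist_sym[of y z] by (intro vol_shift) (simp add: mem_gball)
    also have "\<dots> \<le> D * vol y s" by (rule doubling[OF s])
    finally show "vol z s \<le> D * vol y s" .
    show "0 \<le> m z" using m_pos[of z] by simp
    show "0 < D * vol y s * vol z s" using v D_ge_1 vol_pos[OF s, of z] by simp
  qed (use D_ge_1 in simp)
  finally show ?thesis .
qed

lemma weight_sum_upper:
  assumes s: "0 < s" and Z: "finite Z"
  shows "(\<Sum>z\<in>Z \<inter> gball \<mu> s y. m z / vol z s) \<le> D"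
proof -
  have v: "0 < vol y s" using vol_pos[OF s] .
  have "(\<Sum>z\<in>Z \<inter> gball \<mu> s y. m z / vol z s) \<le> (\<Sum>z\<in>gball \<mu> s y. m z / vol z s)"
    using m_pos vol_pos[OF s] by (intro sum_mono2) (auto simp: less_imp_le)
  also have "\<dots> \<le> (\<Sum>z\<in>gball \<mu> s y. m z * (D / vol y s))"
  proof (intro sum_mono)
    fix z assume z: "z \<in> gball \<mu> s y"
    have "vol y s \<le> vol z (2 * s)" using z by (intro vol_shift) (simp add: mem_gball)
    also have "\<dots> \<le> D * vol z s" by (rule doubling[OF s])
    finally have "1 / vol z s \<le> D / vol y s" using v vol_pos[OF s, of z] by (simp add: field_simps)
    then show "m z / vol z s \<le> m z * (D / vol y s)"
      using m_pos[of z] mult_left_mono[of "1 / vol z s" "D / vol y s" "m z"] by simp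
  qed
  also have "\<dots> = D" unfolding sum_distrib_right[symmetric] vol_def[symmetric] using v by simp
  finally show ?thesis .
qed

lemma weight_sum_upper2:
  assumes s: "0 < s" and Z: "finite Z"
  shows "(\<Sum>z\<in>Z \<inter> gball \<mu> (2 * s) y. m z / vol z s) \<le> D * D"
proof -
  have "(\<Sum>z\<in>Z \<inter> gball \<mu> (2 * s) y. m z / vol z s) \<le> (\<Sum>z\<in>Z \<inter> gball \<mu> (2 * s) y. D * (m z / vol z (2 * s)))"
  proof (intro sum_mono)
    fix z
    have "1 / vol z s \<le> D / vol z (2 * s)" using doubling[OF s, of z] vol_pos[OF s, of z] vol_pos[of "2 * s" z] s
      by (simp add: field_simps)
    then show "m z / vol z s \<le> D * (m z / vol z (2 * s))"
      using m_pos[of z] mult_left_mono[of "1 / vol z s" "D / vol z (2 * s)" "m z"] by (simp add: mult.commute)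
  qed
  also have "\<dots> = D * (\<Sum>z\<in>Z \<inter> gball \<mu> (2 * s) y. m z / vol z (2 * s))" by (simp only: sum_distrib_left)
  also have "\<dots> \<le> D * D" using s D_ge_1 Z by (intro mult_left_mono weight_sum_upper) auto
  finally show ?thesis .
qed

lemma sum_swap_gball:
  fixes h :: "'a \<Rightarrow> 'a \<Rightarrow> real"
  assumes "finite A" "finite B"
  shows "(\<Sum>z\<in>A. \<Sum>y\<in>B \<inter> gball \<mu> s z. h z y) = (\<Sum>y\<in>B. \<Sum>z\<in>A \<inter> gball \<mu> s y. h z y)"
proof -
  have "(\<Sum>z\<in>A. \<Sum>y\<in>B \<inter> gball \<mu> s z. h z y) = (\<Sum>z\<in>A. \<Sum>y\<in>B. if y \<in> gball \<mu> s z then h z y else 0)"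
    using assms by (intro sum.cong refl sum.inter_restrict)
  also have "\<dots> = (\<Sum>y\<in>B. \<Sum>z\<in>A. if z \<in> gball \<mu> s y then h z y else 0)"
    by (subst sum.swap) (simp only: mem_gball_sym)
  also have "\<dots> = (\<Sum>y\<in>B. \<Sum>z\<in>A \<inter> gball \<mu> s y. h z y)"
    using assms by (intro sum.cong refl sum.inter_restrict[symmetric])
  finally show ?thesis .
qed

text \<open>The local Poincare inequalities are summed over all centres \<open>z\<close> with weights
  \<open>m z / vol z s\<close>, which avoids a covering by balls of bounded overlap.\<close>

lemma pseudo_poincare:
  assumes f: "fs f" and s: "0 < s"
  defines "Z \<equiv> (\<Union>y\<in>{y. f y \<noteq> 0}. gball \<mu> s y)"
  shows "ip f f \<le> 4 * D ^ 3 * K * s\<^sup>2 * (ip f f - ip (P f) f) + 2 * D * (\<Sum>z\<in>Z. m z * (avg f s z)\<^sup>2)"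
proof -
  let ?Y = "{y. f y \<noteq> 0}"
  have Y: "finite ?Y" using f by (simp add: fs_def)
  have Z: "finite Z" unfolding Z_def using Y by auto
  define W where "W z = m z / vol z s" for z
  have W: "0 \<le> W z" for z unfolding W_def using m_pos[of z] vol_pos[OF s, of z] by simp
  \<comment> \<open>The support with its neighbours: outside this finite set the energy vanishes, so
    the sums over balls can be restricted to it before the order of summation is exchanged.\<close>
  define A where "A = ?Y \<union> (\<Union>u\<in>?Y. nbrs u)"
  have A: "finite A" unfolding A_def using Y by auto
  have enA: "energy f v = 0" if "v \<notin> A" for v
  proof -
    have "f v = 0" using that by (auto simp: A_def)
    moreover have "f w = 0" if "w \<in> nbrs v" for w using that \<open>v \<notin> A\<close> nbrs_sym by (auto simp: A_def)
    ultimately show ?thesis by (simp add: energy_def)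
  qed
  have "ip f f = (\<Sum>y\<in>?Y. 1 * ((f y)\<^sup>2 * m y))" unfolding ip_def by (simp add: power2_eq_square)
  also have "\<dots> \<le> (\<Sum>y\<in>?Y. (D * (\<Sum>z\<in>gball \<mu> s y. W z)) * ((f y)\<^sup>2 * m y))"
    unfolding W_def using m_pos by (intro sum_mono mult_right_mono weight_sum_lower s) (auto simp: less_imp_le)
  also have "\<dots> = D * (\<Sum>y\<in>?Y. \<Sum>z\<in>Z \<inter> gball \<mu> s y. W z * ((f y)\<^sup>2 * m y))"
  proof -
    have "Z \<inter> gball \<mu> s y = gball \<mu> s y" if "y \<in> ?Y" for y using that by (auto simp: Z_def)
    then show ?thesis unfolding sum_distrib_left
      by (intro sum.cong refl) (simp add: sum_distrib_left sum_distrib_right mult.assoc)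
  qed
  also have "(\<Sum>y\<in>?Y. \<Sum>z\<in>Z \<inter> gball \<mu> s y. W z * ((f y)\<^sup>2 * m y)) = (\<Sum>z\<in>Z. \<Sum>y\<in>?Y \<inter> gball \<mu> s z. W z * ((f y)\<^sup>2 * m y))"
    by (rule sum_swap_gball[symmetric]) (use Y Z in auto)
  also have "\<dots> \<le> (\<Sum>z\<in>Z. W z * (2 * K * s\<^sup>2 * (\<Sum>v\<in>gball \<mu> (2 * s) z. energy f v) + 2 * vol z s * (avg f s z)\<^sup>2))"
  proof (intro sum_mono)
    fix z
    have "(\<Sum>y\<in>?Y \<inter> gball \<mu> s z. (f y)\<^sup>2 * m y) \<le> (\<Sum>y\<in>gball \<mu> s z. (f y)\<^sup>2 * m y)"
      using m_pos by (intro sum_mono2) (auto simp: less_imp_le)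
    also have "\<dots> \<le> (\<Sum>y\<in>gball \<mu> s z. 2 * ((f y - avg f s z)\<^sup>2 * m y) + 2 * (avg f s z)\<^sup>2 * m y)"
    proof (intro sum_mono)
      fix y
      have "(f y)\<^sup>2 \<le> 2 * (f y - avg f s z)\<^sup>2 + 2 * (avg f s z)\<^sup>2"
        using zero_le_power2[of "f y - 2 * avg f s z"] by (simp add: power2_eq_square algebra_simps)
      then show "(f y)\<^sup>2 * m y \<le> 2 * ((f y - avg f s z)\<^sup>2 * m y) + 2 * (avg f s z)\<^sup>2 * m y"
        using m_pos[of y] mult_right_mono[of "(f y)\<^sup>2" "2 * (f y - avg f s z)\<^sup>2 + 2 * (avg f s z)\<^sup>2" "m y"]
        by (simp add: algebra_simps)
    qed
    also have "\<dots> = 2 * (\<Sum>y\<in>gball \<mu> s z. (f y - avg f s z)\<^sup>2 * m y) + 2 * vol z s * (avg f s z)\<^sup>2"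
      unfolding sum.distrib sum_distrib_left[symmetric] vol_def[symmetric] by simp
    also have "\<dots> \<le> 2 * (K * s\<^sup>2 * (\<Sum>v\<in>gball \<mu> (2 * s) z. energy f v)) + 2 * vol z s * (avg f s z)\<^sup>2"
      using poincare[OF s, of f z] by simp
    finally have "(\<Sum>y\<in>?Y \<inter> gball \<mu> s z. (f y)\<^sup>2 * m y)
      \<le> 2 * K * s\<^sup>2 * (\<Sum>v\<in>gball \<mu> (2 * s) z. energy f v) + 2 * vol z s * (avg f s z)\<^sup>2" by (simp add: mult.assoc)
    from mult_left_mono[OF this W[of z]]
    show "(\<Sum>y\<in>?Y \<inter> gball \<mu> s z. W z * ((f y)\<^sup>2 * m y))
      \<le> W z * (2 * K * s\<^sup>2 * (\<Sum>v\<in>gball \<mu> (2 * s) z. energy f v) + 2 * vol z s * (avg f s z)\<^sup>2)"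
      by (simp only: sum_distrib_left)
  qed
  also have "\<dots> = 2 * K * s\<^sup>2 * (\<Sum>z\<in>Z. \<Sum>v\<in>gball \<mu> (2 * s) z. W z * energy f v) + 2 * (\<Sum>z\<in>Z. m z * (avg f s z)\<^sup>2)"
  proof -
    have "W z * (2 * K * s\<^sup>2 * (\<Sum>v\<in>gball \<mu> (2 * s) z. energy f v) + 2 * vol z s * (avg f s z)\<^sup>2)
      = 2 * K * s\<^sup>2 * (\<Sum>v\<in>gball \<mu> (2 * s) z. W z * energy f v) + 2 * (m z * (avg f s z)\<^sup>2)" for z
    proof -
      have "W z * vol z s = m z" using vol_pos[OF s, of z] by (simp add: W_def)
      moreover have "W z * (2 * K * s\<^sup>2 * (\<Sum>v\<in>gball \<mu> (2 * s) z. energy f v) + 2 * vol z s * (avg f s z)\<^sup>2)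
        = 2 * K * s\<^sup>2 * (W z * (\<Sum>v\<in>gball \<mu> (2 * s) z. energy f v)) + 2 * ((W z * vol z s) * (avg f s z)\<^sup>2)"
        by (simp add: algebra_simps)
      ultimately show ?thesis by (simp only: sum_distrib_left)
    qed
    then show ?thesis by (simp only: sum.distrib sum_distrib_left)
  qed
  also have "(\<Sum>z\<in>Z. \<Sum>v\<in>gball \<mu> (2 * s) z. W z * energy f v) = (\<Sum>z\<in>Z. \<Sum>v\<in>A \<inter> gball \<mu> (2 * s) z. W z * energy f v)"
    using enA by (intro sum.cong refl sum.mono_neutral_right) auto
  also have "\<dots> = (\<Sum>v\<in>A. \<Sum>z\<in>Z \<inter> gball \<mu> (2 * s) v. W z * energy f v)"
    by (rule sum_swap_gball) (use A Z in auto)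
  also have "\<dots> = (\<Sum>v\<in>A. (\<Sum>z\<in>Z \<inter> gball \<mu> (2 * s) v. W z) * energy f v)"
    by (simp only: sum_distrib_right)
  finally have main: "ip f f \<le> D * (2 * K * s\<^sup>2 * (\<Sum>v\<in>A. (\<Sum>z\<in>Z \<inter> gball \<mu> (2 * s) v. W z) * energy f v)
      + 2 * (\<Sum>z\<in>Z. m z * (avg f s z)\<^sup>2))"
    using D_ge_1 by (simp add: mult_left_mono)
  \<comment> \<open>Every energy term is counted by the centres within \<open>2 * s\<close>, of
    total weight at most \<open>D * D\<close>. With the outer \<open>D\<close>, the 2 from splitting
    the square and the 2 from \<open>sum_energy\<close> this makes \<open>4 * D ^ 3\<close>.\<close>
  have "(\<Sum>v\<in>A. (\<Sum>z\<in>Z \<inter> gball \<mu> (2 * s) v. W z) * energy f v) \<le> (\<Sum>v\<in>A. (D * D) * energy f v)"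
    unfolding W_def using s Z by (intro sum_mono mult_right_mono weight_sum_upper2 energy_nonneg) auto
  also have "\<dots> = (D * D) * (2 * (ip f f - ip (P f) f))"
    unfolding sum_distrib_left[symmetric] using f A by (subst sum_energy) (auto simp: A_def)
  finally have "2 * K * s\<^sup>2 * (\<Sum>v\<in>A. (\<Sum>z\<in>Z \<inter> gball \<mu> (2 * s) v. W z) * energy f v)
      \<le> 2 * K * s\<^sup>2 * ((D * D) * (2 * (ip f f - ip (P f) f)))" using K by (intro mult_left_mono) auto
  then have "D * (2 * K * s\<^sup>2 * (\<Sum>v\<in>A. (\<Sum>z\<in>Z \<inter> gball \<mu> (2 * s) v. W z) * energy f v) + 2 * (\<Sum>z\<in>Z. m z * (avg f s z)\<^sup>2))
    \<le> D * (2 * K * s\<^sup>2 * ((D * D) * (2 * (ip f f - ip (P f) f))) + 2 * (\<Sum>z\<in>Z. m z * (avg f s z)\<^sup>2))"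
    using D_ge_1 by (intro mult_left_mono) auto
  also have "\<dots> = 4 * D ^ 3 * K * s\<^sup>2 * (ip f f - ip (P f) f) + 2 * D * (\<Sum>z\<in>Z. m z * (avg f s z)\<^sup>2)"
    by (simp add: power3_eq_cube algebra_simps)
  finally show ?thesis using main by linarith
qed

text \<open>One factor of the square is estimated pointwise: unit mass gives
  \<open>1 / vol z s\<close>, and volume growth compares this with \<open>1 / vol x R\<close> at the
  cost of a power of 1 + d(x, z) / R. The other factor is summed with the weights of
  \<open>weight_sum_upper\<close> and gives back the mass of \<open>f\<close>, so the bound is
  linear in \<open>f\<close> and localised at \<open>x\<close>.\<close>

lemma avg_norm_le_moment:
  assumes f: "fs f" "\<And>u. 0 \<le> f u" and mass: "(\<Sum>u | f u \<noteq> 0. f u * m u) \<le> 1"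
    and s: "0 < s" "s \<le> R" and Z: "finite Z"
  shows "(\<Sum>z\<in>Z. m z * (avg f s z)\<^sup>2) \<le>
     (4 * R / s) ^ \<nu> * D * (\<Sum>y | f y \<noteq> 0. f y * m y * (1 + real (gdist \<mu> x y) / R) ^ \<nu>) / vol x R"
proof -
  let ?Y = "{y. f y \<noteq> 0}"
  let ?w = "\<lambda>z. (1 + real (gdist \<mu> x z) / R) ^ \<nu>"
  have Y: "finite ?Y" using f by (simp add: fs_def)
  have R: "0 < R" using s by simp
  have vx: "0 < vol x R" using vol_pos[OF R] .
  have av: "avg f s z = (\<Sum>y\<in>?Y \<inter> gball \<mu> s z. f y * m y / vol z s)" for z
  proof -
    have "(\<Sum>v\<in>gball \<mu> s z. f v * m v) = (\<Sum>y\<in>?Y \<inter> gball \<mu> s z. f y * m y)"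
      by (intro sum.mono_neutral_right) auto
    then show ?thesis unfolding avg_def by (simp add: sum_divide_distrib)
  qed
  have av0: "0 \<le> avg f s z" for z unfolding av using f m_pos vol_pos[OF s(1)]
    by (intro sum_nonneg divide_nonneg_nonneg mult_nonneg_nonneg) (auto simp: less_imp_le)
  have av1: "avg f s z \<le> (2 * R / s) ^ \<nu> * ?w z / vol x R" for z
  proof -
    have "(\<Sum>y\<in>?Y \<inter> gball \<mu> s z. f y * m y) \<le> (\<Sum>y\<in>?Y. f y * m y)"
      using f m_pos Y by (intro sum_mono2) (auto simp: less_imp_le)
    then have "avg f s z \<le> 1 / vol z s"
      unfolding av sum_divide_distrib[symmetric] using mass vol_pos[OF s(1), of z] by (intro divide_right_mono) auto
    also have "\<dots> \<le> (2 * R / s) ^ \<nu> * ?w z / vol x R"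
    proof -
      let ?d = "real (gdist \<mu> x z)"
      have "vol x R \<le> vol z ((R + ?d) / s * s)" using s by (intro vol_shift) auto
      also have "\<dots> \<le> (2 * ((R + ?d) / s)) ^ \<nu> * vol z s"
        using s by (intro vol_growth) (auto simp: field_simps)
      also have "2 * ((R + ?d) / s) = (2 * R / s) * (1 + ?d / R)" using R s by (simp add: field_simps)
      finally have "vol x R \<le> ((2 * R / s) ^ \<nu> * ?w z) * vol z s" by (simp only: power_mult_distrib)
      moreover have "1 / q \<le> t / p" if "p \<le> t * q" "0 < p" "0 < q" for p q t :: real
        using that by (simp add: field_simps)
      ultimately show ?thesis using vx vol_pos[OF s(1), of z] by blast
    qed
    finally show ?thesis .
  qed
  have "(\<Sum>z\<in>Z. m z * ?w z * avg f s z) = (\<Sum>z\<in>Z. \<Sum>y\<in>?Y \<inter> gball \<mu> s z. f y * m y * (?w z * (m z / vol z s)))"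
    unfolding av sum_distrib_left by (intro sum.cong refl) simp
  also have "\<dots> = (\<Sum>y\<in>?Y. \<Sum>z\<in>Z \<inter> gball \<mu> s y. f y * m y * (?w z * (m z / vol z s)))"
    by (rule sum_swap_gball) (use Y Z in auto)
  also have "\<dots> \<le> (\<Sum>y\<in>?Y. \<Sum>z\<in>Z \<inter> gball \<mu> s y. f y * m y * (2 ^ \<nu> * ?w y * (m z / vol z s)))"
  proof (intro sum_mono mult_left_mono mult_right_mono)
    fix y z assume z: "z \<in> Z \<inter> gball \<mu> s y"
    have "real (gdist \<mu> x z) \<le> real (gdist \<mu> x y) + R"
      using z gdist_triangle[of x z y] s by (simp add: mem_gball)
    then have "real (gdist \<mu> x z) / R \<le> (real (gdist \<mu> x y) + R) / R" using R by (intro divide_right_mono) auto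
    also have "\<dots> = real (gdist \<mu> x y) / R + 1" using R by (simp add: field_simps)
    finally have "real (gdist \<mu> x z) / R \<le> real (gdist \<mu> x y) / R + 1" .
    moreover have "0 \<le> real (gdist \<mu> x y) / R" using R by simp
    moreover have "1 + p \<le> 2 * (1 + q)" if "p \<le> q + 1" "0 \<le> q" for p q :: real
      using that by simp
    ultimately have "1 + real (gdist \<mu> x z) / R \<le> 2 * (1 + real (gdist \<mu> x y) / R)" by blast
    then have "?w z \<le> (2 * (1 + real (gdist \<mu> x y) / R)) ^ \<nu>" using R by (intro power_mono) auto
    then show "?w z \<le> 2 ^ \<nu> * ?w y" by (simp only: power_mult_distrib)
  qed (use m_pos f vol_pos[OF s(1)] in \<open>auto simp: less_imp_le\<close>)
  also have "\<dots> = (\<Sum>y\<in>?Y. f y * m y * (2 ^ \<nu> * ?w y) * (\<Sum>z\<in>Z \<inter> gball \<mu> s y. m z / vol z s))"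
    by (simp only: sum_distrib_left mult.assoc)
  also have "\<dots> \<le> (\<Sum>y\<in>?Y. f y * m y * (2 ^ \<nu> * ?w y) * D)"
    using m_pos f R Z s by (intro sum_mono mult_left_mono weight_sum_upper) (auto simp: less_imp_le)
  also have "\<dots> = 2 ^ \<nu> * D * (\<Sum>y\<in>?Y. f y * m y * ?w y)"
    unfolding sum_distrib_left by (intro sum.cong refl) simp
  finally have inner: "(\<Sum>z\<in>Z. m z * ?w z * avg f s z) \<le> 2 ^ \<nu> * D * (\<Sum>y\<in>?Y. f y * m y * ?w y)" .
  have "(\<Sum>z\<in>Z. m z * (avg f s z)\<^sup>2) \<le> (\<Sum>z\<in>Z. (2 * R / s) ^ \<nu> / vol x R * (m z * ?w z * avg f s z))"
  proof (intro sum_mono)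
    fix z
    have "m z * avg f s z * avg f s z \<le> m z * avg f s z * ((2 * R / s) ^ \<nu> * ?w z / vol x R)"
      using m_pos[of z] av0 av1 by (intro mult_left_mono) auto
    then show "m z * (avg f s z)\<^sup>2 \<le> (2 * R / s) ^ \<nu> / vol x R * (m z * ?w z * avg f s z)"
      by (simp add: power2_eq_square mult_ac)
  qed
  also have "\<dots> = (2 * R / s) ^ \<nu> / vol x R * (\<Sum>z\<in>Z. m z * ?w z * avg f s z)" by (simp only: sum_distrib_left)
  also have "\<dots> \<le> (2 * R / s) ^ \<nu> / vol x R * (2 ^ \<nu> * D * (\<Sum>y\<in>?Y. f y * m y * ?w y))"
    using inner R s vx by (intro mult_left_mono) auto
  also have "\<dots> = (2 * R / s * 2) ^ \<nu> * D * (\<Sum>y\<in>?Y. f y * m y * ?w y) / vol x R"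
    unfolding power_mult_distrib by simp
  finally show ?thesis by simp
qed

end


section \<open>Heat kernel bounds\<close>

lemma coeff_pcompose_eq_0:
  fixes Q :: "real poly"
  assumes "\<And>i. r \<le> real i \<Longrightarrow> coeff Q i = 0" "r \<le> real i"
  shows "coeff (pcompose Q [:1, - 1:]) i = 0"
proof (cases "Q = 0")
  case False
  then have "\<not> r \<le> real (degree Q)" using assms(1)[of "degree Q"] by auto
  moreover have "degree (pcompose Q [:1, - 1:]) \<le> degree Q"
    using degree_pcompose_le[of Q "[:1, - 1:]"] by simp
  ultimately show ?thesis using assms(2) by (intro coeff_eq_0) linarith
qed simp

locale heat_graph = doubling_graph \<mu> D K + spectral_graph \<mu> a
  for \<mu> :: "'a::countable \<Rightarrow> 'a \<Rightarrow> real" and D K a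
begin

text \<open>Going from time n to n / 4 halves the radius and may cost a factor \<open>D\<close> in
  volume; the weight \<open>1 / 4 ^ J\<close> per step in \<open>damp_poly\<close> makes up for it
  and leaves a ratio of at most 1 / 2.\<close>

definition J :: nat where "J = (SOME n. 2 * D \<le> 4 ^ n)"

lemma D_le_J: "2 * D \<le> 4 ^ J"
proof -
  obtain n where "2 * D < 4 ^ n" using real_arch_pow[of 4 "2 * D"] by auto
  then show ?thesis unfolding J_def by (intro someI[of "\<lambda>n. 2 * D \<le> 4 ^ n" n]) auto
qed

text \<open>A polynomial substitute for \<open>(1 + n * (1 - x)) powr - J\<close>: it has nonnegative coefficients and
  only even powers, so its quadratic form at \<open>dens x\<close> is a sum of squared norms of \<open>heat j x\<close>.\<close>

definition damp_poly :: "nat \<Rightarrow> real poly" where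
  "damp_poly n = smult (4 * 8 ^ J) (\<Sum>i\<le>n. smult (1 / 4 ^ (J * i)) (monom 1 (2 * (n div 4 ^ i))))"

text \<open>Let \<open>i\<close> be the first scale with
  \<open>(n div 4 ^ i) * (1 - x) <= 1 / 2\<close>; its summand alone suffices. Bernoulli's
  inequality bounds its power of \<open>x\<close> below by 1 / 4, and minimality gives
  \<open>4 ^ i / 8 <= 1 + n * (1 - x)\<close>, the origin of \<open>8 ^ J\<close>. For negative
  \<open>x\<close> the quotient is 0 and the power is 1.\<close>

lemma damp_poly_ge:
  assumes x: "x \<in> {a..1}"
  shows "1 / (1 + real n * (1 - x)) ^ J \<le> poly (damp_poly n) x"
proof -
  define y where "y = 1 - x"
  have y: "0 \<le> y" using x by (simp add: y_def)
  define i where "i = (LEAST i. real (n div 4 ^ i) * y \<le> 1 / 2)"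
  have "n < 4 ^ n" by (induction n) auto
  then have "real (n div 4 ^ n) * y \<le> 1 / 2" by simp
  then have i: "real (n div 4 ^ i) * y \<le> 1 / 2" "i \<le> n"
    unfolding i_def by (rule LeastI, rule Least_le)
  have p: "1 / 4 \<le> x ^ (2 * (n div 4 ^ i))"
  proof (cases "n div 4 ^ i = 0")
    case False
    then have "1 * y \<le> real (n div 4 ^ i) * y" using y by (intro mult_right_mono) auto
    then have "y \<le> 1" using i by simp
    then have "1 + real (n div 4 ^ i) * (- y) \<le> (1 + (- y)) ^ (n div 4 ^ i)"
      by (intro Bernoulli_inequality) auto
    moreover have "1 / 2 \<le> 1 + real (n div 4 ^ i) * (- y)" using i by simp
    moreover have "1 + (- y) = x" by (simp add: y_def)
    ultimately have "1 / 2 \<le> x ^ (n div 4 ^ i)" by (metis order_trans)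
    then have "(1 / 2)\<^sup>2 \<le> (x ^ (n div 4 ^ i))\<^sup>2" by (intro power_mono) auto
    then show ?thesis by (simp add: power2_eq_square power_mult[symmetric] mult.commute power_even_eq)
  qed simp
  have "1 / (1 + real n * y) ^ J \<le> 8 ^ J / 4 ^ (J * i)"
  proof -
    have "4 ^ i / 8 \<le> 1 + real n * y"
    proof (cases i)
      case 0
      then show ?thesis using y by (simp add: add_increasing2)
    next
      case (Suc j)
      then have "1 / 2 < real (n div 4 ^ j) * y"
        using not_less_Least[of j "\<lambda>i. real (n div 4 ^ i) * y \<le> 1 / 2"] unfolding i_def[symmetric] by simp
      moreover have "4 ^ j * real (n div 4 ^ j) \<le> real n"
      proof -
        have "4 ^ j * (n div 4 ^ j) \<le> n" by (metis times_div_less_eq_dividend)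
        then have "real (4 ^ j * (n div 4 ^ j)) \<le> real n" by (simp only: of_nat_le_iff)
        then show ?thesis by simp
      qed
      then have "4 ^ j * (real (n div 4 ^ j) * y) \<le> real n * y"
        using y mult_right_mono[of "4 ^ j * real (n div 4 ^ j)" "real n" y] by (simp add: mult.assoc)
      moreover have "4 ^ j * (1 / 2) \<le> 4 ^ j * (real (n div 4 ^ j) * y)"
        using \<open>1 / 2 < real (n div 4 ^ j) * y\<close> by (intro mult_left_mono) auto
      moreover have "4 ^ i / 8 = (4 ^ j * (1 / 2) :: real)" using Suc by simp
      ultimately show ?thesis by linarith
    qed
    then have "(4 ^ i / 8) ^ J \<le> (1 + real n * y) ^ J" by (intro power_mono) auto
    then have "1 / (1 + real n * y) ^ J \<le> 1 / (4 ^ i / 8) ^ J" by (intro frac_le) auto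
    also have "\<dots> = 8 ^ J / 4 ^ (J * i)" by (simp add: power_divide power_mult[symmetric] mult.commute)
    finally show ?thesis .
  qed
  also have "\<dots> \<le> 4 * 8 ^ J * (1 / 4 ^ (J * i) * x ^ (2 * (n div 4 ^ i)))"
  proof -
    have "(8 ^ J / 4 ^ (J * i)) * 1 \<le> (8 ^ J / 4 ^ (J * i)) * (4 * x ^ (2 * (n div 4 ^ i)))"
      using p by (intro mult_left_mono) auto
    then show ?thesis by (simp add: mult_ac)
  qed
  also have "\<dots> \<le> 4 * 8 ^ J * (\<Sum>i\<le>n. 1 / 4 ^ (J * i) * x ^ (2 * (n div 4 ^ i)))"
    using i(2) by (intro mult_left_mono member_le_sum[of i "{..n}" "\<lambda>i. 1 / 4 ^ (J * i) * x ^ (2 * (n div 4 ^ i))"]) 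
      (auto simp: power_mult)
  also have "\<dots> = poly (damp_poly n) x"
    unfolding damp_poly_def by (simp add: poly_sum poly_monom)
  finally show ?thesis unfolding y_def .
qed

lemma ip_heat: "ip (pop (monom 1 (2 * j)) (dens x)) (dens x) = ip (heat j x) (heat j x)"
proof -
  have "monom 1 (2 * j) = monom 1 j * (monom 1 j :: real poly)" by (simp add: mult_monom mult_2)
  then show ?thesis by (simp add: pop_mult ip_pop_commute fs_pop)
qed

lemma ip_pop_sum:
  assumes "finite I" "fs f"
  shows "ip (pop (\<Sum>i\<in>I. p i) f) g = (\<Sum>i\<in>I. ip (pop (p i) f) g)"
  using assms
proof (induction I rule: finite_induct)
  case empty
  then show ?case by (simp add: ip_def)
next
  case (insert i I)
  then show ?case by (simp add: pop_add ip_add_left fs_pop)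
qed

lemma ip_pop_smult: "fs f \<Longrightarrow> ip (pop (smult c p) f) g = c * ip (pop p f) g"
  by (simp add: pop_smult ip_scale_left fs_pop)

text \<open>The return density at time \<open>2 * n\<close>, measured against the volume at its
  natural radius; a uniform bound for it is the on-diagonal estimate. The \<open>max\<close> gives
  radius 1 at time 0, where the ball is a point and the value is 1.\<close>

definition \<phi> :: "'a \<Rightarrow> nat \<Rightarrow> real" where
  "\<phi> x n = vol x (sqrt (real (max n 1))) * ip (heat n x) (heat n x)"

abbreviation below :: "real \<Rightarrow> 'a \<Rightarrow> nat \<Rightarrow> bool" where
  "below S x n \<equiv> \<forall>j\<le>n. \<phi> x j \<le> S"

lemma \<phi>_nonneg: "0 \<le> \<phi> x n"
proof -
  have "0 < vol x (sqrt (real (max n 1)))" by (rule vol_pos) simp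
  then show ?thesis unfolding \<phi>_def by (intro mult_nonneg_nonneg ip_nonneg) linarith
qed

lemma damp_form_le:
  assumes n: "1 \<le> n" and S: "below S x n"
  shows "vol x (sqrt (real n)) * ip (pop (damp_poly n) (dens x)) (dens x) \<le> 8 ^ (J + 1) * D * S"
proof -
  have S0: "0 \<le> S" using S \<phi>_nonneg[of x 0] by (meson le0 order_trans)
  have vx: "0 < vol x (sqrt (real n))" using n by (intro vol_pos) auto
  have trm: "vol x (sqrt (real n)) * (1 / 4 ^ (J * i) * ip (heat (n div 4 ^ i) x) (heat (n div 4 ^ i) x)) \<le> (1 / 2) ^ i * (D * S)" for i
  proof -
    let ?n = "n div 4 ^ i"
    let ?r = "sqrt (real (max ?n 1))"
    have r: "0 < ?r" by simp
    \<comment> \<open>Rounding down costs one more factor 4 in time, that is one more doubling of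
      the radius; hence \<open>D ^ Suc i\<close>. The \<open>max\<close> covers the scales at which
      the quotient is 0.\<close>
    have "n \<le> 4 ^ Suc i * max ?n 1"
    proof -
      have "n = 4 ^ i * ?n + n mod 4 ^ i" by simp
      moreover have "n mod 4 ^ i < 4 ^ i" by simp
      moreover have "(4::nat) ^ i \<le> 4 ^ i * max ?n 1" "4 ^ i * ?n \<le> 4 ^ i * max ?n 1" by (auto intro: mult_le_mono)
      ultimately have "n \<le> 4 ^ i * max ?n 1 + 4 ^ i * max ?n 1" by linarith
      then show ?thesis by simp
    qed
    then have "real n \<le> real (4 ^ Suc i * max ?n 1)" by (simp only: of_nat_le_iff)
    then have "sqrt (real n) \<le> sqrt (real (4 ^ Suc i * max ?n 1))" by (rule real_sqrt_le_mono)
    also have "real (4 ^ Suc i * max ?n 1) = (2 ^ Suc i)\<^sup>2 * real (max ?n 1)"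
    proof -
      have "(2 ^ j)\<^sup>2 = (4::real) ^ j" for j by (induction j) (auto simp: power2_eq_square)
      then show ?thesis by simp
    qed
    also have "sqrt ((2 ^ Suc i)\<^sup>2 * real (max ?n 1)) = 2 ^ Suc i * ?r" unfolding real_sqrt_mult
      by (subst real_sqrt_unique[of "2 ^ Suc i"]) auto
    finally have "vol x (sqrt (real n)) \<le> vol x (2 ^ Suc i * ?r)" by (rule vol_mono)
    also have "\<dots> \<le> D ^ Suc i * vol x ?r" by (rule vol_power[OF r])
    finally have "vol x (sqrt (real n)) * ip (heat ?n x) (heat ?n x) \<le> (D ^ Suc i * vol x ?r) * ip (heat ?n x) (heat ?n x)"
      by (intro mult_right_mono ip_nonneg)
    also have "\<dots> = D ^ Suc i * \<phi> x ?n" by (simp add: \<phi>_def)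
    also have "\<dots> \<le> D ^ Suc i * S" using D_ge_1 S by (intro mult_left_mono) auto
    finally have "1 / 4 ^ (J * i) * (vol x (sqrt (real n)) * ip (heat ?n x) (heat ?n x)) \<le> 1 / 4 ^ (J * i) * (D ^ Suc i * S)"
      by (intro mult_left_mono) auto
    also have "\<dots> = (D / 4 ^ J) ^ i * (D * S)" by (simp add: power_divide power_mult)
    also have "\<dots> \<le> (1 / 2) ^ i * (D * S)"
      using D_le_J D_ge_1 S0 by (intro mult_right_mono power_mono) (auto simp: field_simps)
    finally show ?thesis by (simp add: mult_ac)
  qed
  have "vol x (sqrt (real n)) * ip (pop (damp_poly n) (dens x)) (dens x)
    = 4 * 8 ^ J * (\<Sum>i\<le>n. vol x (sqrt (real n)) * (1 / 4 ^ (J * i) * ip (heat (n div 4 ^ i) x) (heat (n div 4 ^ i) x)))"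
    unfolding damp_poly_def by (simp only: ip_pop_smult ip_pop_sum fs_dens finite_atMost ip_heat) (simp add: sum_distrib_left mult_ac)
  also have "\<dots> \<le> 4 * 8 ^ J * (\<Sum>i\<le>n. (1 / 2) ^ i * (D * S))"
    by (intro mult_left_mono sum_mono trm) auto
  also have "\<dots> = 4 * 8 ^ J * ((\<Sum>i\<le>n. (1 / 2) ^ i) * (D * S))" by (simp only: sum_distrib_right)
  also have "\<dots> \<le> 4 * 8 ^ J * (2 * (D * S))"
  proof (intro mult_left_mono mult_right_mono)
    have "(\<Sum>i\<le>n. (1 / 2 :: real) ^ i) = 2 - (1 / 2) ^ n" by (induction n) (auto simp: field_simps)
    then show "(\<Sum>i\<le>n. (1 / 2 :: real) ^ i) \<le> 2" by simp
  qed (use S0 D_ge_1 in auto)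
  also have "\<dots> = 8 ^ (J + 1) * D * S" by simp
  finally show ?thesis .
qed

lemma poly_form_le_damp:
  assumes n: "1 \<le> n" and S: "below S x n" and A: "0 \<le> A"
    and p: "\<And>y. y \<in> {a..1} \<Longrightarrow> poly p y \<le> A * (1 / (1 + real n * (1 - y)) ^ J)"
  shows "vol x (sqrt (real n)) * ip (pop p (dens x)) (dens x) \<le> A * (8 ^ (J + 1) * D * S)"
proof -
  have vx: "0 < vol x (sqrt (real n))" using n by (intro vol_pos) auto
  have "ip (pop p (dens x)) (dens x) \<le> ip (pop (smult A (damp_poly n)) (dens x)) (dens x)"
  proof (rule poly_form_mono)
    fix y assume y: "y \<in> {a..1}"
    show "poly p y \<le> poly (smult A (damp_poly n)) y"
      using p[OF y] mult_left_mono[OF damp_poly_ge[OF y, of n] A] by simp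
  qed simp
  also have "\<dots> = A * ip (pop (damp_poly n) (dens x)) (dens x)" by (simp add: ip_pop_smult)
  finally have "vol x (sqrt (real n)) * ip (pop p (dens x)) (dens x)
     \<le> vol x (sqrt (real n)) * (A * ip (pop (damp_poly n) (dens x)) (dens x))"
    using vx by (intro mult_left_mono) auto
  also have "\<dots> = A * (vol x (sqrt (real n)) * ip (pop (damp_poly n) (dens x)) (dens x))" by simp
  also have "\<dots> \<le> A * (8 ^ (J + 1) * D * S)" using damp_form_le[OF n S] A by (intro mult_left_mono) auto
  finally show ?thesis .
qed

text \<open>Remove from \<open>x ^ n\<close> a polynomial in \<open>1 - x\<close> of degree below
  \<open>r\<close>: by finite propagation the heat kernel is unchanged at distance \<open>r\<close>
  or more, and the square norm of what remains is the form of its square. The approximation with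
  \<open>k = 1\<close> is available on the whole spectrum because \<open>a > -1\<close> means
  \<open>1 - a < 2\<close>.\<close>

lemma heat_tail:
  obtains B c where "0 < B" "0 < c"
    "\<And>x n S r. 1 \<le> n \<Longrightarrow> below S x n \<Longrightarrow> 0 \<le> r \<Longrightarrow>
      vol x (sqrt (real n)) * (\<Sum>y | heat n x y \<noteq> 0 \<and> r \<le> real (gdist \<mu> x y). (heat n x y)\<^sup>2 * m y)
      \<le> B * exp (- c * (r\<^sup>2 / real n)) * S"
proof -
  have L: "0 < 1 - a" "(1 - a) ^ 1 < 2" using a by auto
  obtain B c where B: "0 < B" and c: "0 < c" and
    ap: "\<And>n r. 1 \<le> n \<Longrightarrow> 0 \<le> r \<Longrightarrow>
       poly_approx (1 - a) r (\<lambda>x. x ^ 0 * (1 - x ^ 1) ^ n) (\<lambda>x. B * exp (- c * decay_rate 1 n r) * damping 1 0 J n x)"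
    using damped_power_approx[OF order_refl L, of 0 J] by metis
  define B' where "B' = B\<^sup>2 * (8 ^ (J + 1) * D)"
  have B': "0 < B'" using B D_ge_1 by (simp add: B'_def)
  have "vol x (sqrt (real n)) * (\<Sum>y | heat n x y \<noteq> 0 \<and> r \<le> real (gdist \<mu> x y). (heat n x y)\<^sup>2 * m y)
      \<le> B' * exp (- (2 * c) * (r\<^sup>2 / real n)) * S"
    if n: "1 \<le> n" and S: "below S x n" and r: "0 \<le> r" for x n S r
  proof -
    obtain Q where Q: "\<And>i. r \<le> real i \<Longrightarrow> coeff Q i = 0"
      "\<And>x. x \<in> {0..1 - a} \<Longrightarrow> \<bar>(1 - x) ^ n - poly Q x\<bar> \<le> B * exp (- c * decay_rate 1 n r) * damping 1 0 J n x"
      using ap[OF n r] unfolding power_0 mult_1 power_one_right by blast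
    define q where "q = monom 1 n - pcompose Q [:1, - 1:]"
    define f where "f = pop q (dens x)"
    have f: "fs f" by (simp add: f_def fs_pop)
    have eq: "heat n x y = f y" if "r \<le> real (gdist \<mu> x y)" for y
    proof -
      have "pop (pcompose Q [:1, - 1:]) (dens x) y = 0"
        using that gdist_sym[of x y] by (intro pop_dens_eq_0[of r] coeff_pcompose_eq_0[of r] Q(1)) auto
      moreover have "monom 1 n = q + pcompose Q [:1, - 1:]" by (simp add: q_def)
      then have "heat n x y = pop q (dens x) y + pop (pcompose Q [:1, - 1:]) (dens x) y" by (simp only: pop_add)
      ultimately show ?thesis by (simp add: f_def)
    qed
    have om: "decay_rate 1 n r = r\<^sup>2 / real n" unfolding decay_rate_def using r by simp
    have "(\<Sum>y | heat n x y \<noteq> 0 \<and> r \<le> real (gdist \<mu> x y). (heat n x y)\<^sup>2 * m y) = (\<Sum>y | f y \<noteq> 0 \<and> r \<le> real (gdist \<mu> x y). (f y)\<^sup>2 * m y)"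
      using eq by (intro sum.cong) auto
    also have "\<dots> \<le> (\<Sum>y | f y \<noteq> 0. (f y)\<^sup>2 * m y)"
      using f m_pos by (intro sum_mono2) (auto simp: fs_def less_imp_le)
    also have "\<dots> = ip f f" unfolding ip_def by (simp add: power2_eq_square)
    also have "\<dots> = ip (pop (q * q) (dens x)) (dens x)"
      unfolding f_def pop_mult by (intro ip_pop_commute[symmetric] fs_pop fs_dens)
    finally have "vol x (sqrt (real n)) * (\<Sum>y | heat n x y \<noteq> 0 \<and> r \<le> real (gdist \<mu> x y). (heat n x y)\<^sup>2 * m y)
      \<le> vol x (sqrt (real n)) * ip (pop (q * q) (dens x)) (dens x)"
      using vol_pos[of "sqrt (real n)" x] n by (intro mult_left_mono) auto
    also have "\<dots> \<le> (B * exp (- c * (r\<^sup>2 / real n)))\<^sup>2 * (8 ^ (J + 1) * D * S)"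
    proof (rule poly_form_le_damp[OF n S])
      fix y assume y: "y \<in> {a..1}"
      define t where "t = 1 / (1 + real n * (1 - y)) ^ J"
      have "1 \<le> (1 + real n * (1 - y)) ^ J" using y by (intro one_le_power) auto
      then have t: "0 \<le> t" "t \<le> 1" by (auto simp: t_def)
      have "damping 1 0 J n (1 - y) = t" using n by (simp add: damping_def t_def)
      then have "\<bar>poly q y\<bar> \<le> B * exp (- c * (r\<^sup>2 / real n)) * t"
        using Q(2)[of "1 - y"] y unfolding om by (simp add: q_def poly_monom poly_pcompose)
      then have "\<bar>poly q y\<bar>\<^sup>2 \<le> (B * exp (- c * (r\<^sup>2 / real n)) * t)\<^sup>2" by (intro power_mono) auto
      also have "\<dots> = (B * exp (- c * (r\<^sup>2 / real n)))\<^sup>2 * (t * t)" by (simp add: power2_eq_square mult_ac)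
      \<comment> \<open>Squaring has doubled the damping; one copy is dropped, and the other is what
        \<open>poly_form_le_damp\<close> accepts.\<close>
      also have "\<dots> \<le> (B * exp (- c * (r\<^sup>2 / real n)))\<^sup>2 * t"
        using t by (intro mult_left_mono) (auto intro: mult_left_le)
      finally show "poly (q * q) y \<le> (B * exp (- c * (r\<^sup>2 / real n)))\<^sup>2 * (1 / (1 + real n * (1 - y)) ^ J)"
        by (simp add: power2_eq_square t_def)
    qed auto
    also have "\<dots> = B' * exp (- (2 * c) * (r\<^sup>2 / real n)) * S"
    proof -
      have "exp (- (2 * c) * (r\<^sup>2 / real n)) = (exp (- c * (r\<^sup>2 / real n)))\<^sup>2"
        by (simp add: power2_eq_square exp_add[symmetric])
      then show ?thesis unfolding B'_def by (simp add: power_mult_distrib)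
    qed
    finally show ?thesis .
  qed
  moreover have "0 < 2 * c" using c by simp
  ultimately show ?thesis using that B' by blast
qed


text \<open>Annuli of width \<open>sqrt n\<close> about \<open>x\<close>: Cauchy-Schwarz bounds the
  mass in the \<open>j\<close>-th by the root of its volume times its share of the square norm. The
  volume is at most a power of \<open>1 + j\<close> times \<open>vol x (sqrt n)\<close>, which is
  the volume in \<open>heat_tail\<close>; what remains is \<open>sqrt S\<close> times a summable
  series.\<close>

lemma heat_moment:
  obtains C where "0 < C"
    "\<And>x n S. 1 \<le> n \<Longrightarrow> below S x n \<Longrightarrow>
      (\<Sum>y | heat n x y \<noteq> 0. heat n x y * m y * (1 + real (gdist \<mu> x y) / sqrt (real n)) ^ \<nu>) \<le> C * sqrt S"
proof -
  obtain B c where B: "0 < B" and c: "0 < c" and tail: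
    "\<And>x n S r. 1 \<le> n \<Longrightarrow> below S x n \<Longrightarrow> 0 \<le> r \<Longrightarrow>
      vol x (sqrt (real n)) * (\<Sum>y | heat n x y \<noteq> 0 \<and> r \<le> real (gdist \<mu> x y). (heat n x y)\<^sup>2 * m y)
      \<le> B * exp (- c * (r\<^sup>2 / real n)) * S"
    by (rule heat_tail) blast
  obtain A where A: "0 < A" "\<And>s. 0 \<le> s \<Longrightarrow> (1 + s) ^ (2 * \<nu>) * exp (- (c / 4) * s) \<le> A"
    using poly_times_exp_bounded[of "c / 4" "2 * \<nu>"] c by auto
  \<comment> \<open>Half of the decay \<open>exp (- (c / 2) * j)\<close> cancels the polynomial in
    \<open>j\<close>; the other half, \<open>q ^ j\<close>, is summed as a geometric series.\<close>
  define q where "q = exp (- (c / 4))"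
  have q: "0 < q" "q < 1" using c by (auto simp: q_def)
  define C where "C = sqrt B * 4 ^ \<nu> * A / (1 - q)"
  have C: "0 < C" using B A q by (simp add: C_def)
  have "(\<Sum>y | heat n x y \<noteq> 0. heat n x y * m y * (1 + real (gdist \<mu> x y) / sqrt (real n)) ^ \<nu>) \<le> C * sqrt S"
    if n: "1 \<le> n" and S: "below S x n" for x n S
  proof -
    define R where "R = sqrt (real n)"
    have R: "0 < R" "R\<^sup>2 = real n" using n by (auto simp: R_def)
    have S0: "0 \<le> S" using S \<phi>_nonneg[of x 0] by (meson le0 order_trans)
    define f where "f = heat n x"
    let ?Y = "{y. f y \<noteq> 0}"
    have Y: "finite ?Y" using fs_pop[OF fs_dens] by (simp add: f_def fs_def)
    have f0: "0 \<le> f y" for y unfolding f_def by (rule heat_nonneg)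
    define ann where "ann y = nat \<lfloor>real (gdist \<mu> x y) / R\<rfloor>" for y
    have ann: "real (ann y) * R \<le> real (gdist \<mu> x y)" "real (gdist \<mu> x y) < (real (ann y) + 1) * R" for y
    proof -
      have "0 \<le> real (gdist \<mu> x y) / R" using R by simp
      then have e: "real (ann y) = of_int \<lfloor>real (gdist \<mu> x y) / R\<rfloor>" unfolding ann_def by simp
      have "real (ann y) \<le> real (gdist \<mu> x y) / R" "real (gdist \<mu> x y) / R < real (ann y) + 1"
        unfolding e by linarith+
      then show "real (ann y) * R \<le> real (gdist \<mu> x y)" "real (gdist \<mu> x y) < (real (ann y) + 1) * R"
        using R by (auto simp: field_simps)
    qed
    have layer: "(\<Sum>y | y \<in> ?Y \<and> ann y = j. f y * m y) \<le> sqrt B * sqrt S * (2 * (1 + real j)) ^ \<nu> * exp (- (c / 2) * real j)" for j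
    proof -
      let ?Yj = "{y. y \<in> ?Y \<and> ann y = j}"
      have "(\<Sum>y\<in>?Yj. f y * m y)\<^sup>2 = (\<Sum>y\<in>?Yj. (f y * sqrt (m y)) * sqrt (m y))\<^sup>2"
        using m_pos by (simp add: mult.assoc less_imp_le)
      also have "\<dots> \<le> (\<Sum>y\<in>?Yj. (f y * sqrt (m y))\<^sup>2) * (\<Sum>y\<in>?Yj. (sqrt (m y))\<^sup>2)"
        by (rule Cauchy_Schwarz_ineq_sum)
      also have "\<dots> = (\<Sum>y\<in>?Yj. (f y)\<^sup>2 * m y) * (\<Sum>y\<in>?Yj. m y)"
        using m_pos by (simp add: power_mult_distrib less_imp_le)
      also have "\<dots> \<le> (\<Sum>y | f y \<noteq> 0 \<and> real j * R \<le> real (gdist \<mu> x y). (f y)\<^sup>2 * m y) * ((2 * (1 + real j)) ^ \<nu> * vol x R)"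
      proof (rule mult_mono)
        show "(\<Sum>y\<in>?Yj. (f y)\<^sup>2 * m y) \<le> (\<Sum>y | f y \<noteq> 0 \<and> real j * R \<le> real (gdist \<mu> x y). (f y)\<^sup>2 * m y)"
          using Y m_pos ann(1) by (intro sum_mono2) (auto simp: less_imp_le)
        have "(\<Sum>y\<in>?Yj. m y) \<le> vol x ((1 + real j) * R)"
          unfolding vol_def using m_pos ann(2) by (intro sum_mono2) (auto simp: less_imp_le mem_gball add.commute)
        also have "\<dots> \<le> (2 * (1 + real j)) ^ \<nu> * vol x R" using R by (intro vol_growth) auto
        finally show "(\<Sum>y\<in>?Yj. m y) \<le> (2 * (1 + real j)) ^ \<nu> * vol x R" .
      qed (use m_pos in \<open>auto intro!: sum_nonneg simp: less_imp_le\<close>)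
      also have "\<dots> = (2 * (1 + real j)) ^ \<nu> * (vol x R * (\<Sum>y | f y \<noteq> 0 \<and> real j * R \<le> real (gdist \<mu> x y). (f y)\<^sup>2 * m y))"
        by (simp add: mult_ac)
      also have "\<dots> \<le> (2 * (1 + real j)) ^ \<nu> * (B * exp (- c * ((real j * R)\<^sup>2 / real n)) * S)"
        using tail[OF n S, of "real j * R"] R unfolding f_def R_def by (intro mult_left_mono) auto
      also have "\<dots> \<le> ((2 * (1 + real j)) ^ \<nu>)\<^sup>2 * (B * exp (- c * real j) * S)"
      proof (intro mult_mono mult_left_mono mult_right_mono)
        have "1 \<le> (2 * (1 + real j)) ^ \<nu>" by (intro one_le_power) auto
        then show "(2 * (1 + real j)) ^ \<nu> \<le> ((2 * (1 + real j)) ^ \<nu>)\<^sup>2" by (simp add: power2_eq_square)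
        have "(real j * R)\<^sup>2 / real n = (real j)\<^sup>2" using R n by (simp add: power_mult_distrib)
        moreover have "real j \<le> (real j)\<^sup>2" by (cases j) (auto simp: power2_eq_square)
        ultimately show "exp (- c * ((real j * R)\<^sup>2 / real n)) \<le> exp (- c * real j)" using c by simp
      qed (use B S0 in auto)
      also have "\<dots> = (sqrt B * sqrt S * (2 * (1 + real j)) ^ \<nu> * exp (- (c / 2) * real j))\<^sup>2"
      proof -
        have "exp (- c * real j) = (exp (- (c / 2) * real j))\<^sup>2" by (simp add: power2_eq_square exp_add[symmetric])
        then show ?thesis using B S0 by (simp add: power_mult_distrib)
      qed
      finally show ?thesis by (rule power2_le_imp_le) (use B S0 in auto)
    qed
    have "(\<Sum>y\<in>?Y. f y * m y * (1 + real (gdist \<mu> x y) / R) ^ \<nu>) \<le> (\<Sum>y\<in>?Y. f y * m y * (2 * (1 + real (ann y))) ^ \<nu>)"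
    proof (intro sum_mono mult_left_mono power_mono)
      fix y
      have "real (gdist \<mu> x y) / R \<le> real (ann y) + 1" using ann(2)[of y] R by (simp add: field_simps)
      then show "1 + real (gdist \<mu> x y) / R \<le> 2 * (1 + real (ann y))" by simp
    qed (use f0 m_pos R in \<open>auto simp: less_imp_le\<close>)
    also have "\<dots> = (\<Sum>j\<in>ann ` ?Y. \<Sum>y | y \<in> ?Y \<and> ann y = j. f y * m y * (2 * (1 + real (ann y))) ^ \<nu>)"
      using sum.image_gen[OF Y] by fast
    also have "\<dots> = (\<Sum>j\<in>ann ` ?Y. (2 * (1 + real j)) ^ \<nu> * (\<Sum>y | y \<in> ?Y \<and> ann y = j. f y * m y))"
      unfolding sum_distrib_left by (intro sum.cong refl) auto
    also have "\<dots> \<le> (\<Sum>j\<in>ann ` ?Y. sqrt B * sqrt S * 4 ^ \<nu> * A * q ^ j)"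
    proof (intro sum_mono)
      fix j
      have "(2 * (1 + real j)) ^ \<nu> * (\<Sum>y | y \<in> ?Y \<and> ann y = j. f y * m y)
        \<le> (2 * (1 + real j)) ^ \<nu> * (sqrt B * sqrt S * (2 * (1 + real j)) ^ \<nu> * exp (- (c / 2) * real j))"
        by (intro mult_left_mono layer) auto
      also have "\<dots> = sqrt B * sqrt S * 4 ^ \<nu> * ((1 + real j) ^ (2 * \<nu>) * exp (- (c / 4) * real j)) * q ^ j"
      proof -
        have "exp (- (c / 2) * real j) = exp (- (c / 4) * real j) * q ^ j"
          unfolding q_def by (simp add: exp_of_nat_mult[symmetric] exp_add[symmetric] algebra_simps)
        moreover have "(2 * (1 + real j)) ^ \<nu> * (2 * (1 + real j)) ^ \<nu> = 4 ^ \<nu> * (1 + real j) ^ (2 * \<nu>)"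
        proof -
          have "(2 * w) ^ \<nu> * (2 * w) ^ \<nu> = 4 ^ \<nu> * w ^ (2 * \<nu>)" for w :: real
          proof -
            have "(2 * w) ^ \<nu> * (2 * w) ^ \<nu> = ((2 * w) * (2 * w)) ^ \<nu>" by (rule power_mult_distrib[symmetric])
            also have "(2 * w) * (2 * w) = 4 * w\<^sup>2" by (simp add: power2_eq_square)
            also have "(4 * w\<^sup>2) ^ \<nu> = 4 ^ \<nu> * w ^ (2 * \<nu>)" by (simp only: power_mult_distrib power_mult)
            finally show ?thesis .
          qed
          then show ?thesis .
        qed
        moreover have "X * (p * q * X * (e * r)) = p * q * Y * (Z * e) * r" if "X * X = Y * Z"
          for X Y Z p q e r :: real
        proof -
          have "X * (p * q * X * (e * r)) = (X * X) * (p * q * e * r)" by simp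
          then show ?thesis unfolding that by simp
        qed
        ultimately show ?thesis by presburger
      qed
      also have "\<dots> \<le> sqrt B * sqrt S * 4 ^ \<nu> * A * q ^ j"
        using A(2)[of "real j"] B S0 q by (intro mult_right_mono mult_left_mono) auto
      finally show "(2 * (1 + real j)) ^ \<nu> * (\<Sum>y | y \<in> ?Y \<and> ann y = j. f y * m y)
        \<le> sqrt B * sqrt S * 4 ^ \<nu> * A * q ^ j" .
    qed
    also have "\<dots> = sqrt B * sqrt S * 4 ^ \<nu> * A * (\<Sum>j\<in>ann ` ?Y. q ^ j)" by (simp only: sum_distrib_left)
    also have "\<dots> \<le> sqrt B * sqrt S * 4 ^ \<nu> * A * (1 / (1 - q))"
    proof (intro mult_left_mono)
      have "(\<Sum>j\<in>ann ` ?Y. q ^ j) \<le> (\<Sum>j. q ^ j)"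
        using q Y by (intro sum_le_suminf summable_geometric) auto
      also have "\<dots> = 1 / (1 - q)" using q by (intro suminf_geometric) auto
      finally show "(\<Sum>j\<in>ann ` ?Y. q ^ j) \<le> 1 / (1 - q)" .
    qed (use A B S0 in auto)
    also have "\<dots> = C * sqrt S" by (simp add: C_def)
    finally show ?thesis unfolding f_def R_def .
  qed
  then show ?thesis using that C by blast
qed

text \<open>The difference of forms is the form of \<open>(1 - x) * x ^ (2 * n)\<close> at the point
  mass. The pointwise damping bound with \<open>k = l = 1\<close> then yields \<open>1 / n\<close>,
  which compensates the squared radius in the Poincare inequality.\<close>

lemma heat_energy:
  obtains C where "0 < C"
    "\<And>x n S. 1 \<le> n \<Longrightarrow> below S x n \<Longrightarrow>
      real n * vol x (sqrt (real n)) * (ip (heat n x) (heat n x) - ip (P (heat n x)) (heat n x)) \<le> C * S"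
proof -
  have L: "0 < 1 - a" "(1 - a) ^ 1 < 2" using a by auto
  obtain C where C: "0 < C" and
    bd: "\<And>n x. 1 \<le> n \<Longrightarrow> x \<in> {0..1 - a} \<Longrightarrow> \<bar>x ^ 1 * (1 - x ^ 1) ^ n\<bar> \<le> C * damping 1 1 J n x"
    using monomial_power_le_damping[OF order_refl L, of 1 J] by metis
  define C' where "C' = C * (8 ^ (J + 1) * D)"
  have C': "0 < C'" using C D_ge_1 by (simp add: C'_def)
  have "real n * vol x (sqrt (real n)) * (ip (heat n x) (heat n x) - ip (P (heat n x)) (heat n x)) \<le> C' * S"
    if n: "1 \<le> n" and S: "below S x n" for x n S
  proof -
    define p where "p = [:1, - 1:] * monom 1 (2 * n) * (1 :: real poly)"
    have p: "p = monom 1 n * ([:1, - 1:] * monom 1 n)" 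
    proof -
      have "monom 1 (2 * n) = monom 1 n * (monom 1 n :: real poly)" by (simp add: mult_monom mult_2)
      then show ?thesis unfolding p_def by (simp only: ac_simps mult_1_right mult_1_left)
    qed
    have "ip (pop p (dens x)) (dens x) = ip (pop [:1, - 1:] (heat n x)) (heat n x)"
      unfolding p pop_mult[of "monom 1 n"] unfolding pop_mult by (intro ip_pop_commute fs_pop fs_dens)
    also have "pop [:1, - 1:] (heat n x) = (\<lambda>u. 1 * heat n x u + (- 1) * P (heat n x) u)"
      using P_scale[of "- 1" "heat n x"] by simp
    also have "ip \<dots> (heat n x) = 1 * ip (heat n x) (heat n x) + (- 1) * ip (P (heat n x)) (heat n x)"
      by (intro ip_lin_left fs_P fs_pop fs_dens)
    finally have e: "ip (heat n x) (heat n x) - ip (P (heat n x)) (heat n x) = ip (pop p (dens x)) (dens x)" by simp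
    have "vol x (sqrt (real n)) * ip (pop p (dens x)) (dens x) \<le> (C / real n) * (8 ^ (J + 1) * D * S)"
    proof (rule poly_form_le_damp[OF n S])
      fix y assume y: "y \<in> {a..1}"
      have n2: "1 \<le> 2 * n" using n by simp
      have "poly p y \<le> C * damping 1 1 J (2 * n) (1 - y)"
      proof -
        have "poly p y = (1 - y) ^ 1 * (1 - (1 - y) ^ 1) ^ (2 * n)"
          unfolding p_def poly_mult poly_monom by simp
        also have "\<dots> \<le> C * damping 1 1 J (2 * n) (1 - y)"
          using y by (intro order_trans[OF abs_ge_self bd] n2) auto
        finally show ?thesis .
      qed
      also have "damping 1 1 J (2 * n) (1 - y) = 1 / (real (2 * n) * (1 + real (2 * n) * (1 - y)) ^ J)"
        using n by (simp add: damping_def)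
      also have "\<dots> \<le> 1 / (real n * (1 + real n * (1 - y)) ^ J)"
      proof (intro frac_le mult_mono power_mono)
        have "real n * (1 - y) \<le> real (2 * n) * (1 - y)" using y by (intro mult_right_mono) auto
        then show "1 + real n * (1 - y) \<le> 1 + real (2 * n) * (1 - y)" by simp
        have "0 < 1 + real n * (1 - y)" using y by (simp add: add_pos_nonneg)
        then show "0 < real n * (1 + real n * (1 - y)) ^ J" using n by simp
      qed (use y in auto)
      finally show "poly p y \<le> C / real n * (1 / (1 + real n * (1 - y)) ^ J)" using C by (simp add: mult_left_mono)
    qed (use C in auto)
    then have "real n * (vol x (sqrt (real n)) * ip (pop p (dens x)) (dens x)) \<le> real n * ((C / real n) * (8 ^ (J + 1) * D * S))"
      by (intro mult_left_mono) auto
    also have "\<dots> = C' * S" using n by (simp add: C'_def)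
    finally show ?thesis unfolding e by (simp add: mult.assoc)
  qed
  then show ?thesis using that C' by blast
qed

text \<open>Nash's argument: the Poincare inequality at scale \<open>\<epsilon> * sqrt n\<close> leaves the averages of \<open>heat n x\<close>,
  which unit mass and the moment bound control by \<open>sqrt S\<close>.\<close>

lemma on_diagonal_step:
  obtains C where "0 < C"
    "\<And>x n S. 1 \<le> n \<Longrightarrow> below S x n \<Longrightarrow> \<phi> x n \<le> S / 2 + C * sqrt S"
proof -
  obtain C1 where C1: "0 < C1" and mom:
    "\<And>x n S. 1 \<le> n \<Longrightarrow> below S x n \<Longrightarrow>
      (\<Sum>y | heat n x y \<noteq> 0. heat n x y * m y * (1 + real (gdist \<mu> x y) / sqrt (real n)) ^ \<nu>) \<le> C1 * sqrt S"
    by (rule heat_moment) blast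
  obtain C2 where C2: "0 < C2" and en:
    "\<And>x n S. 1 \<le> n \<Longrightarrow> below S x n \<Longrightarrow>
      real n * vol x (sqrt (real n)) * (ip (heat n x) (heat n x) - ip (P (heat n x)) (heat n x)) \<le> C2 * S"
    by (rule heat_energy) blast
  define G where "G = 4 * D ^ 3 * K * C2"
  have G: "0 \<le> G" using D_ge_1 K C2 by (simp add: G_def)
  \<comment> \<open>Makes the energy term at scale \<open>\<epsilon> * sqrt n\<close> at most
    \<open>S / 2\<close>; the price is the factor \<open>(4 / \<epsilon>) ^ \<nu>\<close> in
    \<open>C\<close>.\<close>
  define \<epsilon> where "\<epsilon> = 1 / (2 * (G + 1))"
  have \<epsilon>: "0 < \<epsilon>" "\<epsilon> \<le> 1" "G * \<epsilon>\<^sup>2 \<le> 1 / 2"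
  proof -
    show "0 < \<epsilon>" "\<epsilon> \<le> 1" using G by (auto simp: \<epsilon>_def)
    have "(G + 1) * \<epsilon> = 1 / 2" using G by (simp add: \<epsilon>_def)
    then have "G * \<epsilon> \<le> 1 / 2" using \<open>0 < \<epsilon>\<close> by (simp add: algebra_simps)
    moreover have "(G * \<epsilon>) * \<epsilon> \<le> (G * \<epsilon>) * 1" using G \<open>0 < \<epsilon>\<close> \<open>\<epsilon> \<le> 1\<close> by (intro mult_left_mono) auto
    ultimately show "G * \<epsilon>\<^sup>2 \<le> 1 / 2" by (simp add: power2_eq_square mult.assoc)
  qed
  define C where "C = 2 * D * ((4 / \<epsilon>) ^ \<nu> * D * C1)"
  have C: "0 < C" using D_ge_1 \<epsilon> C1 by (simp add: C_def)
  have "\<phi> x n \<le> S / 2 + C * sqrt S"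
    if n: "1 \<le> n" and S: "below S x n" for x n S
  proof -
    define R where "R = sqrt (real n)"
    have R: "0 < R" "R\<^sup>2 = real n" using n by (auto simp: R_def)
    define s where "s = \<epsilon> * R"
    have s: "0 < s" "s \<le> R" using \<epsilon> R by (auto simp: s_def)
    have S0: "0 \<le> S" using S \<phi>_nonneg[of x 0] by (meson le0 order_trans)
    define f where "f = heat n x"
    have f: "fs f" by (simp add: f_def fs_pop)
    have v: "0 < vol x R" using vol_pos[OF R(1)] .
    define Z where "Z = (\<Union>y\<in>{y. f y \<noteq> 0}. gball \<mu> s y)"
    have Z: "finite Z" unfolding Z_def using f by (auto simp: fs_def)
    have "(\<Sum>z\<in>Z. m z * (avg f s z)\<^sup>2) \<le>
     (4 * R / s) ^ \<nu> * D * (\<Sum>y | f y \<noteq> 0. f y * m y * (1 + real (gdist \<mu> x y) / R) ^ \<nu>) / vol x R"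
      using f heat_nonneg heat_mass_le_1 s Z unfolding f_def by (intro avg_norm_le_moment) auto
    also have "\<dots> \<le> (4 * R / s) ^ \<nu> * D * (C1 * sqrt S) / vol x R"
      using mom[OF n S] s R D_ge_1 v unfolding f_def R_def by (intro divide_right_mono mult_left_mono) auto
    also have "4 * R / s = 4 / \<epsilon>" using R by (simp add: s_def)
    finally have 1: "(\<Sum>z\<in>Z. m z * (avg f s z)\<^sup>2) \<le> (4 / \<epsilon>) ^ \<nu> * D * (C1 * sqrt S) / vol x R" .
    have "\<phi> x n = vol x R * ip f f" using n by (simp add: \<phi>_def R_def f_def max_def)
    also have "\<dots> \<le> vol x R * (4 * D ^ 3 * K * s\<^sup>2 * (ip f f - ip (P f) f) + 2 * D * (\<Sum>z\<in>Z. m z * (avg f s z)\<^sup>2))"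
      using pseudo_poincare[OF f s(1)] v unfolding Z_def by (intro mult_left_mono) auto
    also have "\<dots> = 4 * D ^ 3 * K * \<epsilon>\<^sup>2 * (real n * vol x R * (ip f f - ip (P f) f)) + 2 * D * (vol x R * (\<Sum>z\<in>Z. m z * (avg f s z)\<^sup>2))"
      unfolding s_def power_mult_distrib R by (simp add: algebra_simps)
    also have "\<dots> \<le> 4 * D ^ 3 * K * \<epsilon>\<^sup>2 * (C2 * S) + 2 * D * (vol x R * ((4 / \<epsilon>) ^ \<nu> * D * (C1 * sqrt S) / vol x R))"
      using en[OF n S] 1 v D_ge_1 K unfolding f_def R_def by (intro add_mono mult_left_mono) auto
    also have "\<dots> = (G * \<epsilon>\<^sup>2) * S + C * sqrt S" using v by (simp add: G_def C_def)
    also have "\<dots> \<le> 1 / 2 * S + C * sqrt S" using \<epsilon> S0 by (intro add_right_mono mult_right_mono) auto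
    finally show ?thesis by simp
  qed
  then show ?thesis using that C by blast
qed

text \<open>The maximum \<open>S\<close> over the times up to \<open>N\<close> is attained at some
  \<open>n <= N\<close>, where the step gives \<open>S <= S / 2 + C * sqrt S\<close> unless
  \<open>n = 0\<close>. As \<open>S\<close> is finite, this can be solved for \<open>S\<close>, and
  the bound depends neither on \<open>N\<close> nor on \<open>x\<close>.\<close>

lemma on_diagonal:
  obtains C where "0 < C" "\<And>x n. \<phi> x n \<le> C"
proof -
  obtain C where C: "0 < C" and step:
    "\<And>x n S. 1 \<le> n \<Longrightarrow> below S x n \<Longrightarrow> \<phi> x n \<le> S / 2 + C * sqrt S"
    by (rule on_diagonal_step) blast
  have "\<phi> x N \<le> max 1 (4 * C\<^sup>2)" for x N
  proof -
    define S where "S = Max (\<phi> x ` {..N})"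
    have S: "\<phi> x j \<le> S" if "j \<le> N" for j unfolding S_def using that by (intro Max_ge) auto
    have "S \<in> \<phi> x ` {..N}" unfolding S_def by (intro Max_in) auto
    then obtain n where n: "n \<le> N" "S = \<phi> x n" by auto
    have "S \<le> max 1 (4 * C\<^sup>2)"
    proof (cases "n = 0")
      case True
      have "vol x 1 = m x" unfolding vol_def by (simp add: gball_le_1)
      moreover have "ip (dens x) (dens x) = 1 / m x" by (simp add: ip_dens) (simp add: dens_def \<delta>_def)
      ultimately have "\<phi> x 0 = 1" using m_pos[of x] by (simp add: \<phi>_def heat_0)
      then show ?thesis using True n by simp
    next
      case False
      then have "S \<le> S / 2 + C * sqrt S" unfolding n(2) using n S by (intro step) auto
      then have "S \<le> 2 * C * sqrt S" by simp
      moreover have S0: "0 \<le> S" unfolding n(2) by (rule \<phi>_nonneg)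
      ultimately have "sqrt S * sqrt S \<le> 2 * C * sqrt S" by simp
      then have "sqrt S \<le> 2 * C"
      proof (cases "S = 0")
        case False
        then have "0 < sqrt S" using S0 by simp
        then show ?thesis using \<open>sqrt S * sqrt S \<le> 2 * C * sqrt S\<close> by (rule mult_right_le_imp_le[rotated])
      qed (use C in simp)
      then have "(sqrt S)\<^sup>2 \<le> (2 * C)\<^sup>2" using S0 by (intro power_mono) auto
      then show ?thesis using S0 by (simp add: power_mult_distrib)
    qed
    then show ?thesis using S[of N] by simp
  qed
  moreover have "0 < max 1 (4 * C\<^sup>2)" by simp
  ultimately show ?thesis using that by blast
qed


lemma off_diagonal:
  assumes k: "1 \<le> k" and L: "(1 - a) ^ k < 2"
  obtains C c where "0 < C" "0 < c"
    "\<And>n u v. 1 \<le> n \<Longrightarrow>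
      kernel_bound k l C c n u v"
proof -
  have L0: "0 < 1 - a" using a by simp
  obtain B c where B: "0 < B" and c: "0 < c" and
    ap: "\<And>n r. 1 \<le> n \<Longrightarrow> 0 \<le> r \<Longrightarrow>
       poly_approx (1 - a) r (\<lambda>x. x ^ l * (1 - x ^ k) ^ n) (\<lambda>x. B * exp (- c * decay_rate k n r) * damping k l J n x)"
    using damped_power_approx[OF k L0 L, of l J] by metis
  obtain C0 where C0: "0 < C0" "\<And>x n. \<phi> x n \<le> C0" by (rule on_diagonal) blast
  define C1 where "C1 = 8 ^ (J + 1) * D * C0"
  have C1: "0 < C1" using C0 D_ge_1 by (simp add: C1_def)
  have "kernel_bound k l (B * C1 * D) c n u v"
    if n: "1 \<le> n" for n u v
  proof -
    define t where "t = real n powr (1 / real k)"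
    define r where "r = real n powr (1 / (2 * real k))"
    \<comment> \<open>The damping lives at the scale \<open>t = n powr (1 / k)\<close>, but heat
      kernels exist at integer times only. As \<open>n' <= t <= 2 * n'\<close>, the radius
      \<open>sqrt t\<close> is at most \<open>2 * sqrt n'\<close> and one doubling suffices.\<close>
    define n' where "n' = nat \<lfloor>t\<rfloor>"
    define d where "d = real (gdist \<mu> u v)"
    let ?e = "exp (- c * decay_rate k n d)"
    have t1: "1 \<le> t" unfolding t_def using n by (intro ge_one_powr_ge_zero) auto
    have rt: "r = sqrt t" unfolding r_def t_def using n by (simp add: powr_half_sqrt[symmetric] powr_powr mult.commute)
    have r0: "0 < r" using n by (simp add: r_def)
    have n': "1 \<le> n'" "real n' \<le> t" "t \<le> 2 * real n'"
    proof -
      have e: "real n' = of_int \<lfloor>t\<rfloor>" using t1 by (simp add: n'_def)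
      show "1 \<le> n'" using t1 by (simp add: n'_def le_nat_iff le_floor_iff)
      show "real n' \<le> t" unfolding e by simp
      have "t < real n' + 1" unfolding e by linarith
      then show "t \<le> 2 * real n'" using \<open>1 \<le> n'\<close> by linarith
    qed
    obtain Q where Q: "\<And>i. d \<le> real i \<Longrightarrow> coeff Q i = 0"
      "\<And>x. x \<in> {0..1 - a} \<Longrightarrow> \<bar>x ^ l * (1 - x ^ k) ^ n - poly Q x\<bar> \<le> B * ?e * damping k l J n x"
      using ap[OF n, of d] unfolding d_def by fastforce
    define p :: "real poly" where "p = [:1, - 1:] ^ l * (1 - [:1, - 1:] ^ k) ^ n"
    define q where "q = p - pcompose Q [:1, - 1:]"
    define E where "E = B * ?e / t ^ l"
    have E: "0 \<le> E" using B t1 by (simp add: E_def)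
    have "\<bar>poly q y\<bar> \<le> poly (smult E (damp_poly n')) y" if y: "y \<in> {a..1}" for y
    proof -
      have "poly q y = (1 - y) ^ l * (1 - (1 - y) ^ k) ^ n - poly Q (1 - y)"
        unfolding q_def p_def by (simp add: poly_pcompose)
      then have "\<bar>poly q y\<bar> \<le> B * ?e * damping k l J n (1 - y)" using Q(2)[of "1 - y"] y by simp
      also have "\<dots> \<le> B * ?e * (1 / t ^ l * (1 / (1 + real n' * (1 - y)) ^ J))"
      proof (rule mult_left_mono)
        have g: "0 < 1 + real n' * (1 - y)" using y by (simp add: add_pos_nonneg)
        have "real n' * (1 - y) \<le> t * (1 - y)" using y n' by (intro mult_right_mono) auto
        then have "(1 + real n' * (1 - y)) ^ J \<le> (1 + t * (1 - y)) ^ J" using g by (intro power_mono) auto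
        then have "t ^ l * (1 + real n' * (1 - y)) ^ J \<le> t ^ l * (1 + t * (1 - y)) ^ J"
          using t1 by (intro mult_left_mono) auto
        then have "damping k l J n (1 - y) \<le> 1 / (t ^ l * (1 + real n' * (1 - y)) ^ J)"
          unfolding damping_def t_def[symmetric] using t1 g by (intro frac_le mult_pos_pos zero_less_power) auto
        then show "damping k l J n (1 - y) \<le> 1 / t ^ l * (1 / (1 + real n' * (1 - y)) ^ J)" by simp
      qed (use B in simp)
      also have "\<dots> = E * (1 / (1 + real n' * (1 - y)) ^ J)" by (simp add: E_def)
      also have "\<dots> \<le> E * poly (damp_poly n') y" using E damp_poly_ge[OF y] by (intro mult_left_mono) auto
      finally show ?thesis by simp
    qed
    \<comment> \<open>The same majorant at \<open>u\<close> and at \<open>v\<close> produces the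
      geometric mean of the two volumes.\<close>
    from form_bound[OF this, of "dens v" "dens u"]
    have "(ip (pop q (dens v)) (dens u))\<^sup>2 \<le> (E * ip (pop (damp_poly n') (dens v)) (dens v)) * (E * ip (pop (damp_poly n') (dens u)) (dens u))"
      by (simp add: ip_pop_smult)
    also have "\<dots> \<le> (E * (C1 * D / vol v r)) * (E * (C1 * D / vol u r))"
    proof -
      have W: "E * ip (pop (damp_poly n') (dens x)) (dens x) \<le> E * (C1 * D / vol x r)"
        "0 \<le> E * ip (pop (damp_poly n') (dens x)) (dens x)" for x
      proof -
        have vx: "0 < vol x r" "0 < vol x (sqrt (real n'))" using r0 n' by (auto intro!: vol_pos)
        have "r \<le> sqrt (4 * real n')" unfolding rt using n' by (intro real_sqrt_le_mono) linarith
        then have "vol x r \<le> vol x (2 * sqrt (real n'))" by (intro vol_mono) (simp add: real_sqrt_mult)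
        also have "\<dots> \<le> D * vol x (sqrt (real n'))" using n' by (intro doubling) auto
        finally have v: "vol x r \<le> D * vol x (sqrt (real n'))" .
        have i0: "0 \<le> ip (pop (damp_poly n') (dens x)) (dens x)"
        proof (rule poly_form_nonneg)
          fix y assume y: "y \<in> {a..1}"
          then have "0 \<le> 1 / (1 + real n' * (1 - y)) ^ J" by simp
          then show "0 \<le> poly (damp_poly n') y" using damp_poly_ge[OF y, of n'] by linarith
        qed simp
        have "vol x (sqrt (real n')) * ip (pop (damp_poly n') (dens x)) (dens x) \<le> C1"
          unfolding C1_def using n' C0 by (intro damp_form_le) auto
        then have "D * (vol x (sqrt (real n')) * ip (pop (damp_poly n') (dens x)) (dens x)) \<le> D * C1"
          using D_ge_1 by (intro mult_left_mono) auto
        moreover have "vol x r * ip (pop (damp_poly n') (dens x)) (dens x) \<le> (D * vol x (sqrt (real n'))) * ip (pop (damp_poly n') (dens x)) (dens x)"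
          using v i0 by (intro mult_right_mono)
        ultimately have "vol x r * ip (pop (damp_poly n') (dens x)) (dens x) \<le> C1 * D"
          by (simp add: mult_ac)
        then have "ip (pop (damp_poly n') (dens x)) (dens x) \<le> C1 * D / vol x r"
          using vx by (simp add: pos_le_divide_eq mult.commute)
        then show "E * ip (pop (damp_poly n') (dens x)) (dens x) \<le> E * (C1 * D / vol x r)"
          using E by (rule mult_left_mono)
        show "0 \<le> E * ip (pop (damp_poly n') (dens x)) (dens x)" using E i0 by (rule mult_nonneg_nonneg)
      qed
      show ?thesis by (intro mult_mono W order_trans[OF W(2) W(1)])
    qed
    also have "\<dots> = (E * C1 * D / sqrt (vol u r * vol v r))\<^sup>2"
    proof -
      have "(sqrt (vol u r * vol v r))\<^sup>2 = vol u r * vol v r"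
        using vol_pos[OF r0, of u] vol_pos[OF r0, of v] by (intro real_sqrt_pow2 mult_nonneg_nonneg) auto
      moreover have "e * (w / p) * (e * (w / q)) = (e * w)\<^sup>2 / (q * p)" for e w p q :: real
        by (simp add: power2_eq_square mult_ac)
      ultimately show ?thesis unfolding power_divide by (simp only: mult.assoc)
    qed
    finally have "\<bar>ip (pop q (dens v)) (dens u)\<bar> \<le> \<bar>E * C1 * D / sqrt (vol u r * vol v r)\<bar>"
      by (simp only: abs_le_square_iff)
    also have "\<dots> = E * C1 * D / sqrt (vol u r * vol v r)"
      using E C1 D_ge_1 vol_pos[OF r0, of u] vol_pos[OF r0, of v]
      by (intro abs_of_nonneg divide_nonneg_nonneg mult_nonneg_nonneg real_sqrt_ge_zero) auto
    finally have "\<bar>ip (pop q (dens v)) (dens u)\<bar> \<le> E * C1 * D / sqrt (vol u r * vol v r)" .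
    then have "m v * \<bar>ip (pop q (dens v)) (dens u)\<bar> \<le> m v * (E * C1 * D / sqrt (vol u r * vol v r))"
      using m_pos[of v] by (intro mult_left_mono) auto
    moreover have "\<bar>poly_kernel \<mu> p u v\<bar> = m v * \<bar>ip (pop q (dens v)) (dens u)\<bar>"
    proof -
      have "poly_kernel \<mu> p u v = m v * ip (pop q (dens v)) (dens u)"
      proof -
        have "pop (pcompose Q [:1, - 1:]) (dens v) u = 0"
          by (rule pop_dens_eq_0[of d]) (auto intro: coeff_pcompose_eq_0[of d] Q(1) simp: d_def)
        moreover have "p = q + pcompose Q [:1, - 1:]" by (simp add: q_def)
        then have "pop p (dens v) = (\<lambda>u. pop q (dens v) u + pop (pcompose Q [:1, - 1:]) (dens v) u)"
          by (simp only: pop_add)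
        ultimately have "pop p (dens v) u = pop q (dens v) u" by simp
        then show ?thesis unfolding poly_kernel_dens by (simp add: ip_dens fs_pop)
      qed
      then show ?thesis using m_pos[of v] by (simp add: abs_mult)
    qed
    ultimately have "\<bar>poly_kernel \<mu> p u v\<bar> \<le> m v * (E * C1 * D / sqrt (vol u r * vol v r))"
      by (simp only:)
    also have "\<dots> = (B * C1 * D) * m v / (t ^ l * sqrt (vol u r * vol v r)) * ?e"
      by (simp add: E_def)
    finally show ?thesis unfolding p_def t_def r_def d_def .
  qed
  moreover have "0 < B * C1 * D" using B C1 D_ge_1 by simp
  ultimately show ?thesis using that c by blast
qed

end

lemma decay_rate_eq:
  assumes "1 \<le> k" "1 \<le> n" "0 \<le> d"
  shows "decay_rate k n d = (d / real n powr (1 / (2 * real k))) powr (2 * real k / (2 * real k - 1))"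
proof (cases "d = 0")
  case True
  then show ?thesis using assms by (simp add: decay_rate_def)
next
  case False
  define x where "x = d / real n powr (1 / (2 * real k))"
  have x: "0 < x" using False assms by (simp add: x_def)
  have "x ^ (2 * k) = d ^ (2 * k) / (real n powr (1 / (2 * real k))) ^ (2 * k)"
    by (simp add: x_def power_divide)
  also have "(real n powr (1 / (2 * real k))) ^ (2 * k) = real n"
    using assms by (simp add: powr_realpow[symmetric] powr_powr)
  finally have "decay_rate k n d = (x ^ (2 * k)) powr (1 / (2 * real k - 1))" by (simp add: decay_rate_def)
  also have "x ^ (2 * k) = x powr (2 * real k)" using x by (simp flip: powr_realpow)
  finally show ?thesis using x by (simp add: powr_powr x_def)
qed

section \<open>Passage from the stated hypotheses to real inequalities\<close>

context locally_finite_graph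
begin

lemma gmeasure_gball: "gmeasure \<mu> (gball \<mu> r u) = ennreal (vol u r)"
  unfolding gmeasure_def vol_def using m_pos by (simp add: infsum_finite sum_ennreal less_imp_le)

text \<open>A negative constant becomes 0 in \<open>ennreal\<close>, hence the
  \<open>max\<close>.\<close>

lemma doubling_real:
  assumes "doubling \<mu> D r0" "0 < r" "ereal r < r0"
  shows "vol u (2 * r) \<le> max D 0 * vol u r"
proof -
  have "ennreal (vol u (2 * r)) \<le> ennreal D * ennreal (vol u r)"
    using assms unfolding doubling_def gmeasure_gball by blast
  also have "\<dots> = ennreal (max D 0 * vol u r)"
    using vol_pos[OF assms(2), of u] by (cases "0 \<le> D") (auto simp: ennreal_mult max_def ennreal_neg)
  finally show ?thesis using vol_pos[OF assms(2), of u] by (subst (asm) ennreal_le_iff) auto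
qed

lemma grad_sq_eq: "grad_sq \<mu> f v * ennreal (m v) = ennreal (energy f v)"
proof -
  have "(\<Sum>\<^sub>\<infinity>w. ennreal (\<mu> v w * (f v - f w)\<^sup>2)) = (\<Sum>w\<in>nbrs v. ennreal (\<mu> v w * (f v - f w)\<^sup>2))"
    by (rule infsum_nbrs) (simp add: nbrs_def)
  also have "\<dots> = ennreal (energy f v)" unfolding energy_def by (intro sum_ennreal mult_nonneg_nonneg nonneg) auto
  finally have "grad_sq \<mu> f v = ennreal (energy f v) / ennreal (m v)" by (simp add: grad_sq_def)
  also have "\<dots> = ennreal (energy f v / m v)" using energy_nonneg m_pos[of v] by (simp add: divide_ennreal)
  finally have "grad_sq \<mu> f v * ennreal (m v) = ennreal (energy f v / m v * m v)"
    using energy_nonneg[of f v] m_pos[of v] by (simp add: ennreal_mult[symmetric])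
  then show ?thesis using m_pos[of v] by simp
qed

lemma poincare_real:
  assumes "poincare \<mu> K r0" "0 < r" "ereal r < r0"
  shows "(\<Sum>v\<in>gball \<mu> r u. (f v - avg f r u)\<^sup>2 * m v) \<le> max K 0 * r\<^sup>2 * (\<Sum>v\<in>gball \<mu> (2 * r) u. energy f v)"
proof -
  have av: "gavg \<mu> f u r = avg f r u"
    unfolding gavg_def avg_def gmeasure_gball using vol_pos[OF assms(2), of u] by (simp add: infsum_finite)
  have "(\<Sum>\<^sub>\<infinity>v\<in>gball \<mu> r u. ennreal (\<bar>f v - gavg \<mu> f u r\<bar>\<^sup>2 * m v))
        \<le> ennreal (K * r\<^sup>2) * (\<Sum>\<^sub>\<infinity>v\<in>gball \<mu> (2 * r) u. grad_sq \<mu> f v * ennreal (m v))"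
    using assms unfolding poincare_def by blast
  also have "(\<Sum>\<^sub>\<infinity>v\<in>gball \<mu> r u. ennreal (\<bar>f v - gavg \<mu> f u r\<bar>\<^sup>2 * m v)) = ennreal (\<Sum>v\<in>gball \<mu> r u. (f v - avg f r u)\<^sup>2 * m v)"
    using m_pos by (simp add: infsum_finite av sum_ennreal less_imp_le)
  also have "(\<Sum>\<^sub>\<infinity>v\<in>gball \<mu> (2 * r) u. grad_sq \<mu> f v * ennreal (m v)) = ennreal (\<Sum>v\<in>gball \<mu> (2 * r) u. energy f v)"
    unfolding grad_sq_eq using energy_nonneg by (simp add: infsum_finite sum_ennreal)
  also have "ennreal (K * r\<^sup>2) * ennreal (\<Sum>v\<in>gball \<mu> (2 * r) u. energy f v)
     = ennreal (max K 0 * r\<^sup>2 * (\<Sum>v\<in>gball \<mu> (2 * r) u. energy f v))"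
    using energy_nonneg
    by (cases "0 \<le> K") (auto simp: ennreal_mult[symmetric] sum_nonneg max_def ennreal_neg mult_nonpos_nonneg)
  finally show ?thesis using energy_nonneg by (subst (asm) ennreal_le_iff) (auto intro!: mult_nonneg_nonneg sum_nonneg)
qed

end

text \<open>The radius 3 / 4 is the device: that ball is a single vertex, while the doubled one
  contains all neighbours. So the neighbours of \<open>u\<close> have total weight at most
  \<open>D * m u\<close>, and by symmetry each has weight at least \<open>m u / D\<close>, which
  leaves room for at most \<open>D * D\<close> of them.\<close>

lemma doubling_imp_locally_finite:
  assumes g: "weighted_graph \<mu>" and d: "doubling \<mu> D r0" and r0: "1 < r0"
  shows "finite {v. \<mu> u v \<noteq> 0}"
proof -
  define m where "m = vweight \<mu>"
  have mp: "0 < m u" for u using g by (auto simp: weighted_graph_def m_def)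
  have sym: "\<mu> u v = \<mu> v u" and nn: "0 \<le> \<mu> u v" for u v using g by (auto simp: weighted_graph_def)
  have near: "v \<in> gball \<mu> (2 * (3 / 4)) u" if "\<mu> u v \<noteq> 0" for u v
  proof -
    have "(adj \<mu> ^^ 1) u v" using that nn[of u v] by (simp add: adj_def relpowp_1 del: relpowp.simps)
    then have "gdist \<mu> u v \<le> 1" unfolding gdist_def by (rule Least_le)
    then show ?thesis by (simp add: gball_def)
  qed
  have single: "gball \<mu> (3 / 4) u = {u}" for u
  proof -
    have p: "(adj \<mu> ^^ gdist \<mu> u v) u v" for v
    proof -
      have "(adj \<mu>)\<^sup>*\<^sup>* u v" using g by (auto simp: weighted_graph_def)
      then obtain n where "(adj \<mu> ^^ n) u v" using rtranclp_imp_relpowp by metis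
      then show ?thesis unfolding gdist_def by (rule LeastI)
    qed
    have "gdist \<mu> u v = 0 \<longleftrightarrow> u = v" for v
      using p[of v] by (auto simp: gdist_def intro!: Least_equality)
    moreover have "real (gdist \<mu> u v) < 3 / 4 \<longleftrightarrow> gdist \<mu> u v = 0" for v by (cases "gdist \<mu> u v") auto
    ultimately show ?thesis by (auto simp: gball_def)
  qed
  have "ereal (3 / 4) < 1" by simp
  then have r34: "ereal (3 / 4) < r0" using r0 by (rule less_trans)
  have gs: "gmeasure \<mu> (gball \<mu> (3 / 4) u) = ennreal (m u)" for u
    by (simp add: gmeasure_def single infsum_finite m_def)
  have dbl: "gmeasure \<mu> (gball \<mu> (2 * (3 / 4)) u) \<le> ennreal D * ennreal (m u)" for u
    unfolding gs[symmetric] using d[unfolded doubling_def, rule_format, of "3 / 4" u] r34 by simp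
  \<comment> \<open>The ball is not yet known to be finite, so sums are compared over its finite
    subsets.\<close>
  have sub: "(\<Sum>v\<in>F. ennreal (m v)) \<le> ennreal D * ennreal (m u)" if "finite F" "F \<subseteq> gball \<mu> (2 * (3 / 4)) u" for F u
  proof -
    have "(\<Sum>v\<in>F. ennreal (m v)) = infsum (\<lambda>v. ennreal (m v)) F" using that by simp
    also have "\<dots> \<le> gmeasure \<mu> (gball \<mu> (2 * (3 / 4)) u)"
      unfolding gmeasure_def m_def using that by (intro infsum_mono_neutral nonneg_summable_on_complete) auto
    also have "\<dots> \<le> ennreal D * ennreal (m u)" by (rule dbl)
    finally show ?thesis .
  qed
  have Dp: "0 < D"
  proof (rule ccontr)
    assume "\<not> 0 < D"
    then have "ennreal D = 0" by (simp add: ennreal_neg)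
    moreover have "gball \<mu> (3 / 4) u \<subseteq> gball \<mu> (2 * (3 / 4)) u" by (auto simp: gball_def)
    ultimately have "ennreal (m u) \<le> 0" using sub[of "{u}" u] single[of u] by simp
    then show False using mp[of u] by simp
  qed
  have subr: "(\<Sum>v\<in>F. m v) \<le> D * m u" if "finite F" "F \<subseteq> gball \<mu> (2 * (3 / 4)) u" for F u
  proof -
    have "ennreal (\<Sum>v\<in>F. m v) \<le> ennreal (D * m u)"
      using sub[OF that] mp Dp by (simp add: sum_ennreal less_imp_le ennreal_mult)
    then show ?thesis using mp Dp by (subst (asm) ennreal_le_iff) (auto simp: less_imp_le)
  qed
  have card: "real (card F) \<le> D * D" if F: "finite F" "F \<subseteq> {v. \<mu> u v \<noteq> 0}" for F
  proof -
    have "m u / D \<le> m v" if "v \<in> F" for v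
      using subr[of "{u}" v] near[of v u] F that sym[of u v] Dp by (auto simp: field_simps)
    then have "real (card F) * (m u / D) \<le> (\<Sum>v\<in>F. m v)" by (rule sum_bounded_below)
    also have "\<dots> \<le> D * m u" using F near by (intro subr) auto
    finally show ?thesis using mp[of u] Dp by (simp add: field_simps)
  qed
  then have "finite {v. \<mu> u v \<noteq> 0} \<and> card {v. \<mu> u v \<noteq> 0} \<le> nat \<lfloor>D * D\<rfloor>"
    by (intro finite_if_finite_subsets_card_bdd le_nat_floor)
  then show ?thesis by simp
qed

section \<open>Bounded times, for a finite range of scales\<close>

context spectral_graph
begin

lemma poly_kernel_le:
  assumes p: "\<And>y. y \<in> {a..1} \<Longrightarrow> \<bar>poly p y\<bar> \<le> A"
  shows "\<bar>poly_kernel \<mu> p u v\<bar> \<le> m v * (A / sqrt (m u * m v))"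
proof -
  have A: "0 \<le> A" using p[of 1] a by simp
  have d: "ip (dens x) (dens x) = 1 / m x" for x
    using ip_dens[OF fs_dens, of x x] by (simp add: dens_def \<delta>_def)
  have "(ip (pop p (dens v)) (dens u))\<^sup>2 \<le> ip (pop [:A:] (dens v)) (dens v) * ip (pop [:A:] (dens u)) (dens u)"
    using p by (intro form_bound) auto
  also have "\<dots> = (A * (1 / m v)) * (A * (1 / m u))"
    by (simp add: ip_scale_left d)
  also have "\<dots> = (A / sqrt (m u * m v))\<^sup>2"
  proof -
    have "(sqrt (m u * m v))\<^sup>2 = m u * m v" using m_pos[of u] m_pos[of v] by simp
    then show ?thesis unfolding power_divide by (simp add: power2_eq_square mult_ac)
  qed
  finally have "\<bar>ip (pop p (dens v)) (dens u)\<bar> \<le> \<bar>A / sqrt (m u * m v)\<bar>"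
    by (simp only: abs_le_square_iff)
  also have "\<dots> = A / sqrt (m u * m v)"
    using A m_pos[of u] m_pos[of v] by simp
  finally have "m v * \<bar>ip (pop p (dens v)) (dens u)\<bar> \<le> m v * (A / sqrt (m u * m v))"
    using m_pos[of v] by (intro mult_left_mono) auto
  moreover have "\<bar>poly_kernel \<mu> p u v\<bar> = m v * \<bar>ip (pop p (dens v)) (dens u)\<bar>"
    using m_pos[of v] by (simp add: poly_kernel_dens abs_mult)
  ultimately show ?thesis by (simp only:)
qed

lemma poly_kernel_eq_0: "degree p < gdist \<mu> u v \<Longrightarrow> poly_kernel \<mu> p u v = 0"
  unfolding poly_kernel_eq by (rule pop_\<delta>_eq_0[of "real (gdist \<mu> u v)"]) (auto intro: coeff_eq_0)

text \<open>The restriction on the radius bounds \<open>n\<close> by \<open>N\<close>. At distance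
  above \<open>l + k * n\<close> the kernel vanishes by degree; up to there the decay rate is at
  most \<open>T\<close>, so the exponential factor is bounded from below and the rate 1 will do. The
  volumes are comparable with \<open>m u\<close> and \<open>m v\<close> after boundedly many
  doublings.\<close>

lemma off_diagonal_bounded_time:
  assumes k: "1 \<le> k" and L: "(1 - a) ^ k < 2" and D: "1 \<le> D"
    and dbl: "\<And>r u. 0 < r \<Longrightarrow> r < \<rho> \<Longrightarrow> vol u (2 * r) \<le> D * vol u r"
  obtains C where "0 < C"
    "\<And>n u v. 1 \<le> n \<Longrightarrow> real n powr (1 / (2 * real k)) < \<rho> \<Longrightarrow>
      kernel_bound k l C 1 n u v"
proof -
  define N where "N = nat \<lceil>\<rho> ^ (2 * k)\<rceil>"
  \<comment> \<open>After \<open>i\<close> halvings every admissible radius is below 1, where a ball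
    is just its centre.\<close>
  obtain i where i: "\<rho> < 2 ^ i" using real_arch_pow[of 2 \<rho>] by auto
  define T where "T = decay_rate k 1 (real (l + k * N))"
  define C where "C = 2 ^ l * (real N powr (1 / real k)) ^ l * D ^ i * exp T + 1"
  have C: "0 < C" using D by (simp add: C_def add_nonneg_pos)
  have "kernel_bound k l C 1 n u v"
    if n: "1 \<le> n" and rn: "real n powr (1 / (2 * real k)) < \<rho>" for n u v
  proof -
    define t where "t = real n powr (1 / real k)"
    define r where "r = real n powr (1 / (2 * real k))"
    define p :: "real poly" where "p = [:1, - 1:] ^ l * (1 - [:1, - 1:] ^ k) ^ n"
    have r: "0 < r" "r < \<rho>" using n rn by (auto simp: r_def)
    have t: "1 \<le> t" unfolding t_def using n by (intro ge_one_powr_ge_zero) auto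
    have nN: "n \<le> N"
    proof -
      have "real n = r ^ (2 * k)" using n k by (simp add: r_def powr_realpow[symmetric] powr_powr)
      also have "\<dots> \<le> \<rho> ^ (2 * k)" using r by (intro power_mono) auto
      finally show ?thesis unfolding N_def by linarith
    qed
    have vols: "0 < vol u r" "0 < vol v r" using r by (auto intro: vol_pos)
    show ?thesis
    proof (cases "gdist \<mu> u v \<le> l + k * n")
      case False
      have "degree p \<le> l + k * n"
      proof -
        have 1: "degree ([:1, - 1:] ^ j :: real poly) \<le> j" for j
          using degree_power_le[of "[:1, - 1:] :: real poly" j] by simp
        have "degree (1 - [:1, - 1:] ^ k :: real poly) \<le> k"
          using 1[of k] by (intro degree_diff_le) auto
        then have "degree ((1 - [:1, - 1:] ^ k) ^ n :: real poly) \<le> k * n"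
          by (meson degree_power_le le_trans mult_le_mono1)
        then show ?thesis unfolding p_def using 1[of l] by (meson add_mono degree_mult_le le_trans)
      qed
      then have "poly_kernel \<mu> p u v = 0" using False by (intro poly_kernel_eq_0) linarith
      moreover have "0 \<le> C * m v / (t ^ l * sqrt (vol u r * vol v r)) * exp (- 1 * decay_rate k n (real (gdist \<mu> u v)))"
        using C m_pos[of v] t vols by simp
      ultimately show ?thesis unfolding p_def t_def r_def by simp
    next
      case True
      have "\<bar>poly p y\<bar> \<le> 2 ^ l" if y: "y \<in> {a..1}" for y
      proof -
        have "(1 - y) ^ k \<le> (1 - a) ^ k" using y by (intro power_mono) auto
        moreover have "0 \<le> (1 - y) ^ k" using y by simp
        ultimately have "\<bar>1 - (1 - y) ^ k\<bar> \<le> 1" using L by linarith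
        then have 1: "\<bar>1 - (1 - y) ^ k\<bar> ^ n \<le> 1" by (simp add: power_le_one)
        have 2: "\<bar>1 - y\<bar> ^ l \<le> 2 ^ l" using y a by (intro power_mono) auto
        have "\<bar>poly p y\<bar> = \<bar>1 - y\<bar> ^ l * \<bar>1 - (1 - y) ^ k\<bar> ^ n"
          by (simp add: p_def abs_mult power_abs)
        also have "\<dots> \<le> 2 ^ l * 1" by (intro mult_mono 1 2) auto
        finally show ?thesis by simp
      qed
      then have "\<bar>poly_kernel \<mu> p u v\<bar> \<le> m v * (2 ^ l / sqrt (m u * m v))" by (rule poly_kernel_le)
      also have "\<dots> \<le> m v * (2 ^ l * D ^ i / sqrt (vol u r * vol v r))"
      proof (intro mult_left_mono)
        have V: "vol x r \<le> D ^ i * m x" for x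
        proof -
          \<comment> \<open>Starting from \<open>r / 2 ^ i\<close>, doubling is applied only at
            radii below \<open>r\<close>, hence within the range where it is assumed.\<close>
          have "vol x (r / 2 ^ i * 2 ^ j) \<le> D ^ j * vol x (r / 2 ^ i)" if "j \<le> i" for j
            using that
          proof (induction j)
            case (Suc j)
            have "(2::real) ^ j < 2 ^ i" using Suc by simp
            then have "r * 2 ^ j < r * 2 ^ i" using r by simp
            then have "r / 2 ^ i * 2 ^ j < r" by (simp add: field_simps)
            then have "vol x (2 * (r / 2 ^ i * 2 ^ j)) \<le> D * vol x (r / 2 ^ i * 2 ^ j)"
              using r by (intro dbl) auto
            also have "\<dots> \<le> D * (D ^ j * vol x (r / 2 ^ i))" using Suc D by (intro mult_left_mono) auto
            finally show ?case by (simp add: mult.assoc mult.left_commute)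
          qed simp
          from this[of i] have "vol x r \<le> D ^ i * vol x (r / 2 ^ i)" by simp
          also have "vol x (r / 2 ^ i) = m x"
            unfolding vol_def using r i by (subst gball_le_1) (auto simp: field_simps)
          finally show ?thesis .
        qed
        have "vol u r * vol v r \<le> (D ^ i * m u) * (D ^ i * m v)"
          using V vols D m_pos[of u] by (intro mult_mono) auto
        also have "\<dots> = (D ^ i)\<^sup>2 * (m u * m v)" by (simp add: power2_eq_square)
        finally have "sqrt (vol u r * vol v r) \<le> D ^ i * sqrt (m u * m v)"
          using real_sqrt_le_mono D by (fastforce simp: real_sqrt_mult)
        then have "2 ^ l * sqrt (vol u r * vol v r) \<le> 2 ^ l * (D ^ i * sqrt (m u * m v))" by simp
        then show "2 ^ l / sqrt (m u * m v) \<le> 2 ^ l * D ^ i / sqrt (vol u r * vol v r)"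
          using vols m_pos[of u] m_pos[of v] by (simp add: divide_simps mult_ac)
      qed (use m_pos[of v] in simp)
      also have "\<dots> = 2 ^ l * D ^ i * m v / sqrt (vol u r * vol v r)" by simp
      also have "\<dots> \<le> (C * exp (- 1 * decay_rate k n (real (gdist \<mu> u v))) / t ^ l) * m v / sqrt (vol u r * vol v r)"
      proof (intro divide_right_mono mult_right_mono)
        have "decay_rate k n (real (gdist \<mu> u v)) \<le> T"
          unfolding decay_rate_def T_def
        proof (intro powr_mono2)
          have "l + k * n \<le> l + k * N" using nN by simp
          then have "real (gdist \<mu> u v) \<le> real (l + k * N)" using True by linarith
          then have "real (gdist \<mu> u v) ^ (2 * k) \<le> real (l + k * N) ^ (2 * k)" by (intro power_mono) auto
          then show "real (gdist \<mu> u v) ^ (2 * k) / real n \<le> real (l + k * N) ^ (2 * k) / real 1"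
            using n by (intro frac_le) auto
        qed (use k in auto)
        then have 1: "1 \<le> exp T * exp (- 1 * decay_rate k n (real (gdist \<mu> u v)))"
          by (simp flip: exp_add)
        have "t \<le> real N powr (1 / real k)" unfolding t_def using nN by (intro powr_mono2) auto
        then have 2: "t ^ l \<le> (real N powr (1 / real k)) ^ l" using t by (intro power_mono) auto
        have "2 ^ l * D ^ i * t ^ l * 1 \<le> 2 ^ l * D ^ i * (real N powr (1 / real k)) ^ l * (exp T * exp (- 1 * decay_rate k n (real (gdist \<mu> u v))))"
          using 1 2 D t by (intro mult_mono) auto
        also have "\<dots> \<le> C * exp (- 1 * decay_rate k n (real (gdist \<mu> u v)))"
          unfolding C_def by (simp add: algebra_simps)
        finally have "2 ^ l * D ^ i * t ^ l \<le> C * exp (- 1 * decay_rate k n (real (gdist \<mu> u v)))" by simp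
        moreover have "0 < t ^ l" using t by simp
        ultimately show "2 ^ l * D ^ i \<le> C * exp (- 1 * decay_rate k n (real (gdist \<mu> u v))) / t ^ l"
          by (simp only: pos_le_divide_eq)
      qed (use m_pos[of v] vols in auto)
      also have "\<dots> = C * m v / (t ^ l * sqrt (vol u r * vol v r)) * exp (- 1 * decay_rate k n (real (gdist \<mu> u v)))"
        by simp
      finally show ?thesis unfolding p_def t_def r_def .
    qed
  qed
  then show ?thesis using that C by blast
qed

end

theorem theorem4p5:
  fixes \<mu> :: "'a::countable \<Rightarrow> 'a \<Rightarrow> real"
    and D\<^sub>X P\<^sub>X a :: real and r\<^sub>0 :: ereal and k l :: nat
  assumes "weighted_graph \<mu>"
    and "0 < r\<^sub>0"
    and "doubling \<mu> D\<^sub>X r\<^sub>0"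
    and "poincare \<mu> P\<^sub>X r\<^sub>0"
    and "1 \<le> k"
    and "-1 < a" and "a < 1"
    and "l2_spectrum (vweight \<mu>) (markov_op \<mu>) \<subseteq> complex_of_real ` {a<..1}"
    and "(1 - a) / 2 < 2 powr (-1 + 1 / real k)"
  shows "\<exists>C\<^sub>5 c\<^sub>5 :: real. 0 < C\<^sub>5 \<and> 0 < c\<^sub>5 \<and>
    (\<forall>n::nat. \<forall>r::real. \<forall>u v.
       1 \<le> n \<and> r = real n powr (1 / (2 * real k)) \<and> ereal r < r\<^sub>0 \<longrightarrow>
       \<bar>poly_kernel \<mu> ([:1, -1:] ^ l * (1 - [:1, -1:] ^ k) ^ n) u v\<bar>
       \<le> C\<^sub>5 * vweight \<mu> v
           / (real n powr (real l / real k)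
              * sqrt (enn2real (gmeasure \<mu> (gball \<mu> r u)) * enn2real (gmeasure \<mu> (gball \<mu> r v))))
         * exp (- c\<^sub>5 * (real (gdist \<mu> u v) / real n powr (1 / (2 * real k)))
                        powr (2 * real k / (2 * real k - 1))))"
proof (cases "r\<^sub>0 \<le> 1")
  case True
  \<comment> \<open>For \<open>n >= 1\<close> the radius is at least 1, so the claim is vacuous
    here.\<close>
  have "\<not> ereal (real n powr (1 / (2 * real k))) < r\<^sub>0" if "1 \<le> n" for n :: nat
  proof -
    have "1 \<le> real n powr (1 / (2 * real k))" using that by (intro ge_one_powr_ge_zero) auto
    then have "1 \<le> ereal (real n powr (1 / (2 * real k)))" by simp
    then show ?thesis using True by (meson not_less order_trans)
  qed
  then show ?thesis by (intro exI[of _ 1]) auto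
next
  case False
  then have r0: "1 < r\<^sub>0" by simp
  interpret locally_finite_graph \<mu>
    by unfold_locales (use assms doubling_imp_locally_finite[OF assms(1,3) r0] in auto)
  interpret spectral_graph \<mu> a
    by unfold_locales (use assms spectrum_lower_bound in auto)
  \<comment> \<open>The hypothesis on \<open>a\<close>, doubled and raised to the power
    \<open>k\<close>; it keeps \<open>1 - x ^ k\<close> above -1 on the whole spectral
    interval.\<close>
  have L: "(1 - a) ^ k < 2"
  proof -
    have "2 powr (-1 + 1 / real k) = 2 powr (1 / real k) / (2::real)" 
      unfolding powr_add by (simp add: powr_minus)
    then have "1 - a < 2 powr (1 / real k)" using assms(9) by simp
    then have "(1 - a) ^ k < (2 powr (1 / real k)) ^ k" using assms(5,7) by (intro power_strict_mono) auto
    also have "\<dots> = 2" using assms(5) by (simp add: powr_realpow[symmetric] powr_powr)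
    finally show ?thesis .
  qed
  obtain C c where C: "0 < C" and c: "0 < c" and bound:
    "\<And>n u v. 1 \<le> n \<Longrightarrow> ereal (real n powr (1 / (2 * real k))) < r\<^sub>0 \<Longrightarrow>
      kernel_bound k l C c n u v"
  proof (cases r\<^sub>0)
    \<comment> \<open>A finite range bounds the time, so only an infinite one calls for the heat
      kernel estimates.\<close>
    case (real \<rho>)
    have "vol u (2 * r) \<le> max D\<^sub>X 1 * vol u r" if "0 < r" "r < \<rho>" for r u
    proof -
      have "vol u (2 * r) \<le> max D\<^sub>X 0 * vol u r" using that real by (intro doubling_real[OF assms(3)]) auto
      also have "\<dots> \<le> max D\<^sub>X 1 * vol u r" using vol_pos[OF that(1), of u] by (intro mult_right_mono) auto
      finally show ?thesis .
    qed
    then obtain C where "0 < C" "\<And>n u v. 1 \<le> n \<Longrightarrow> real n powr (1 / (2 * real k)) < \<rho> \<Longrightarrow>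
      kernel_bound k l C 1 n u v"
      using off_diagonal_bounded_time[OF assms(5) L, of "max D\<^sub>X 1" \<rho> l] by (metis max.cobounded2)
    then show ?thesis using that[of C 1] real by simp
  next
    case PInf
    interpret heat_graph \<mu> "max D\<^sub>X 0" "max P\<^sub>X 0" a
      by unfold_locales (use doubling_real[OF assms(3)] poincare_real[OF assms(4)] PInf in auto)
    obtain C c where "0 < C" "0 < c" "\<And>n u v. 1 \<le> n \<Longrightarrow>
      kernel_bound k l C c n u v"
      by (rule off_diagonal[OF assms(5) L, of l]) blast
    then show ?thesis using that[of C c] by blast
  next
    case MInf
    then show ?thesis using assms(2) by simp
  qed
  show ?thesis
  proof (rule exI[of _ C], rule exI[of _ c], intro conjI allI impI C c)
    fix n :: nat and r :: real and u v
    assume n: "1 \<le> n \<and> r = real n powr (1 / (2 * real k)) \<and> ereal r < r\<^sub>0"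
    then have r: "0 < r" by simp
    have e: "(real n powr (1 / real k)) ^ l = real n powr (real l / real k)"
      using n by (simp add: powr_realpow[symmetric] powr_powr)
    have v: "enn2real (gmeasure \<mu> (gball \<mu> r x)) = vol x r" for x
      unfolding gmeasure_gball using vol_pos[OF r, of x] by simp
    show "\<bar>poly_kernel \<mu> ([:1, -1:] ^ l * (1 - [:1, -1:] ^ k) ^ n) u v\<bar>
       \<le> C * vweight \<mu> v
           / (real n powr (real l / real k)
              * sqrt (enn2real (gmeasure \<mu> (gball \<mu> r u)) * enn2real (gmeasure \<mu> (gball \<mu> r v))))
         * exp (- c * (real (gdist \<mu> u v) / real n powr (1 / (2 * real k)))
                        powr (2 * real k / (2 * real k - 1)))"
    proof -
      have "1 \<le> n" "ereal (real n powr (1 / (2 * real k))) < r\<^sub>0" "r = real n powr (1 / (2 * real k))"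
        using n by auto
      then show ?thesis
        using bound[of n u v] decay_rate_eq[of k n "real (gdist \<mu> u v)"] assms(5) unfolding v e by simp
    qed
  qed
qed

end
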